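(* Let $n\ge 0$, let $\mathbf{T}=(S^1)^n$ be a torus, let $\xi_{\mathbf{T}}$ be a covering over $\mathbf{T}$, and let $k\ge 0$ be an integer. Then $\xi_{\mathbf{T}}$ can be induced from a covering over a space of dimension at most $k$ if and only if the monodromy group of $\xi_{\mathbf{T}}$ (considered as an abstract group) can be represented as a direct sum of $k$ cyclic groups. Moreover, if $\xi_{\mathbf{T}}$ can be induced from a covering over some space of dimension at most $k$, then it can also be induced from a covering over the $k$-dimensional torus $(S^1)^k$.
   Context: A space is a topological space which admits a universal covering and is homotopy equivalent to a CW-complex. A space is of dimension at most $k$ (a "$k$-dimensional space" in the statement) if it is homotopy equivalent to a CW-complex with cells of dimension at most $k$. Maps are continuous. A covering $\xi_X$ over $X$ is a (surjective) covering map $p_X:(\tilde X,\tilde x_0)\to (X,x_0)$ of pointed spaces with $X$ connected; $\tilde X$ need not be connected and the number of sheets may be infinite. Its monodromy representation is the homomorphism $M_X:\pi_1(X,x_0)\to S(p_X^{-1}(x_0))$ to the group of permutations of the fiber given by lifting loops; the monodromy group is the image of $M_X$. A covering $\xi_X$ over $X$ is induced from a covering $\xi_Y$ over $Y$ by a map $f:X\to Y$ if $\xi_X$ is isomorphic, as a covering over $X$, to the pullback $f^*\xi_Y$. It can be induced from a covering over a space $Y$ if this holds for some $f:X\to Y$ and some covering $\xi_Y$ over $Y$. Trivial groups are allowed among the cyclic groups. *)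

theory Defs
  imports "HOL-Analysis.Analysis" "HOL-Algebra.Product_Groups" "HOL-Algebra.Bij"
begin

section \<open>Fundamental group\<close>

definition loops :: "'a topology \<Rightarrow> 'a \<Rightarrow> (real \<Rightarrow> 'a) set" where
  "loops X x = {g. pathin X g \<and> g 0 = x \<and> g 1 = x}"

text \<open>Paths are functions on all of \<^typ>\<open>real\<close>; values outside the unit interval are irrelevant,
  and a homotopy class contains every loop that agrees on the unit interval with one of its members.\<close>

definition loop_class :: "'a topology \<Rightarrow> 'a \<Rightarrow> (real \<Rightarrow> 'a) \<Rightarrow> (real \<Rightarrow> 'a) set" where
  "loop_class X x g =
     {h. homotopic_with (\<lambda>r. r 0 = x \<and> r 1 = x) (top_of_set {0..1}) X g h}"

definition concat_paths :: "(real \<Rightarrow> 'a) \<Rightarrow> (real \<Rightarrow> 'a) \<Rightarrow> real \<Rightarrow> 'a" where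
  "concat_paths g h = (\<lambda>t. if t \<le> 1/2 then g (2 * t) else h (2 * t - 1))"

definition fundamental_group :: "'a topology \<Rightarrow> 'a \<Rightarrow> (real \<Rightarrow> 'a) set monoid" where
  "fundamental_group X x =
     \<lparr>carrier = loop_class X x ` loops X x,
      monoid.mult = (\<lambda>A B. \<Union>g\<in>A. \<Union>h\<in>B. loop_class X x (concat_paths g h)),
      one = loop_class X x (\<lambda>_. x)\<rparr>"

definition simply_connected_space :: "'a topology \<Rightarrow> bool" where
  "simply_connected_space X \<longleftrightarrow>
     path_connected_space X \<and>
     (\<forall>x \<in> topspace X. carrier (fundamental_group X x) = {\<one>\<^bsub>fundamental_group X x\<^esub>})"


section \<open>Coverings\<close>

text \<open>The analogue for abstract topologies of \<^const>\<open>covering_space\<close>.\<close>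

definition covering_map :: "'e topology \<Rightarrow> 'a topology \<Rightarrow> ('e \<Rightarrow> 'a) \<Rightarrow> bool" where
  "covering_map E X p \<longleftrightarrow>
     continuous_map E X p \<and> p ` topspace E = topspace X \<and>
     (\<forall>x \<in> topspace X. \<exists>U. openin X U \<and> x \<in> U \<and>
        (\<exists>\<V>. \<Union>\<V> = {e \<in> topspace E. p e \<in> U} \<and> pairwise disjnt \<V> \<and>
             (\<forall>V \<in> \<V>. openin E V \<and>
                      homeomorphic_map (subtopology E V) (subtopology X U) p)))"

definition pointed_covering ::
  "'e topology \<Rightarrow> 'e \<Rightarrow> 'a topology \<Rightarrow> 'a \<Rightarrow> ('e \<Rightarrow> 'a) \<Rightarrow> bool" where
  "pointed_covering E e0 X x0 p \<longleftrightarrow>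
     connected_space X \<and> covering_map E X p \<and> e0 \<in> topspace E \<and> p e0 = x0"

definition covering_fiber :: "'e topology \<Rightarrow> 'a \<Rightarrow> ('e \<Rightarrow> 'a) \<Rightarrow> 'e set" where
  "covering_fiber E x0 p = {e \<in> topspace E. p e = x0}"

text \<open>A class \<open>c\<close> sends \<open>e\<close> to the starting point of the lift of \<open>c\<close> that ends at \<open>e\<close>. With products of
  paths read from left to right and \<^const>\<open>BijGroup\<close> multiplying by composition, this makes the
  monodromy a homomorphism. Lifting from the starting point instead composes it with inversion
  and has the same image.\<close>

definition monodromy ::
  "'e topology \<Rightarrow> 'a \<Rightarrow> ('e \<Rightarrow> 'a) \<Rightarrow> (real \<Rightarrow> 'a) set \<Rightarrow> ('e \<Rightarrow> 'e)" where
  "monodromy E x0 p c =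
     (\<lambda>e \<in> covering_fiber E x0 p. THE e'. \<exists>g. pathin E g \<and> p \<circ> g \<in> c \<and> g 0 = e' \<and> g 1 = e)"

definition monodromy_group ::
  "'e topology \<Rightarrow> 'a topology \<Rightarrow> 'a \<Rightarrow> ('e \<Rightarrow> 'a) \<Rightarrow> ('e \<Rightarrow> 'e) monoid" where
  "monodromy_group E X x0 p =
     (BijGroup (covering_fiber E x0 p))
       \<lparr>carrier := monodromy E x0 p ` carrier (fundamental_group X x0)\<rparr>"

definition isomorphic_coverings ::
  "'a topology \<Rightarrow> 'e topology \<Rightarrow> ('e \<Rightarrow> 'a) \<Rightarrow> 'f topology \<Rightarrow> ('f \<Rightarrow> 'a) \<Rightarrow> bool" where
  "isomorphic_coverings X E p F q \<longleftrightarrow>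
     covering_map E X p \<and> covering_map F X q \<and>
     (\<exists>h. homeomorphic_map E F h \<and> (\<forall>e \<in> topspace E. q (h e) = p e))"

text \<open>The projection of the pullback to \<open>X\<close> is \<^const>\<open>fst\<close>.\<close>

definition pullback_space ::
  "'a topology \<Rightarrow> ('a \<Rightarrow> 'y) \<Rightarrow> 'f topology \<Rightarrow> ('f \<Rightarrow> 'y) \<Rightarrow> ('a \<times> 'f) topology" where
  "pullback_space X f F q = subtopology (prod_topology X F) {(x, u). f x = q u}"

text \<open>The total space of the inducing covering is taken on the type \<open>'f\<close>.\<close>

definition inducible_from ::
  "'f itself \<Rightarrow> 'e topology \<Rightarrow> 'a topology \<Rightarrow> ('e \<Rightarrow> 'a) \<Rightarrow> 'y topology \<Rightarrow> bool" where
  "inducible_from _ E X p Y \<longleftrightarrow>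
     (\<exists>(F :: 'f topology) u0 y0 q f.
        pointed_covering F u0 Y y0 q \<and> continuous_map X Y f \<and>
        isomorphic_coverings X E p (pullback_space X f F q) fst)"


section \<open>CW-complexes and dimension\<close>

definition cw_disk :: "nat \<Rightarrow> (nat \<Rightarrow> real) set" where
  "cw_disk d = {x \<in> topspace (Euclidean_space d). (\<Sum>i<d. (x i)\<^sup>2) \<le> 1}"

definition cw_open_disk :: "nat \<Rightarrow> (nat \<Rightarrow> real) set" where
  "cw_open_disk d = {x \<in> topspace (Euclidean_space d). (\<Sum>i<d. (x i)\<^sup>2) < 1}"

text \<open>A cell is given by its dimension and its characteristic map. Two different characteristic maps
  in \<open>C\<close> have disjoint open cells, so indexing cells by their characteristic maps loses nothing.
  The last two conditions are closure-finiteness and the weak topology.\<close>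

definition cw_structure :: "'c topology \<Rightarrow> (nat \<times> ((nat \<Rightarrow> real) \<Rightarrow> 'c)) set \<Rightarrow> bool" where
  "cw_structure K C \<longleftrightarrow>
     Hausdorff_space K \<and>
     (\<forall>(d, \<phi>) \<in> C.
        continuous_map (subtopology (Euclidean_space d) (cw_disk d)) K \<phi> \<and>
        homeomorphic_map (subtopology (Euclidean_space d) (cw_open_disk d))
                         (subtopology K (\<phi> ` cw_open_disk d)) \<phi>) \<and>
     (\<Union>(d, \<phi>) \<in> C. \<phi> ` cw_open_disk d) = topspace K \<and>
     pairwise (\<lambda>(d, \<phi>) (d', \<phi>'). disjnt (\<phi> ` cw_open_disk d) (\<phi>' ` cw_open_disk d')) C \<and>
     (\<forall>(d, \<phi>) \<in> C. \<exists>D \<subseteq> C. finite D \<and> (\<forall>(d', \<phi>') \<in> D. d' < d) \<and>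
        \<phi> ` (cw_disk d - cw_open_disk d) \<subseteq> (\<Union>(d', \<phi>') \<in> D. \<phi>' ` cw_open_disk d')) \<and>
     (\<forall>A \<subseteq> topspace K. (\<forall>(d, \<phi>) \<in> C. closedin K (A \<inter> \<phi> ` cw_disk d)) \<longrightarrow> closedin K A)"

text \<open>The type \<^typ>\<open>(real \<Rightarrow> 'y) set\<close> loses no generality: mapping a point \<open>u\<close> of a simply connected
  covering space to the set of projections of all paths from a fixed point to \<open>u\<close> is injective.\<close>

definition admits_universal_covering :: "'y topology \<Rightarrow> bool" where
  "admits_universal_covering Y \<longleftrightarrow>
     (\<exists>(U :: (real \<Rightarrow> 'y) set topology) p. simply_connected_space U \<and> covering_map U Y p)"

text \<open>The CW-complex is taken on the type \<open>'c\<close>.\<close>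

definition space_of_dim_at_most :: "'c itself \<Rightarrow> nat \<Rightarrow> 'y topology \<Rightarrow> bool" where
  "space_of_dim_at_most _ k Y \<longleftrightarrow>
     admits_universal_covering Y \<and>
     (\<exists>(K :: 'c topology) C. cw_structure K C \<and> (\<forall>(d, \<phi>) \<in> C. d \<le> k) \<and>
        Y homotopy_equivalent_space K)"

text \<open>The types carry the base \<open>Y\<close>, the CW-complex, and the total space over \<open>Y\<close>, respectively. As one
  cannot quantify over types inside a formula, a necessary condition for inducibility has to be stated
  for arbitrary types, and a sufficient one for some types.\<close>

definition inducible_from_dim_at_most ::
  "'y itself \<Rightarrow> 'c itself \<Rightarrow> 'f itself \<Rightarrow> nat \<Rightarrow>
   'e topology \<Rightarrow> 'a topology \<Rightarrow> ('e \<Rightarrow> 'a) \<Rightarrow> bool" where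
  "inducible_from_dim_at_most _ _ _ k E X p \<longleftrightarrow>
     (\<exists>Y :: 'y topology. space_of_dim_at_most TYPE('c) k Y \<and> inducible_from TYPE('f) E X p Y)"


section \<open>Tori and sums of cyclic groups\<close>

definition torus :: "nat \<Rightarrow> (nat \<Rightarrow> complex) topology" where
  "torus n = product_topology (\<lambda>_. top_of_set (sphere 0 1)) {..<n}"

text \<open>Every cyclic group is isomorphic to one with elements of type \<^typ>\<open>int\<close>.\<close>

definition direct_sum_of_cyclic_groups :: "nat \<Rightarrow> 'g monoid \<Rightarrow> bool" where
  "direct_sum_of_cyclic_groups k G \<longleftrightarrow>
     (\<exists>C :: nat \<Rightarrow> int monoid. (\<forall>i<k. group (C i) \<and> cyclic_group (C i)) \<and>
        G \<cong> sum_group {..<k} C)"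

end

theory Submission
  imports Defs
begin

text \<open>
  The lifts of the exponential map from Euclidean space to the total space of a covering of the \<open>n\<close>-torus
  have a lattice \<open>L\<close> of common periods, and the monodromy group is the quotient of the integer lattice by \<open>L\<close>.

  If \<open>L\<close> and \<open>k\<close> further vectors generate the integer lattice, then these vectors define a linear map \<open>B\<close>
  from the \<open>k\<close>-torus to the \<open>n\<close>-torus. Writing the unit vectors in terms of them modulo \<open>L\<close> gives a map \<open>A\<close>
  in the other direction such that \<open>B A\<close> is the identity modulo \<open>L\<close>. So \<open>A\<close> induces the covering from its
  own pullback along \<open>B\<close>.

  Conversely, let \<open>f\<close> induce the covering from a covering over a space \<open>Y\<close> that is homotopy equivalent to a
  \<open>k\<close>-dimensional complex. Over the preimage of an open cell \<open>f\<close> is homotopic to a constant, hence lifts to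
  the universal covering of \<open>Y\<close>. Comparing these lifts with those of \<open>f\<close> on Euclidean space gives, for each
  \<open>i \<le> k\<close>, a locally constant equivariant function with values in the integer lattice modulo \<open>L\<close> on the set
  of points that are mapped into open \<open>i\<close>-cells. If more than \<open>k\<close> invariant factors of the quotient were
  nontrivial, then \<open>k + 1\<close> of them would have a common divisor \<open>q \<noteq> 1\<close>, and coordinates of the functions
  would give \<open>k + 1\<close> integer functions on a fine periodic grid such that on every small cube one of them is
  constant modulo \<open>q\<close>. The cup product of their coboundaries is then divisible by \<open>q\<close> on every cube, but its
  sum over a period is \<open>1\<close>.
\<close>

section \<open>Coverings and lifts\<close>

text \<open>The sets of points that are mapped into open cells of one dimension are in general
  neither open nor closed, so they do not form an open cover of the torus. What survives is that the
  cells of one dimension are separated from each other within their union. The integer functions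
  therefore live on these sets only, and are extended to neighbourhoods modulo \<open>q\<close>
  afterwards. The count of sets is a Lebesgue covering argument made discrete: the product of
  \<open>k + 1\<close> coordinate classes of a torus is nonzero modulo every non-unit
  \<open>q\<close>. Working with divisibility instead of residue classes treats finite and infinite
  cyclic factors alike: an invariant factor \<open>0\<close> stands for an infinite cyclic group,
  congruence modulo \<open>0\<close> is equality, and \<open>q dvd 1\<close> fails for
  \<open>q = 0\<close> just as for \<open>q > 1\<close>. The divisibility chain of the Smith form
  makes a nontrivial invariant factor a common divisor of all later ones; an arbitrary diagonal form
  need not provide one modulus for all \<open>k + 1\<close> functions.\<close>

lemma continuous_map_eq_openin_nhds:
  assumes "\<And>x. x \<in> topspace X \<Longrightarrow> \<exists>W. openin X W \<and> x \<in> W \<and> continuous_map (subtopology X W) Y f"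
  shows "continuous_map X Y f"
proof -
  obtain W where W: "\<And>x. x \<in> topspace X \<Longrightarrow> openin X (W x) \<and> x \<in> W x \<and> continuous_map (subtopology X (W x)) Y f"
    using assms by metis
  show ?thesis
    by (rule pasting_lemma[where I = "topspace X" and T = W and f = "\<lambda>_. f"]) (use W in auto)
qed

lemma topspace_subtopology_openin: "openin X U \<Longrightarrow> topspace (subtopology X U) = U"
  by (simp add: inf_absorb2 openin_subset)

lemma continuous_map_in_topspace: "continuous_map X Y f \<Longrightarrow> x \<in> topspace X \<Longrightarrow> f x \<in> topspace Y"
  by (auto simp: continuous_map_def)

lemma covering_mapD:
  assumes "covering_map E X p"
  shows "continuous_map E X p" "p ` topspace E = topspace X"
  using assms by (auto simp: covering_map_def)

lemma covering_evenly:
  assumes "covering_map E X p" "x \<in> topspace X"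
  obtains U \<V> where "openin X U" "x \<in> U" "\<Union>\<V> = {e \<in> topspace E. p e \<in> U}" "pairwise disjnt \<V>"
    "\<And>V. V \<in> \<V> \<Longrightarrow> openin E V"
    "\<And>V. V \<in> \<V> \<Longrightarrow> homeomorphic_map (subtopology E V) (subtopology X U) p"
    "\<And>V. V \<in> \<V> \<Longrightarrow> inj_on p V"
proof -
  have "\<exists>U. openin X U \<and> x \<in> U \<and> (\<exists>\<V>. \<Union>\<V> = {e \<in> topspace E. p e \<in> U} \<and> pairwise disjnt \<V> \<and>
             (\<forall>V \<in> \<V>. openin E V \<and> homeomorphic_map (subtopology E V) (subtopology X U) p))"
    using assms unfolding covering_map_def by simp
  then obtain U \<V> where "openin X U" "x \<in> U" "\<Union>\<V> = {e \<in> topspace E. p e \<in> U}" "pairwise disjnt \<V>"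
    "\<forall>V \<in> \<V>. openin E V \<and> homeomorphic_map (subtopology E V) (subtopology X U) p"
    by (elim exE conjE)
  then have *: "openin X U" "x \<in> U" "\<Union>\<V> = {e \<in> topspace E. p e \<in> U}" "pairwise disjnt \<V>"
    "\<And>V. V \<in> \<V> \<Longrightarrow> openin E V \<and> homeomorphic_map (subtopology E V) (subtopology X U) p"
    by auto
  moreover have "inj_on p V" if "V \<in> \<V>" for V
  proof -
    have "topspace (subtopology E V) = V"
      using *(5)[OF that] by (simp only: topspace_subtopology_openin)
    then show ?thesis using *(5)[OF that] by (simp add: homeomorphic_map_def)
  qed
  ultimately show ?thesis by (intro that[of U \<V>]) simp_all
qed

text \<open>Keeps a single sheet through \<open>e\<close> together with its section, the form in
  which local arguments about lifts use a covering.\<close>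

lemma covering_local_inverse:
  assumes "covering_map E X p" "e \<in> topspace E"
  obtains U V s where "openin X U" "openin E V" "e \<in> V" "continuous_map (subtopology X U) E s"
    "\<And>v. v \<in> V \<Longrightarrow> p v \<in> U \<and> s (p v) = v" "\<And>u. u \<in> U \<Longrightarrow> s u \<in> V \<and> p (s u) = u"
proof -
  have "p e \<in> topspace X" using covering_mapD[OF assms(1)] assms(2) by auto
  then obtain U \<V> where
    U: "openin X U" "p e \<in> U" "\<Union>\<V> = {e \<in> topspace E. p e \<in> U}"
    and dU: "pairwise disjnt \<V>" and U': "\<And>V. V \<in> \<V> \<Longrightarrow> openin E V"
    "\<And>V. V \<in> \<V> \<Longrightarrow> homeomorphic_map (subtopology E V) (subtopology X U) p"
    "\<And>V. V \<in> \<V> \<Longrightarrow> inj_on p V"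
    by (rule covering_evenly[OF assms(1)]) (rule that)
  note U = U U'
  have "e \<in> \<Union>\<V>" unfolding U(3) using U(2) assms(2) by simp
  then obtain V where V: "V \<in> \<V>" "e \<in> V" by (elim UnionE)
  obtain s where s: "homeomorphic_maps (subtopology E V) (subtopology X U) p s"
    using U(5)[OF V(1)] homeomorphic_map_maps by blast
  have tV: "topspace (subtopology E V) = V" and tU: "topspace (subtopology X U) = U"
    using U(1) U(4)[OF V(1)] by (simp_all only: topspace_subtopology_openin)
  have sV: "continuous_map (subtopology X U) (subtopology E V) s"
    and pU: "continuous_map (subtopology E V) (subtopology X U) p"
    and inv: "\<And>v. v \<in> V \<Longrightarrow> s (p v) = v" "\<And>u. u \<in> U \<Longrightarrow> p (s u) = u"
    using s tU tV by (auto simp: homeomorphic_maps_def)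
  show ?thesis
  proof (rule that[of U V s])
    show "p v \<in> U \<and> s (p v) = v" if "v \<in> V" for v
      using inv(1)[OF that] continuous_map_image_subset_topspace[OF pU] that tU tV by auto
    show "s u \<in> V \<and> p (s u) = u" if "u \<in> U" for u
      using inv(2)[OF that] continuous_map_image_subset_topspace[OF sV] that tU tV by auto
    show "continuous_map (subtopology X U) E s"
      using sV continuous_map_into_fulltopology by blast
  qed (use U V in auto)
qed

text \<open>Near a point of agreement both maps take values in one sheet, where a local section
  recovers the value from its projection.\<close>

lemma lifts_agree_openin:
  assumes "covering_map E X p" "continuous_map S E g" "continuous_map S E h"
    and "\<And>s. s \<in> topspace S \<Longrightarrow> p (g s) = p (h s)"
  shows "openin S {s \<in> topspace S. g s = h s}"
proof (subst openin_subopen, intro ballI)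
  fix s assume s: "s \<in> {s \<in> topspace S. g s = h s}"
  then have "g s \<in> topspace E" using continuous_map_in_topspace[OF assms(2), of s] by simp
  then obtain U V r where U: "openin X U"
    and V: "openin E V" "g s \<in> V" and r: "continuous_map (subtopology X U) E r"
    and rV: "\<And>v. v \<in> V \<Longrightarrow> p v \<in> U \<and> r (p v) = v"
    and rU: "\<And>u. u \<in> U \<Longrightarrow> r u \<in> V \<and> p (r u) = u"
    by (rule covering_local_inverse[OF assms(1)]) (rule that)
  let ?T = "{x \<in> topspace S. g x \<in> V} \<inter> {x \<in> topspace S. h x \<in> V}"
  have "openin S ?T"
    using V(1) assms(2,3) by (auto intro: openin_continuous_map_preimage)
  moreover have "s \<in> ?T" using s V by auto
  moreover have "?T \<subseteq> {s \<in> topspace S. g s = h s}" using rV assms(4) by (auto) (metis)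
  ultimately show "\<exists>T. openin S T \<and> s \<in> T \<and> T \<subseteq> {s \<in> topspace S. g s = h s}" by blast
qed

text \<open>At a point of disagreement the two values lie over the same point in distinct sheets,
  and distinct sheets are disjoint.\<close>

lemma lifts_agree_closedin:
  assumes "covering_map E X p" "continuous_map S E g" "continuous_map S E h"
    and eq: "\<And>s. s \<in> topspace S \<Longrightarrow> p (g s) = p (h s)"
  shows "closedin S {s \<in> topspace S. g s = h s}"
proof -
  have "openin S {s \<in> topspace S. g s \<noteq> h s}"
  proof (subst openin_subopen, intro ballI)
    fix s assume s: "s \<in> {s \<in> topspace S. g s \<noteq> h s}"
    then have gs: "g s \<in> topspace E" "h s \<in> topspace E" using assms(2,3) by (auto simp: continuous_map_def)
    then have px: "p (g s) \<in> topspace X" using assms(1) by (auto simp: covering_map_def)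
    then obtain U \<V> where "openin X U" and
      U: "p (g s) \<in> U" "\<Union>\<V> = {e \<in> topspace E. p e \<in> U}" "pairwise disjnt \<V>"
      "\<And>V. V \<in> \<V> \<Longrightarrow> openin E V" and "\<And>V. V \<in> \<V> \<Longrightarrow> homeomorphic_map (subtopology E V) (subtopology X U) p"
      and Ui: "\<And>V. V \<in> \<V> \<Longrightarrow> inj_on p V"
      by (rule covering_evenly[OF assms(1)]) (rule that)
    note U = U Ui
    have "p (h s) \<in> U" using U(1) s eq by auto
    then have "g s \<in> \<Union>\<V>" "h s \<in> \<Union>\<V>" unfolding U(2) using U(1) gs by auto
    then obtain V V' where V: "V \<in> \<V>" "g s \<in> V" "V' \<in> \<V>" "h s \<in> V'"
      by (elim UnionE)
    have "V \<noteq> V'" using V inj_onD[OF U(5)[OF V(1)], of "g s" "h s"] s eq by auto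
    then have "disjnt V V'" using U(3) V by (auto simp: pairwise_def)
    let ?T = "{x \<in> topspace S. g x \<in> V} \<inter> {x \<in> topspace S. h x \<in> V'}"
    have "openin S ?T"
      using V U(4) assms(2,3) by (auto intro: openin_continuous_map_preimage)
    moreover have "s \<in> ?T" using s V by auto
    moreover have "?T \<subseteq> {s \<in> topspace S. g s \<noteq> h s}"
      using \<open>disjnt V V'\<close> by (auto simp: disjnt_def)
    ultimately show "\<exists>T. openin S T \<and> s \<in> T \<and> T \<subseteq> {s \<in> topspace S. g s \<noteq> h s}" by blast
  qed
  moreover have "topspace S - {s \<in> topspace S. g s = h s} = {s \<in> topspace S. g s \<noteq> h s}" by auto
  ultimately show ?thesis by (simp add: closedin_def)
qed

lemma lifts_unique:
  assumes "covering_map E X p" "connected_space S" "continuous_map S E g" "continuous_map S E h"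
    and "\<And>s. s \<in> topspace S \<Longrightarrow> p (g s) = p (h s)"
    and "a \<in> topspace S" "g a = h a" "s \<in> topspace S"
  shows "g s = h s"
proof -
  let ?A = "{s \<in> topspace S. g s = h s}"
  have "openin S ?A" "closedin S ?A"
    using lifts_agree_openin lifts_agree_closedin assms(1,3,4,5) by blast+
  then have "?A = {} \<or> ?A = topspace S"
    using assms(2) by (auto simp: connected_space_clopen_in)
  then show ?thesis using assms(6-8) by blast
qed

section \<open>Homotopy lifting\<close>

lemma continuous_map_cases_split_fst:
  fixes a b c :: real
  assumes "a \<le> b" "b \<le> c"
    and 1: "continuous_map (prod_topology (top_of_set {a..b}) S) E G1"
    and 2: "continuous_map (prod_topology (top_of_set {b..c}) S) E G2"
    and eq: "\<And>s. s \<in> topspace S \<Longrightarrow> G1 (b, s) = G2 (b, s)"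
  shows "continuous_map (prod_topology (top_of_set {a..c}) S) E (\<lambda>x. if fst x \<le> b then G1 x else G2 x)"
proof (rule continuous_map_cases_le)
  let ?P = "prod_topology (top_of_set {a..c}) S"
  show "continuous_map ?P euclideanreal fst"
    using continuous_map_fst continuous_map_into_fulltopology by blast
  have "subtopology ?P {x \<in> topspace ?P. fst x \<le> b} = subtopology ?P ({a..b} \<times> topspace S)"
    using assms by (intro arg_cong[of _ _ "subtopology ?P"]) auto
  also have "\<dots> = prod_topology (top_of_set {a..b}) S"
    using assms by (simp add: subtopology_Times subtopology_subtopology inf_absorb2)
  finally show "continuous_map (subtopology ?P {x \<in> topspace ?P. fst x \<le> b}) E G1" using 1 by simp
  have "subtopology ?P {x \<in> topspace ?P. b \<le> fst x} = subtopology ?P ({b..c} \<times> topspace S)"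
    using assms by (intro arg_cong[of _ _ "subtopology ?P"]) auto
  also have "\<dots> = prod_topology (top_of_set {b..c}) S"
    using assms by (simp add: subtopology_Times subtopology_subtopology inf_absorb2)
  finally show "continuous_map (subtopology ?P {x \<in> topspace ?P. b \<le> fst x}) E G2" using 2 by simp
  show "G1 x = G2 x" if "x \<in> topspace ?P" "fst x = b" for x
    using that eq by (cases x) auto
qed auto

text \<open>Time is cut by bisection. The neighbourhood of \<open>s0\<close> shrinks with every
  piece of time that is added, which is harmless because finitely many pieces suffice.\<close>

lemma homotopy_lifting_local:
  assumes cov: "covering_map E X p"
    and H: "continuous_map (prod_topology (top_of_set {0..1::real}) S) X H"
    and g: "continuous_map S E g" "\<And>s. s \<in> topspace S \<Longrightarrow> p (g s) = H (0, s)"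
    and s0: "s0 \<in> topspace S"
  shows "\<exists>N G. openin S N \<and> s0 \<in> N \<and> continuous_map (prod_topology (top_of_set {0..1}) (subtopology S N)) E G
     \<and> (\<forall>t\<in>{0..1}. \<forall>s\<in>N. p (G (t,s)) = H (t,s)) \<and> (\<forall>s\<in>N. G (0,s) = g s)"
proof -
  \<comment> \<open>The lift at time \<open>a\<close> and its neighbourhood are universally
    quantified, so that the end of one piece can serve as the start of the next.\<close>
  define P where "P a b \<longleftrightarrow> 0 \<le> a \<and> a \<le> b \<and> b \<le> 1 \<longrightarrow> (\<forall>N g. openin S N \<and> s0 \<in> N \<and> continuous_map (subtopology S N) E g \<and>
     (\<forall>s\<in>N. p (g s) = H (a,s)) \<longrightarrow>
     (\<exists>N' G. openin S N' \<and> s0 \<in> N' \<and> N' \<subseteq> N \<and> continuous_map (prod_topology (top_of_set {a..b}) (subtopology S N')) E G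
     \<and> (\<forall>t\<in>{a..b}. \<forall>s\<in>N'. p (G (t,s)) = H (t,s)) \<and> (\<forall>s\<in>N'. G (a,s) = g s)))" for a b :: real
  have "P 0 1"
  proof (rule Bolzano)
    fix a b c :: real assume P: "P a b" "P b c" "a \<le> b" "b \<le> c"
    show "P a c"
      unfolding P_def
    proof (intro impI allI, elim conjE)
      fix N g assume ac: "0 \<le> a" "a \<le> c" "c \<le> 1" and N: "openin S N" "s0 \<in> N" "continuous_map (subtopology S N) E g"
        "\<forall>s\<in>N. p (g s) = H (a,s)"
      from P(1)[unfolded P_def, rule_format, of N g] ac P(3,4) N
      obtain N1 G1 where 1: "openin S N1" "s0 \<in> N1" "N1 \<subseteq> N" 
        "continuous_map (prod_topology (top_of_set {a..b}) (subtopology S N1)) E G1"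
        "\<forall>t\<in>{a..b}. \<forall>s\<in>N1. p (G1 (t,s)) = H (t,s)" "\<forall>s\<in>N1. G1 (a,s) = g s" by auto
      have "continuous_map (subtopology S N1) E (G1 \<circ> (\<lambda>s. (b, s)))"
        by (rule continuous_map_compose[OF _ 1(4)], intro continuous_map_pairedI) (use P(3) in auto)
      with P(2)[unfolded P_def, rule_format, of N1 "\<lambda>s. G1 (b,s)"] ac P(3,4) 1
      obtain N2 G2 where 2: "openin S N2" "s0 \<in> N2" "N2 \<subseteq> N1" 
        "continuous_map (prod_topology (top_of_set {b..c}) (subtopology S N2)) E G2"
        "\<forall>t\<in>{b..c}. \<forall>s\<in>N2. p (G2 (t,s)) = H (t,s)" "\<forall>s\<in>N2. G2 (b,s) = G1 (b,s)" 
        by (auto simp: o_def)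
      have "continuous_map (prod_topology (top_of_set {a..b}) (subtopology S N2)) E G1"
        using 1(4) 2(3)
        by (metis continuous_map_from_subtopology inf.absorb_iff2 prod_topology_subtopology(2) subtopology_subtopology)
      from continuous_map_cases_split_fst[OF P(3,4) this 2(4)] 2(6)
      have "continuous_map (prod_topology (top_of_set {a..c}) (subtopology S N2)) E (\<lambda>x. if fst x \<le> b then G1 x else G2 x)"
        by simp
      then show "\<exists>N' G. openin S N' \<and> s0 \<in> N' \<and> N' \<subseteq> N \<and> continuous_map (prod_topology (top_of_set {a..c}) (subtopology S N')) E G
           \<and> (\<forall>t\<in>{a..c}. \<forall>s\<in>N'. p (G (t,s)) = H (t,s)) \<and> (\<forall>s\<in>N'. G (a,s) = g s)"
        using 1 2 P(3,4)
        by (intro exI[of _ N2] exI[of _ "\<lambda>x. if fst x \<le> b then G1 x else G2 x"]) (auto simp: subset_iff)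
    qed
  next
    fix x :: real assume x: "0 \<le> x" "x \<le> 1"
    have "H (x, s0) \<in> topspace X"
      using continuous_map_image_subset_topspace[OF H] x s0 by auto
    then obtain U \<V> where
      U: "openin X U" "H (x,s0) \<in> U" "\<Union>\<V> = {e \<in> topspace E. p e \<in> U}"
      and dU: "pairwise disjnt \<V>" and U': "\<And>V. V \<in> \<V> \<Longrightarrow> openin E V"
      "\<And>V. V \<in> \<V> \<Longrightarrow> homeomorphic_map (subtopology E V) (subtopology X U) p"
      "\<And>V. V \<in> \<V> \<Longrightarrow> inj_on p V"
      by (rule covering_evenly[OF cov]) (rule that)
    note U = U U'
    have "openin (prod_topology (top_of_set {0..1}) S) {z \<in> topspace (prod_topology (top_of_set {0..1}) S). H z \<in> U}"
      using openin_continuous_map_preimage[OF H U(1)] .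
    moreover have "(x, s0) \<in> {z \<in> topspace (prod_topology (top_of_set {0..1}) S). H z \<in> U}"
      using x s0 U by auto
    ultimately obtain T N0 where T: "openin (top_of_set {0..1}) T" "openin S N0" "x \<in> T" "s0 \<in> N0"
      "T \<times> N0 \<subseteq> {z \<in> topspace (prod_topology (top_of_set {0..1}) S). H z \<in> U}"
      unfolding openin_prod_topology_alt by meson
    obtain d where d: "d > 0" "\<And>t. t \<in> {0..1} \<Longrightarrow> \<bar>t - x\<bar> < d \<Longrightarrow> t \<in> T"
      using T(1,3) unfolding openin_euclidean_subtopology_iff by (auto simp: dist_real_def)
    show "\<exists>d>0. \<forall>a b. a \<le> x \<and> x \<le> b \<and> b - a < d \<longrightarrow> P a b"
    proof (intro exI[of _ d] conjI d(1) allI impI, elim conjE)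
      fix a b assume ab: "a \<le> x" "x \<le> b" "b - a < d"
      show "P a b"
        unfolding P_def
      proof (intro impI allI, elim conjE)
        fix N g assume ac: "0 \<le> a" "a \<le> b" "b \<le> 1" and N: "openin S N" "s0 \<in> N" "continuous_map (subtopology S N) E g"
          "\<forall>s\<in>N. p (g s) = H (a,s)"
        have abT: "{a..b} \<subseteq> T" using d(2) ab ac by auto
        have NS: "N \<subseteq> topspace S" using N(1) openin_subset by blast
        have gE: "g s0 \<in> topspace E"
          using N(2) NS continuous_map_in_topspace[OF N(3), of s0] by auto
        have "a \<in> T" using abT ac by auto
        then have "(a, s0) \<in> T \<times> N0" using T(4) by blast
        then have "H (a, s0) \<in> U" using T(5) by blast
        then have "p (g s0) \<in> U" using N(2,4) by simp
        then have "g s0 \<in> \<Union>\<V>" unfolding U(3) using gE by simp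
        then obtain V where V: "V \<in> \<V>" "g s0 \<in> V" by (elim UnionE)
        obtain r where r: "homeomorphic_maps (subtopology E V) (subtopology X U) p r"
          using U(5)[OF V(1)] homeomorphic_map_maps by blast
        have tV: "topspace (subtopology E V) = V" and tU: "topspace (subtopology X U) = U"
          using U(1) U(4)[OF V(1)] by (simp_all only: topspace_subtopology_openin)
        \<comment> \<open>\<open>N'\<close> keeps the initial values in the sheet \<open>V\<close>
          and the homotopy in \<open>U\<close>; the inverse of \<open>p\<close> on \<open>V\<close>
          then lifts this piece of \<open>H\<close>.\<close>
        define N' where "N' = N0 \<inter> {s \<in> topspace (subtopology S N). g s \<in> V}"
        have "openin (subtopology S N) {s \<in> topspace (subtopology S N). g s \<in> V}"
          using openin_continuous_map_preimage[OF N(3) U(4)[OF V(1)]] .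
        then have oN': "openin S N'"
          unfolding N'_def using openin_Int[OF T(2) openin_trans_full[OF _ N(1)]] by simp
        have cr: "continuous_map (subtopology X U) E r"
          using r continuous_map_into_fulltopology by (auto simp: homeomorphic_maps_def)
        have HN: "continuous_map (prod_topology (top_of_set {a..b}) (subtopology S N')) (subtopology X U) H"
        proof (rule continuous_map_into_subtopology)
          have "prod_topology (top_of_set {a..b}) (subtopology S N') = subtopology (prod_topology (top_of_set {0..1}) S) ({a..b} \<times> N')"
            using ac by (simp add: subtopology_Times subtopology_subtopology inf_absorb2)
          then show "continuous_map (prod_topology (top_of_set {a..b}) (subtopology S N')) X H"
            using H continuous_map_from_subtopology by simp
          show "H \<in> topspace (prod_topology (top_of_set {a..b}) (subtopology S N')) \<rightarrow> U"
            using T(5) abT by (fastforce simp: N'_def)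
        qed
        have cG: "continuous_map (prod_topology (top_of_set {a..b}) (subtopology S N')) E (\<lambda>z. r (H z))"
          using continuous_map_compose[OF HN cr] by (simp add: o_def)
        have inU: "H (t,s) \<in> U" if "t \<in> {a..b}" "s \<in> N'" for t s
          using that T(5) abT by (fastforce simp: N'_def)
        have "p (r (H (t,s))) = H (t,s)" if "t \<in> {a..b}" "s \<in> N'" for t s
          using r tU inU[OF that] by (auto simp: homeomorphic_maps_def)
        moreover have "r (H (a,s)) = g s" if "s \<in> N'" for s
        proof -
          have "g s \<in> V" "p (g s) = H (a,s)" using that N(4) by (auto simp: N'_def)
          then show ?thesis using r tV by (metis homeomorphic_maps_def)
        qed
        moreover have "s0 \<in> N'" using T(4) N(2) V NS by (auto simp: N'_def)
        ultimately show "\<exists>N' G. openin S N' \<and> s0 \<in> N' \<and> N' \<subseteq> N \<and> continuous_map (prod_topology (top_of_set {a..b}) (subtopology S N')) E G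
           \<and> (\<forall>t\<in>{a..b}. \<forall>s\<in>N'. p (G (t,s)) = H (t,s)) \<and> (\<forall>s\<in>N'. G (a,s) = g s)"
          using oN' cG by (intro exI[of _ N'] exI[of _ "\<lambda>z. r (H z)"]) (auto simp: N'_def)
      qed
    qed
  qed auto
  from this[unfolded P_def, rule_format, of "topspace S" g] g s0
  show ?thesis by auto
qed

text \<open>For fixed \<open>s\<close> two local lifts are lifts of the same path with the same
  start, hence equal, so the local lifts paste together. The parameter space \<open>S\<close> is
  arbitrary, which later allows subspaces of the torus.\<close>

theorem homotopy_lifting:
  assumes cov: "covering_map E X p"
    and H: "continuous_map (prod_topology (top_of_set {0..1::real}) S) X H"
    and g: "continuous_map S E g" "\<And>s. s \<in> topspace S \<Longrightarrow> p (g s) = H (0, s)"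
  obtains G where "continuous_map (prod_topology (top_of_set {0..1}) S) E G"
    "\<And>t s. t \<in> {0..1} \<Longrightarrow> s \<in> topspace S \<Longrightarrow> p (G (t,s)) = H (t,s)" "\<And>s. s \<in> topspace S \<Longrightarrow> G (0,s) = g s"
proof -
  have "\<forall>s0\<in>topspace S. \<exists>N G. openin S N \<and> s0 \<in> N \<and> continuous_map (prod_topology (top_of_set {0..1}) (subtopology S N)) E G
     \<and> (\<forall>t\<in>{0..1}. \<forall>s\<in>N. p (G (t,s)) = H (t,s)) \<and> (\<forall>s\<in>N. G (0,s) = g s)"
    using homotopy_lifting_local[OF cov H g] by blast
  then obtain N where "\<forall>s0\<in>topspace S. \<exists>G. openin S (N s0) \<and> s0 \<in> N s0 \<and> continuous_map (prod_topology (top_of_set {0..1}) (subtopology S (N s0))) E G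
     \<and> (\<forall>t\<in>{0..1}. \<forall>s\<in>N s0. p (G (t,s)) = H (t,s)) \<and> (\<forall>s\<in>N s0. G (0,s) = g s)"
    unfolding bchoice_iff by blast
  then obtain G where "\<forall>s0\<in>topspace S. openin S (N s0) \<and> s0 \<in> N s0 \<and> continuous_map (prod_topology (top_of_set {0..1}) (subtopology S (N s0))) E (G s0)
     \<and> (\<forall>t\<in>{0..1}. \<forall>s\<in>N s0. p (G s0 (t,s)) = H (t,s)) \<and> (\<forall>s\<in>N s0. G s0 (0,s) = g s)"
    unfolding bchoice_iff by blast
  then have N: "openin S (N s0)" "s0 \<in> N s0"
    and G: "continuous_map (prod_topology (top_of_set {0..1}) (subtopology S (N s0))) E (G s0)"
     "\<And>t s. t\<in>{0..1} \<Longrightarrow> s\<in>N s0 \<Longrightarrow> p (G s0 (t,s)) = H (t,s)" "\<And>s. s\<in>N s0 \<Longrightarrow> G s0 (0,s) = g s"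
    if "s0 \<in> topspace S" for s0 using that by blast+
  let ?P = "prod_topology (top_of_set {0..1::real}) S"
  have agree: "G i (t,s) = G j (t,s)" if ij: "i \<in> topspace S" "j \<in> topspace S" "s \<in> N i" "s \<in> N j" and t: "t \<in> {0..1}" for i j s t
  proof -
    have sS: "s \<in> topspace S" using N(1)[OF ij(1)] ij(3) openin_subset by blast
    have *: "continuous_map (top_of_set {0..1}) E (\<lambda>t. G k (t, s))" if "k \<in> topspace S" "s \<in> N k" for k
    proof -
      have "continuous_map (top_of_set {0..1}) (prod_topology (top_of_set {0..1}) (subtopology S (N k))) (\<lambda>t. (t, s))"
        by (intro continuous_map_pairedI) (use that sS in \<open>auto simp: continuous_on_id\<close>)
      from continuous_map_compose[OF this G(1)[OF that(1)]] show ?thesis by (simp add: o_def)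
    qed
    show ?thesis
    proof (rule lifts_unique[OF cov, of "top_of_set {0..1}" _ _ "0"])
      show "connected_space (top_of_set {0..1::real})"
        using connectedin_absolute connectedin_def by (metis connected_Icc connectedin_iff_connected)
      show "p (G i (u, s)) = p (G j (u, s))" if "u \<in> topspace (top_of_set {0..1})" for u
        using that G(2) ij by simp
      show "G i (0, s) = G j (0, s)" using G(3) ij by simp
    qed (use * ij t in auto)
  qed
  define GG where "GG = (\<lambda>(t,s). G s (t,s))"
  have "continuous_map ?P E GG"
  proof (rule pasting_lemma[where I = "topspace S" and T = "\<lambda>s. {0..1} \<times> N s" and f = G])
    show "openin ?P ({0..1} \<times> N i)" if "i \<in> topspace S" for i
      using N(1)[OF that] by (metis openin_prod_Times_iff openin_topspace topspace_euclidean_subtopology)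
    show "continuous_map (subtopology ?P ({0..1} \<times> N i)) E (G i)" if "i \<in> topspace S" for i
      using G(1)[OF that] by (simp add: subtopology_Times subtopology_subtopology)
    show "G i x = G j x" if "i \<in> topspace S" "j \<in> topspace S" "x \<in> topspace ?P \<inter> {0..1} \<times> N i \<inter> {0..1} \<times> N j" for i j x
      using that agree[of i j "snd x" "fst x"] by (simp add: mem_Times_iff)
    show "\<exists>j. j \<in> topspace S \<and> x \<in> {0..1} \<times> N j \<and> GG x = G j x" if "x \<in> topspace ?P" for x
      using that N(2)[of "snd x"] by (intro exI[of _ "snd x"]) (simp add: mem_Times_iff GG_def case_prod_unfold)
  qed
  then show ?thesis
    by (rule that) (use G(2,3) N(2) in \<open>simp_all add: GG_def\<close>)
qed

lemma connected_space_unit_interval: "connected_space (top_of_set {0..1::real})"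
  by (metis connectedin_absolute connectedin_def connected_Icc connectedin_iff_connected)

text \<open>Homotopy lifting with a one-point space of parameters.\<close>

lemma path_lifting:
  assumes cov: "covering_map E X p" and g: "pathin X g" and e: "e \<in> topspace E" "p e = g 0"
  obtains h where "pathin E h" "\<And>t. t \<in> {0..1} \<Longrightarrow> p (h t) = g t" "h 0 = e"
proof -
  have H: "continuous_map (prod_topology (top_of_set {0..1::real}) (discrete_topology {()})) X (\<lambda>(t, s). g t)"
    using continuous_map_compose[OF continuous_map_fst[of "top_of_set {0..1::real}" "discrete_topology {()}"] g[unfolded pathin_def]]
    by (simp add: o_def case_prod_unfold)
  obtain G where G: "continuous_map (prod_topology (top_of_set {0..1::real}) (discrete_topology {()})) E G"
    "\<And>t s. t \<in> {0..1} \<Longrightarrow> p (G (t,s)) = g t" "\<And>s. G (0,s) = e"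
    using homotopy_lifting[OF cov H, of "\<lambda>_. e"] e by auto
  have "continuous_map (top_of_set {0..1}) (prod_topology (top_of_set {0..1::real}) (discrete_topology {()})) (\<lambda>t. (t, ()))"
    by (intro continuous_map_pairedI) (auto simp: continuous_on_id)
  from continuous_map_compose[OF this G(1)] have "pathin E (\<lambda>t. G (t, ()))"
    by (simp add: pathin_def o_def)
  then show ?thesis by (rule that) (use G in auto)
qed

lemma path_lifts_unique:
  assumes "covering_map E X p" "pathin E g" "pathin E h" "\<And>t. t \<in> {0..1} \<Longrightarrow> p (g t) = p (h t)"
    and "a \<in> {0..1}" "g a = h a" "t \<in> {0..1}"
  shows "g t = h t"
  by (rule lifts_unique[OF assms(1) connected_space_unit_interval, of g h a])
     (use assms in \<open>auto simp: pathin_def\<close>)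

lemma path_lifts_homotopic:
  assumes cov: "covering_map E X p" and g: "pathin E g" and h: "pathin E h"
    and hom: "homotopic_with (\<lambda>r. r 0 = x \<and> r 1 = y) (top_of_set {0..1}) X (p \<circ> g) (p \<circ> h)"
    and eq: "g 0 = h 0 \<or> g 1 = h 1"
  shows "g 0 = h 0 \<and> g 1 = h 1"
proof -
  obtain H where H: "continuous_map (prod_topology (top_of_set {0..1::real}) (top_of_set {0..1::real})) X H"
    "\<And>s. H (0, s) = p (g s)" "\<And>s. H (1, s) = p (h s)" "\<And>t. t \<in> {0..1} \<Longrightarrow> H (t, 0) = x \<and> H (t, 1) = y"
    using hom unfolding homotopic_with_def by (auto simp: o_def)
  obtain G where G: "continuous_map (prod_topology (top_of_set {0..1::real}) (top_of_set {0..1})) E G"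
    "\<And>t s. t \<in> {0..1} \<Longrightarrow> s \<in> {0..1} \<Longrightarrow> p (G (t,s)) = H (t,s)" "\<And>s. s \<in> {0..1} \<Longrightarrow> G (0,s) = g s"
    using homotopy_lifting[OF cov H(1) g[unfolded pathin_def]] H(2) by auto
  have path: "pathin E (\<lambda>t. G (t, s))" "pathin E (\<lambda>t. G (s, t))" if "s \<in> {0..1}" for s
  proof -
    have "continuous_map (top_of_set {0..1}) (prod_topology (top_of_set {0..1::real}) (top_of_set {0..1})) (\<lambda>t. (t, s))"
      "continuous_map (top_of_set {0..1}) (prod_topology (top_of_set {0..1::real}) (top_of_set {0..1})) (\<lambda>t. (s, t))"
      by (intro continuous_map_pairedI; use that in \<open>simp add: continuous_on_id\<close>)+
    from continuous_map_compose[OF this(1) G(1)] continuous_map_compose[OF this(2) G(1)]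
    show "pathin E (\<lambda>t. G (t, s))" "pathin E (\<lambda>t. G (s, t))" by (simp_all add: pathin_def o_def)
  qed
  have const: "G (t, s) = g s" if s: "s = 0 \<or> s = 1" and t: "t \<in> {0..1}" for s t
  proof (rule path_lifts_unique[OF cov path(1) _ _ _ _ t, of s "\<lambda>_. g s" 0])
    show "pathin E (\<lambda>_. g s)"
      using s continuous_map_image_subset_topspace[OF g[unfolded pathin_def]] by (auto simp: image_subset_iff)
    show "p (G (u, s)) = p (g s)" if u: "u \<in> {0..1}" for u
      using G(2)[OF u, of s] H(4)[of u] H(4)[of 0] H(2)[of s] s u by auto
  qed (use s G(3) in auto)
  have *: "G (1, s) = h s" if s: "s \<in> {0..1}" and a: "a = 0 \<or> a = 1" and ea: "g a = h a" for s a
  proof (rule path_lifts_unique[OF cov path(2) h _ _ _ s, of 1 a])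
    show "p (G (1, u)) = p (h u)" if u: "u \<in> {0..1}" for u
      using G(2)[of 1 u] H(3) u by simp
    show "G (1, a) = h a" using const[OF a, of 1] ea by simp
  qed (use a in auto)
  have "G (1, 0) = h 0 \<and> G (1, 1) = h 1"
    using eq *[of 0 0] *[of 1 0] *[of 0 1] *[of 1 1] by auto
  then show ?thesis using const[of 0 1] const[of 1 1] by auto
qed

text \<open>Serves \<open>lift_over_cell\<close>, where one of the two maps is constant and so has
  an evident lift.\<close>

lemma lift_exists_homotopic:
  assumes cov: "covering_map E X p" and hom: "homotopic_with (\<lambda>_. True) S X f f'"
    and g: "continuous_map S E g" "\<And>s. s \<in> topspace S \<Longrightarrow> p (g s) = f s"
  obtains g' where "continuous_map S E g'" "\<And>s. s \<in> topspace S \<Longrightarrow> p (g' s) = f' s"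
proof -
  obtain H where H: "continuous_map (prod_topology (top_of_set {0..1::real}) S) X H"
    "\<And>s. H (0, s) = f s" "\<And>s. H (1, s) = f' s"
    using hom unfolding homotopic_with_def by auto
  obtain G where G: "continuous_map (prod_topology (top_of_set {0..1::real}) S) E G"
    "\<And>t s. t \<in> {0..1} \<Longrightarrow> s \<in> topspace S \<Longrightarrow> p (G (t,s)) = H (t,s)"
    using homotopy_lifting[OF cov H(1) g(1)] g(2) H(2) by metis
  have "continuous_map S (prod_topology (top_of_set {0..1::real}) S) (\<lambda>s. (1, s))"
    by (intro continuous_map_pairedI) auto
  from continuous_map_compose[OF this G(1)] have "continuous_map S E (\<lambda>s. G (1, s))" by (simp add: o_def)
  then show ?thesis by (rule that) (use G(2)[of 1] H(3) in auto)
qed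

section \<open>Pullbacks of coverings\<close>

lemma topspace_pullback_space:
  "topspace (pullback_space X f F q) = {(x, u). x \<in> topspace X \<and> u \<in> topspace F \<and> f x = q u}"
  by (auto simp: pullback_space_def)

lemma continuous_map_pullback_iff:
  "continuous_map S (pullback_space X f F q) h \<longleftrightarrow>
     continuous_map S X (fst \<circ> h) \<and> continuous_map S F (snd \<circ> h) \<and> (\<forall>s\<in>topspace S. f (fst (h s)) = q (snd (h s)))"
  unfolding pullback_space_def continuous_map_in_subtopology continuous_map_pairwise
  by (auto simp: o_def Pi_iff case_prod_unfold)

text \<open>The sheets over the preimage of an evenly covered set consist of the pairs with second
  component in a given sheet; the inverse on such a sheet is
  \<open>x \<mapsto> (x, r (f x))\<close>.\<close>

lemma covering_map_pullback:
  assumes cov: "covering_map F Y q" and f: "continuous_map X Y f"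
  shows "covering_map (pullback_space X f F q) X fst"
proof -
  let ?P = "pullback_space X f F q"
  have cf: "continuous_map ?P X fst" and cs: "continuous_map ?P F snd"
    by (auto simp: pullback_space_def intro: continuous_map_subtopology_fst continuous_map_subtopology_snd)
  show ?thesis
    unfolding covering_map_def
  proof (intro conjI ballI cf)
    show "fst ` topspace ?P = topspace X"
    proof (intro equalityI subsetI)
      fix x assume x: "x \<in> topspace X"
      then have "f x \<in> q ` topspace F"
        using f covering_mapD(2)[OF cov] by (auto simp: continuous_map_def)
      then obtain u where "u \<in> topspace F" "f x = q u" by auto
      then have "(x, u) \<in> topspace ?P" using x by (auto simp: topspace_pullback_space)
      then show "x \<in> fst ` topspace ?P" by force
    qed (auto simp: topspace_pullback_space)
    fix x assume x: "x \<in> topspace X"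
    then have "f x \<in> topspace Y" by (rule continuous_map_in_topspace[OF f])
    then obtain U \<V> where
      U: "openin Y U" "f x \<in> U" "\<Union>\<V> = {e \<in> topspace F. q e \<in> U}" "pairwise disjnt \<V>"
      "\<And>V. V \<in> \<V> \<Longrightarrow> openin F V"
      "\<And>V. V \<in> \<V> \<Longrightarrow> homeomorphic_map (subtopology F V) (subtopology Y U) q"
      "\<And>V. V \<in> \<V> \<Longrightarrow> inj_on q V"
      by (rule covering_evenly[OF cov]) (rule that)
    define U' where "U' = {x \<in> topspace X. f x \<in> U}"
    define W where "W V = {z \<in> topspace ?P. snd z \<in> V}" for V
    have oU': "openin X U'" unfolding U'_def using f U(1) by (rule openin_continuous_map_preimage)
    have tU': "topspace (subtopology X U') = U'" using oU' by (rule topspace_subtopology_openin)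
    have oW: "openin ?P (W V)" if "V \<in> \<V>" for V
      unfolding W_def using cs U(5)[OF that] by (rule openin_continuous_map_preimage)
    have "homeomorphic_map (subtopology ?P (W V)) (subtopology X U') fst" if V: "V \<in> \<V>" for V
    proof -
      obtain r where r: "homeomorphic_maps (subtopology F V) (subtopology Y U) q r"
        using U(6)[OF V] homeomorphic_map_maps by blast
      have tV: "topspace (subtopology F V) = V" and tU: "topspace (subtopology Y U) = U"
        using U(1) U(5)[OF V] by (simp_all only: topspace_subtopology_openin)
      have rV: "continuous_map (subtopology Y U) (subtopology F V) r"
        using r unfolding homeomorphic_maps_def by (elim conjE)
      have r': "continuous_map (subtopology Y U) F r" "\<And>v. v \<in> V \<Longrightarrow> r (q v) = v" "\<And>u. u \<in> U \<Longrightarrow> q (r u) = u"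
        using r continuous_map_into_fulltopology[OF rV] unfolding homeomorphic_maps_def tU tV by simp_all
      have r'4: "\<And>u. u \<in> U \<Longrightarrow> r u \<in> V"
        using continuous_map_in_topspace[OF rV] unfolding tU tV .
      have tW: "topspace (subtopology ?P (W V)) = W V"
        using oW[OF V] by (rule topspace_subtopology_openin)
      have VU: "q v \<in> U \<and> v \<in> topspace F" if "v \<in> V" for v using that V U(3) by blast
      have fU': "continuous_map (subtopology X U') (subtopology Y U) f"
        using f tU' by (auto simp: continuous_map_in_subtopology continuous_map_from_subtopology U'_def)
      have "homeomorphic_maps (subtopology ?P (W V)) (subtopology X U') fst (\<lambda>x. (x, r (f x)))"
        unfolding homeomorphic_maps_def tW tU'
      proof (intro conjI ballI)
        show "continuous_map (subtopology ?P (W V)) (subtopology X U') fst"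
          unfolding continuous_map_in_subtopology tW
          using cf continuous_map_from_subtopology VU
          by (auto simp: W_def U'_def topspace_pullback_space)
        show "continuous_map (subtopology X U') (subtopology ?P (W V)) (\<lambda>x. (x, r (f x)))"
          unfolding continuous_map_in_subtopology continuous_map_pullback_iff tU'
        proof (intro conjI ballI)
          show "continuous_map (subtopology X U') X (fst \<circ> (\<lambda>x. (x, r (f x))))"
            using continuous_map_id_subt[of X U'] by (simp add: o_def id_def)
          show "continuous_map (subtopology X U') F (snd \<circ> (\<lambda>x. (x, r (f x))))"
            using continuous_map_compose[OF fU' r'(1)] by (simp add: o_def)
          show "f (fst (s, r (f s))) = q (snd (s, r (f s)))" if "s \<in> U'" for s
            using that r'(3) by (auto simp: U'_def)
          show "(\<lambda>x. (x, r (f x))) \<in> U' \<rightarrow> W V"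
            using r'(3) r'4 VU by (auto simp: U'_def W_def topspace_pullback_space)
        qed
        show "(fst z, r (f (fst z))) = z" if "z \<in> W V" for z
          using that r'(2) by (auto simp: W_def topspace_pullback_space)
      qed auto
      then show ?thesis using homeomorphic_map_maps by blast
    qed
    moreover have "\<Union> (W ` \<V>) = {e \<in> topspace ?P. fst e \<in> U'}"
    proof (intro equalityI subsetI)
      fix e assume "e \<in> {e \<in> topspace ?P. fst e \<in> U'}"
      then have e: "e \<in> topspace ?P" "snd e \<in> \<Union>\<V>" using U(3) by (auto simp: U'_def topspace_pullback_space)
      then show "e \<in> \<Union> (W ` \<V>)" by (auto simp: W_def)
    next
      fix e assume "e \<in> \<Union> (W ` \<V>)"
      then have e: "e \<in> topspace ?P" "snd e \<in> \<Union>\<V>" by (auto simp: W_def)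
      then show "e \<in> {e \<in> topspace ?P. fst e \<in> U'}" unfolding U(3) by (auto simp: U'_def topspace_pullback_space)
    qed
    moreover have "pairwise disjnt (W ` \<V>)"
      using U(4) by (auto simp: pairwise_def W_def disjnt_def)
    ultimately show "\<exists>U. openin X U \<and> x \<in> U \<and> (\<exists>\<V>. \<Union> \<V> = {e \<in> topspace ?P. fst e \<in> U} \<and> pairwise disjnt \<V> \<and>
         (\<forall>V\<in>\<V>. openin ?P V \<and> homeomorphic_map (subtopology ?P V) (subtopology X U) fst))"
      using oU' x U(2) oW by (intro exI[of _ U'] conjI exI[of _ "W ` \<V>"]) (auto simp: U'_def)
  qed
qed

section \<open>Integer functions on a periodic grid\<close>

definition bump :: "nat \<Rightarrow> (nat \<Rightarrow> int) \<Rightarrow> nat \<Rightarrow> int" where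
  "bump d v = v(d := v d + 1)"

text \<open>The sign of the permutation that moves \<open>d\<close> to the front of the increasing
  enumeration of \<open>D\<close>.\<close>

definition shuffle_sign :: "nat \<Rightarrow> nat set \<Rightarrow> int" where
  "shuffle_sign d D = (-1) ^ card {x \<in> D. x < d}"

text \<open>The cubical cup product of the coboundaries of the functions in the list, evaluated on the cube
  with lowest corner \<open>v\<close> and edges in the directions \<open>D\<close>.\<close>

fun cup_product :: "((nat \<Rightarrow> int) \<Rightarrow> int) list \<Rightarrow> nat set \<Rightarrow> (nat \<Rightarrow> int) \<Rightarrow> int" where
  "cup_product [] D v = 1"
| "cup_product (h # hs) D v =
     (\<Sum>d\<in>D. shuffle_sign d D * (h (bump d v) - h v) * cup_product hs (D - {d}) (bump d v))"

lemma bump_commute: "bump d (bump c v) = bump c (bump d v)"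
  by (auto simp: bump_def fun_eq_iff)

text \<open>Deleting the smaller index lowers the count below the larger one by one; deleting the
  larger index leaves the count below the smaller one alone.\<close>

lemma shuffle_sign_less:
  assumes "finite D" "c \<in> D" "d \<in> D" "c < d"
  shows "shuffle_sign d D * shuffle_sign c (D - {d}) = - (shuffle_sign c D * shuffle_sign d (D - {c}))"
proof -
  have "{x \<in> D - {d}. x < c} = {x \<in> D. x < c}" using assms by auto
  then have 1: "shuffle_sign c (D - {d}) = shuffle_sign c D" by (simp add: shuffle_sign_def)
  have "{x \<in> D. x < d} = insert c {x \<in> D - {c}. x < d}" using assms by auto
  then have "card {x \<in> D. x < d} = Suc (card {x \<in> D - {c}. x < d})" using assms by simp
  then have 2: "shuffle_sign d D = - shuffle_sign d (D - {c})" by (simp add: shuffle_sign_def)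
  show ?thesis using 1 2 by (simp add: mult.commute)
qed

lemma shuffle_sign_antisym:
  assumes "finite D" "c \<in> D" "d \<in> D" "c \<noteq> d"
  shows "shuffle_sign d D * shuffle_sign c (D - {d}) = - (shuffle_sign c D * shuffle_sign d (D - {c}))"
  using shuffle_sign_less[of D c d] shuffle_sign_less[of D d c] assms by (cases "c < d") auto

lemma sum_pairs_swap:
  fixes f :: "'a \<Rightarrow> 'a \<Rightarrow> int"
  assumes "finite D"
  shows "(\<Sum>d\<in>D. \<Sum>c\<in>D - {d}. f d c) = (\<Sum>d\<in>D. \<Sum>c\<in>D - {d}. f c d)"
proof -
  have eq: "D - {d} = {c \<in> D. c \<noteq> d}" "D - {d} = {c \<in> D. d \<noteq> c}" for d by auto
  have "(\<Sum>d\<in>D. \<Sum>c\<in>D - {d}. f d c) = (\<Sum>d\<in>D. \<Sum>c | c \<in> D \<and> d \<noteq> c. f d c)" by (simp only: eq(2))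
  also have "\<dots> = (\<Sum>c\<in>D. \<Sum>d | d \<in> D \<and> d \<noteq> c. f d c)"
    using assms by (rule sum.swap_restrict) (rule assms)
  finally show ?thesis by (simp only: eq(1))
qed

text \<open>Renaming the two directions reverses the sign of the ordered pair, which is the source
  of the cancellations in \<open>cup_product_closed\<close>.\<close>

lemma sum_pairs_antisym:
  assumes "finite D"
  shows "(\<Sum>d\<in>D. \<Sum>c\<in>D - {d}. shuffle_sign d D * shuffle_sign c (D - {d}) * F d c) =
         - (\<Sum>d\<in>D. \<Sum>c\<in>D - {d}. shuffle_sign d D * shuffle_sign c (D - {d}) * F c d)"
proof -
  have "(\<Sum>d\<in>D. \<Sum>c\<in>D - {d}. shuffle_sign d D * shuffle_sign c (D - {d}) * F d c) =
        (\<Sum>d\<in>D. \<Sum>c\<in>D - {d}. shuffle_sign c D * shuffle_sign d (D - {c}) * F c d)"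
    by (rule sum_pairs_swap[OF assms])
  also have "\<dots> = (\<Sum>d\<in>D. \<Sum>c\<in>D - {d}. - (shuffle_sign d D * shuffle_sign c (D - {d}) * F c d))"
  proof (intro sum.cong refl)
    fix d c assume "d \<in> D" "c \<in> D - {d}"
    then have "shuffle_sign c D * shuffle_sign d (D - {c}) = - (shuffle_sign d D * shuffle_sign c (D - {d}))"
      using shuffle_sign_antisym[OF assms, of d c] by blast
    then show "shuffle_sign c D * shuffle_sign d (D - {c}) * F c d = - (shuffle_sign d D * shuffle_sign c (D - {d}) * F c d)"
      by (simp only: mult_minus_left)
  qed
  finally show ?thesis by (simp add: sum_negf)
qed

lemma sum_pairs_symmetric:
  assumes "finite D" "\<And>c d. F c d = F d c"
  shows "(\<Sum>d\<in>D. \<Sum>c\<in>D - {d}. shuffle_sign d D * shuffle_sign c (D - {d}) * F d c) = (0::int)"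
  using sum_pairs_antisym[OF assms(1), of F] assms(2) by simp

text \<open>Cocycles are preserved by the cup product with a coboundary. The double sum over pairs
  of directions splits into four sums according to the point at which \<open>h\<close> is taken.
  Symmetry kills the one at the far corner; induction, symmetry and antisymmetry dispose of the
  rest.\<close>

lemma cup_product_closed:
  assumes "finite D" "card D = length hs + 1"
  shows "(\<Sum>d\<in>D. shuffle_sign d D * (cup_product hs (D - {d}) (bump d v) - cup_product hs (D - {d}) v)) = 0"
  using assms
proof (induction hs arbitrary: D v)
  case Nil
  then show ?case by simp
next
  case (Cons h hs)
  let ?s = "\<lambda>d c. shuffle_sign d D * shuffle_sign c (D - {d})"
  let ?W = "\<lambda>d c. cup_product hs (D - {d} - {c})"
  have Wsym: "?W c d = ?W d c" for c d
    by (simp add: Diff_insert2[symmetric] insert_commute flip: Diff_insert)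
  have IH: "(\<Sum>c\<in>D - {d}. shuffle_sign c (D - {d}) * (?W d c (bump c u) - ?W d c u)) = 0" if "d \<in> D" for d u
    by (rule Cons.IH) (use Cons.prems that in auto)
  have expand: "(\<Sum>d\<in>D. shuffle_sign d D * (cup_product (h # hs) (D - {d}) (bump d v) - cup_product (h # hs) (D - {d}) v))
     = (\<Sum>d\<in>D. \<Sum>c\<in>D - {d}. ?s d c * ((h (bump c (bump d v)) - h (bump d v)) * ?W d c (bump c (bump d v))
          - (h (bump c v) - h v) * ?W d c (bump c v)))"
    by (simp add: sum_subtractf[symmetric] sum_distrib_left algebra_simps)
  also have "\<dots> = (\<Sum>d\<in>D. \<Sum>c\<in>D - {d}. ?s d c * (h (bump c (bump d v)) * ?W d c (bump c (bump d v))))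
       - (\<Sum>d\<in>D. \<Sum>c\<in>D - {d}. ?s d c * (h (bump d v) * ?W d c (bump c (bump d v))))
       - (\<Sum>d\<in>D. \<Sum>c\<in>D - {d}. ?s d c * (h (bump c v) * ?W d c (bump c v)))
       + (\<Sum>d\<in>D. \<Sum>c\<in>D - {d}. ?s d c * (h v * ?W d c (bump c v)))"
    by (simp add: sum_subtractf[symmetric] sum.distrib[symmetric] algebra_simps)
  also have "(\<Sum>d\<in>D. \<Sum>c\<in>D - {d}. ?s d c * (h (bump c (bump d v)) * ?W d c (bump c (bump d v)))) = 0"
    by (rule sum_pairs_symmetric) (use Cons.prems in \<open>simp_all only: Wsym bump_commute\<close>)
  also have "(\<Sum>d\<in>D. \<Sum>c\<in>D - {d}. ?s d c * (h (bump c v) * ?W d c (bump c v))) =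
       - (\<Sum>d\<in>D. \<Sum>c\<in>D - {d}. ?s d c * (h (bump d v) * ?W d c (bump d v)))"
    using sum_pairs_antisym[OF Cons.prems(1), of "\<lambda>d c. h (bump c v) * ?W d c (bump c v)"]
    by (simp only: Wsym)
  \<comment> \<open>The factor \<open>h v\<close> does not depend on \<open>c\<close>, so the
    induction hypothesis moves \<open>?W\<close> from \<open>bump c v\<close> back to
    \<open>v\<close>, where the summand is symmetric.\<close>
  also have "(\<Sum>d\<in>D. \<Sum>c\<in>D - {d}. ?s d c * (h v * ?W d c (bump c v))) = 
       (\<Sum>d\<in>D. \<Sum>c\<in>D - {d}. ?s d c * (h v * ?W d c v))"
  proof (rule sum.cong[OF refl])
    fix d assume "d \<in> D"
    have "(\<Sum>c\<in>D - {d}. ?s d c * (h v * ?W d c (bump c v))) - (\<Sum>c\<in>D - {d}. ?s d c * (h v * ?W d c v))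
      = shuffle_sign d D * h v * (\<Sum>c\<in>D - {d}. shuffle_sign c (D - {d}) * (?W d c (bump c v) - ?W d c v))"
      by (simp add: sum_subtractf[symmetric] sum_distrib_left algebra_simps)
    then show "(\<Sum>c\<in>D - {d}. ?s d c * (h v * ?W d c (bump c v))) = (\<Sum>c\<in>D - {d}. ?s d c * (h v * ?W d c v))"
      using IH[OF \<open>d \<in> D\<close>] by simp
  qed
  also have "\<dots> = 0"
    by (rule sum_pairs_symmetric) (use Cons.prems in \<open>simp_all only: Wsym\<close>)
  \<comment> \<open>The same exchange at the base point \<open>bump d v\<close>; the result cancels
    against the term obtained by antisymmetry.\<close>
  also have "(\<Sum>d\<in>D. \<Sum>c\<in>D - {d}. ?s d c * (h (bump d v) * ?W d c (bump c (bump d v)))) =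
       (\<Sum>d\<in>D. \<Sum>c\<in>D - {d}. ?s d c * (h (bump d v) * ?W d c (bump d v)))"
  proof (rule sum.cong[OF refl])
    fix d assume "d \<in> D"
    have "(\<Sum>c\<in>D - {d}. ?s d c * (h (bump d v) * ?W d c (bump c (bump d v)))) - (\<Sum>c\<in>D - {d}. ?s d c * (h (bump d v) * ?W d c (bump d v)))
      = shuffle_sign d D * h (bump d v) * (\<Sum>c\<in>D - {d}. shuffle_sign c (D - {d}) * (?W d c (bump c (bump d v)) - ?W d c (bump d v)))"
      by (simp add: sum_subtractf[symmetric] sum_distrib_left algebra_simps)
    then show "(\<Sum>c\<in>D - {d}. ?s d c * (h (bump d v) * ?W d c (bump c (bump d v)))) = (\<Sum>c\<in>D - {d}. ?s d c * (h (bump d v) * ?W d c (bump d v)))"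
      using IH[OF \<open>d \<in> D\<close>] by simp
  qed
  finally show ?case by simp
qed

definition grid_cube :: "nat set \<Rightarrow> (nat \<Rightarrow> int) \<Rightarrow> (nat \<Rightarrow> int) set" where
  "grid_cube D v = {w. (\<forall>i\<in>D. w i = v i \<or> w i = v i + 1) \<and> (\<forall>i. i \<notin> D \<longrightarrow> w i = v i)}"

text \<open>Each summand contains a difference of the \<open>j\<close>-th function between points of
  the cube: either as its leading factor or, by induction, within the product on a face.\<close>

lemma cup_product_dvd:
  assumes "j < length hs" "\<And>w w'. w \<in> grid_cube D v \<Longrightarrow> w' \<in> grid_cube D v \<Longrightarrow> q dvd (hs ! j) w - (hs ! j) w'"
  shows "q dvd cup_product hs D v"
  using assms
proof (induction hs arbitrary: j D v)
  case (Cons h hs)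
  show ?case
    unfolding cup_product.simps
  proof (rule dvd_sum)
    fix d assume d: "d \<in> D"
    show "q dvd shuffle_sign d D * (h (bump d v) - h v) * cup_product hs (D - {d}) (bump d v)"
    proof (cases j)
      case 0
      have "bump d v \<in> grid_cube D v" "v \<in> grid_cube D v" using d by (auto simp: grid_cube_def bump_def)
      then have "q dvd h (bump d v) - h v" using Cons.prems(2) 0 by simp
      then show ?thesis by simp
    next
      case (Suc i)
      have sub: "grid_cube (D - {d}) (bump d v) \<subseteq> grid_cube D v"
      proof
        fix w assume "w \<in> grid_cube (D - {d}) (bump d v)"
        then have w: "\<And>i. i \<in> D \<Longrightarrow> i \<noteq> d \<Longrightarrow> w i = v i \<or> w i = v i + 1" "\<And>i. i \<notin> D \<Longrightarrow> w i = v i" "w d = v d + 1"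
          using d by (auto simp: grid_cube_def bump_def split: if_splits)
        show "w \<in> grid_cube D v" unfolding grid_cube_def using w by blast
      qed
      have "q dvd cup_product hs (D - {d}) (bump d v)"
      proof (rule Cons.IH)
        show "i < length hs" using Cons.prems(1) Suc by simp
        show "q dvd (hs ! i) w - (hs ! i) w'" if "w \<in> grid_cube (D - {d}) (bump d v)" "w' \<in> grid_cube (D - {d}) (bump d v)" for w w'
          using Cons.prems(2)[of w w'] Suc sub that by auto
      qed
      then show ?thesis by simp
    qed
  qed
qed simp

text \<open>Only differences of the listed functions enter, so additive constants picked up over a
  period drop out.\<close>

lemma cup_product_periodic:
  assumes "\<And>h. h \<in> set hs \<Longrightarrow> \<exists>c. \<forall>v. h (v(d := v d + N)) = h v + c"
  shows "cup_product hs D (v(d := v d + N)) = cup_product hs D v"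
  using assms
proof (induction hs arbitrary: D v)
  case (Cons h hs)
  have b: "bump c (v(d := v d + N)) = (bump c v)(d := bump c v d + N)" for c
    by (auto simp: bump_def fun_eq_iff)
  have "\<exists>c. \<forall>v. h (v(d := v d + N)) = h v + c" by (rule Cons.prems) simp
  then obtain c where "\<forall>v. h (v(d := v d + N)) = h v + c" ..
  then have hh: "h (v(d := v d + N)) = h v + c" for v by blast
  have IH: "cup_product hs D (v(d := v d + N)) = cup_product hs D v" for D v
    by (rule Cons.IH, rule Cons.prems) simp
  show ?case unfolding cup_product.simps b hh IH by simp
qed simp

text \<open>One period in the directions \<open>D\<close>. The other coordinates are frozen at
  \<open>0\<close>, so that directions can be split off one at a time.\<close>

definition grid_box :: "nat \<Rightarrow> nat set \<Rightarrow> (nat \<Rightarrow> int) set" where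
  "grid_box N D = {v. (\<forall>i\<in>D. 0 \<le> v i \<and> v i < int N) \<and> (\<forall>i. i \<notin> D \<longrightarrow> v i = 0)}"

lemma sum_grid_box_split:
  fixes g :: "(nat \<Rightarrow> int) \<Rightarrow> int"
  assumes "d \<in> D"
  shows "(\<Sum>v\<in>grid_box N D. g v) = (\<Sum>u\<in>grid_box N (D - {d}). \<Sum>t<N. g (u(d := int t)))"
proof -
  have "(\<Sum>u\<in>grid_box N (D - {d}). \<Sum>t<N. g (u(d := int t))) = (\<Sum>(u, t)\<in>grid_box N (D - {d}) \<times> {..<N}. g (u(d := int t)))"
    by (simp add: sum.cartesian_product)
  also have "\<dots> = (\<Sum>v\<in>grid_box N D. g v)"
  proof (rule sum.reindex_bij_witness[where i = "\<lambda>v. (v(d := 0), nat (v d))" and j = "\<lambda>(u, t). u(d := int t)"])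
    fix a assume "a \<in> grid_box N (D - {d}) \<times> {..<N}"
    then obtain u t where a: "a = (u, t)" "u \<in> grid_box N (D - {d})" "t < N" by auto
    then have "u d = 0" by (auto simp: grid_box_def)
    then have "u(d := 0) = u" by (auto simp: fun_eq_iff)
    then show "(((case a of (u, t) \<Rightarrow> u(d := int t))(d := 0), nat ((case a of (u, t) \<Rightarrow> u(d := int t)) d))) = a"
      using a by simp
    show "(case a of (u, t) \<Rightarrow> u(d := int t)) \<in> grid_box N D" using a assms by (auto simp: grid_box_def)
  next
    fix v assume v: "v \<in> grid_box N D"
    then have "0 \<le> v d" "v d < int N" using assms by (auto simp: grid_box_def)
    then show "(case (v(d := 0), nat (v d)) of (u, t) \<Rightarrow> u(d := int t)) = v" by (auto simp: fun_eq_iff)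
    show "(v(d := 0), nat (v d)) \<in> grid_box N (D - {d}) \<times> {..<N}"
      using v \<open>0 \<le> v d\<close> \<open>v d < int N\<close> by (auto simp: grid_box_def)
  qed auto
  finally show ?thesis by simp
qed

text \<open>Along every line in direction \<open>d\<close> the differences telescope to the two
  opposite faces of the box.\<close>

lemma sum_grid_box_telescope:
  fixes F :: "(nat \<Rightarrow> int) \<Rightarrow> int"
  assumes "d \<in> D"
  shows "(\<Sum>v\<in>grid_box N D. F (bump d v) - F v) = (\<Sum>u\<in>grid_box N (D - {d}). F (u(d := u d + int N)) - F u)"
  unfolding sum_grid_box_split[OF assms]
proof (rule sum.cong[OF refl])
  fix u assume u: "u \<in> grid_box N (D - {d})"
  then have ud: "u d = 0" by (auto simp: grid_box_def)
  then have u0: "u(d := 0) = u" by (auto simp: fun_eq_iff)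
  have "bump d (u(d := int t)) = u(d := int (Suc t))" for t by (auto simp: bump_def fun_eq_iff)
  then have "(\<Sum>t<N. F (bump d (u(d := int t))) - F (u(d := int t))) = (\<Sum>t<N. F (u(d := int (Suc t))) - F (u(d := int t)))"
    by simp
  also have "\<dots> = F (u(d := int N)) - F (u(d := int 0))" by (rule sum_lessThan_telescope)
  finally show "(\<Sum>t<N. F (bump d (u(d := int t))) - F (u(d := int t))) = F (u(d := u d + int N)) - F u"
    using u0 ud by simp
qed

text \<open>A discrete Stokes argument. The product of the coboundary of \<open>h\<close> with a
  cocycle is the coboundary of \<open>h\<close> times the cocycle, so the sum over the box reduces
  to pairs of opposite faces. There the cocycle is periodic and \<open>h\<close> jumps only in
  direction \<open>j\<close>, which leaves the same sum with one direction and one function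
  fewer.\<close>

lemma sum_cup_product_diagonal:
  assumes "length hs = m - j" "j \<le> m"
    and "\<And>i d v. i < length hs \<Longrightarrow> d < m \<Longrightarrow> (hs ! i) (v(d := v d + int N)) = (hs ! i) v + (if d = j + i then 1 else 0)"
  shows "(\<Sum>v\<in>grid_box N {j..<m}. cup_product hs {j..<m} v) = 1"
  using assms
proof (induction hs arbitrary: j)
  case Nil
  then have "grid_box N {j..<m} = {\<lambda>_. 0}" by (auto simp: grid_box_def)
  then show ?case by simp
next
  case (Cons h hs)
  let ?D = "{j..<m}"
  have j: "j < m" using Cons.prems by simp
  have D: "?D - {j} = {Suc j..<m}" by auto
  let ?W = "\<lambda>d. cup_product hs (?D - {d})"
  have per: "?W d (v(d := v d + int N)) = ?W d v" if "d < m" for d v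
  proof (rule cup_product_periodic)
    fix h' assume "h' \<in> set hs"
    then obtain i where "i < length hs" "h' = hs ! i" by (auto simp: in_set_conv_nth)
    then show "\<exists>c. \<forall>v. h' (v(d := v d + int N)) = h' v + c"
      using Cons.prems(3)[of "Suc i" d] that
      by (intro exI[of _ "if d = j + Suc i then 1 else 0"]) (simp only: nth_Cons_Suc length_Cons Suc_less_eq simp_thms)
  qed
  have hper: "h (v(d := v d + int N)) = h v + (if d = j then 1 else 0)" if "d < m" for d v
    using Cons.prems(3)[OF _ that, of 0 v] by (simp only: nth_Cons_0 length_Cons zero_less_Suc simp_thms add_0_right)
  have closed: "(\<Sum>d\<in>?D. shuffle_sign d ?D * (?W d (bump d v) - ?W d v)) = 0" for v
    by (rule cup_product_closed) (use Cons.prems in auto)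
  \<comment> \<open>The Leibniz rule, in which the term with the coboundary of the cocycle vanishes
    by \<open>closed\<close>.\<close>
  have "cup_product (h # hs) ?D v = (\<Sum>d\<in>?D. shuffle_sign d ?D * (h (bump d v) * ?W d (bump d v) - h v * ?W d v))" for v
  proof -
    have "cup_product (h # hs) ?D v = (\<Sum>d\<in>?D. shuffle_sign d ?D * (h (bump d v) * ?W d (bump d v) - h v * ?W d v))
       - h v * (\<Sum>d\<in>?D. shuffle_sign d ?D * (?W d (bump d v) - ?W d v))"
      by (simp add: sum_distrib_left sum_subtractf[symmetric] algebra_simps)
    then show ?thesis using closed by simp
  qed
  then have "(\<Sum>v\<in>grid_box N ?D. cup_product (h # hs) ?D v) =
      (\<Sum>v\<in>grid_box N ?D. \<Sum>d\<in>?D. shuffle_sign d ?D * (h (bump d v) * ?W d (bump d v) - h v * ?W d v))" by simp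
  also have "\<dots> = (\<Sum>d\<in>?D. shuffle_sign d ?D * (\<Sum>v\<in>grid_box N ?D. h (bump d v) * ?W d (bump d v) - h v * ?W d v))"
    by (subst sum.swap) (simp add: sum_distrib_left)
  also have "\<dots> = (\<Sum>d\<in>?D. if d = j then (\<Sum>u\<in>grid_box N (?D - {j}). ?W j u) else 0)"
  proof (rule sum.cong[OF refl])
    fix d assume d: "d \<in> ?D"
    \<comment> \<open>\<open>j\<close> is the least direction in \<open>?D\<close>, so its sign is
      positive.\<close>
    have "{x \<in> ?D. x < j} = {}" by auto
    then have sg: "shuffle_sign j ?D = 1" by (simp only: shuffle_sign_def card.empty power_0)
    have "(\<Sum>v\<in>grid_box N ?D. h (bump d v) * ?W d (bump d v) - h v * ?W d v)
      = (\<Sum>u\<in>grid_box N (?D - {d}). h (u(d := u d + int N)) * ?W d (u(d := u d + int N)) - h u * ?W d u)"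
      by (rule sum_grid_box_telescope[OF d, where F = "\<lambda>v. h v * ?W d v"])
    also have "\<dots> = (\<Sum>u\<in>grid_box N (?D - {d}). (if d = j then 1 else 0) * ?W d u)"
      using d by (intro sum.cong refl) (simp add: per hper algebra_simps)
    finally show "shuffle_sign d ?D * (\<Sum>v\<in>grid_box N ?D. h (bump d v) * ?W d (bump d v) - h v * ?W d v)
       = (if d = j then (\<Sum>u\<in>grid_box N (?D - {j}). ?W j u) else 0)"
      using sg by auto
  qed
  also have "\<dots> = (\<Sum>u\<in>grid_box N {Suc j..<m}. cup_product hs {Suc j..<m} u)"
    using j by (simp add: D)
  also have "\<dots> = 1"
  proof (rule Cons.IH)
    show "(hs ! i) (v(d := v d + int N)) = (hs ! i) v + (if d = Suc j + i then 1 else 0)" if "i < length hs" "d < m" for i d v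
      using Cons.prems(3)[of "Suc i" d v] that
      by (simp only: nth_Cons_Suc length_Cons Suc_less_eq simp_thms add_Suc_right add_Suc)
  qed (use Cons.prems j in auto)
  finally show ?case .
qed

theorem periodic_grid_nonconstant:
  fixes H :: "nat \<Rightarrow> (nat \<Rightarrow> int) \<Rightarrow> int"
  assumes per: "\<And>i d v. i < m \<Longrightarrow> d < m \<Longrightarrow> H i (v(d := v d + int N)) = H i v + (if d = i then 1 else 0)"
    and const: "\<And>v. v \<in> grid_box N {0..<m} \<Longrightarrow>
      \<exists>i<m. \<forall>w\<in>grid_cube {0..<m} v. \<forall>w'\<in>grid_cube {0..<m} v. q dvd H i w - H i w'"
  shows "q dvd 1"
proof -
  let ?hs = "map H [0..<m]"
  have "(\<Sum>v\<in>grid_box N {0..<m}. cup_product ?hs {0..<m} v) = 1"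
    by (rule sum_cup_product_diagonal) (use per in auto)
  moreover have "q dvd (\<Sum>v\<in>grid_box N {0..<m}. cup_product ?hs {0..<m} v)"
  proof (rule dvd_sum)
    fix v assume "v \<in> grid_box N {0..<m}"
    then obtain i where "i < m" "\<forall>w\<in>grid_cube {0..<m} v. \<forall>w'\<in>grid_cube {0..<m} v. q dvd H i w - H i w'"
      using const by blast
    then show "q dvd cup_product ?hs {0..<m} v"
      by (intro cup_product_dvd[of i]) auto
  qed
  ultimately show ?thesis by simp
qed

section \<open>Smith normal form of a sublattice\<close>

text \<open>Vectors are total functions that vanish from \<open>n\<close> on, in accordance with
  \<open>Euclidean_space\<close>, so they can be added to its points entrywise.\<close>

definition int_lattice :: "nat \<Rightarrow> (nat \<Rightarrow> int) set" where
  "int_lattice n = {z. \<forall>i\<ge>n. z i = 0}"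

text \<open>The single law for \<open>a + c * b\<close> packages sums, differences and
  multiples.\<close>

definition lattice_aut :: "nat \<Rightarrow> ((nat \<Rightarrow> int) \<Rightarrow> nat \<Rightarrow> int) \<Rightarrow> bool" where
  "lattice_aut n U \<longleftrightarrow> bij_betw U (int_lattice n) (int_lattice n) \<and>
     (\<forall>a\<in>int_lattice n. \<forall>b\<in>int_lattice n. \<forall>c. U (\<lambda>i. a i + c * b i) = (\<lambda>i. U a i + c * U b i))"

lemma int_lattice_zero: "(\<lambda>_. 0) \<in> int_lattice n"
  by (auto simp: int_lattice_def)

lemma lattice_aut_in: "lattice_aut n U \<Longrightarrow> a \<in> int_lattice n \<Longrightarrow> U a \<in> int_lattice n"
  by (auto simp: lattice_aut_def bij_betw_def)

lemma lattice_aut_comb: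
  "lattice_aut n U \<Longrightarrow> a \<in> int_lattice n \<Longrightarrow> b \<in> int_lattice n \<Longrightarrow> U (\<lambda>i. a i + c * b i) j = U a j + c * U b j"
  unfolding lattice_aut_def by metis

lemma lattice_aut_id: "lattice_aut n (\<lambda>a. a)"
  by (simp add: lattice_aut_def bij_betw_def)

lemma lattice_aut_compose:
  assumes "lattice_aut n U" "lattice_aut n V"
  shows "lattice_aut n (\<lambda>a. V (U a))"
proof -
  have "bij_betw (V \<circ> U) (int_lattice n) (int_lattice n)"
    using assms by (intro bij_betw_trans[of U _ "int_lattice n"]) (auto simp: lattice_aut_def)
  moreover have "V (U (\<lambda>i. a i + c * b i)) = (\<lambda>i. V (U a) i + c * V (U b) i)"
    if "a \<in> int_lattice n" "b \<in> int_lattice n" for a b c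
  proof -
    have "U (\<lambda>i. a i + c * b i) = (\<lambda>i. U a i + c * U b i)"
      using assms(1) that by (auto simp: lattice_aut_def)
    then show ?thesis using assms(2) lattice_aut_in[OF assms(1)] that by (auto simp: lattice_aut_def)
  qed
  ultimately show ?thesis by (auto simp: lattice_aut_def o_def)
qed

lemma lattice_aut_inverse_pair:
  assumes "\<And>a. a \<in> int_lattice n \<Longrightarrow> U a \<in> int_lattice n \<and> V a \<in> int_lattice n \<and> V (U a) = a \<and> U (V a) = a"
    and "\<And>a b c. a \<in> int_lattice n \<Longrightarrow> b \<in> int_lattice n \<Longrightarrow> U (\<lambda>i. a i + c * b i) = (\<lambda>i. U a i + c * U b i)"
  shows "lattice_aut n U"
proof -
  have "bij_betw U (int_lattice n) (int_lattice n)"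
    by (rule bij_betw_byWitness[where f' = V]) (use assms(1) in auto)
  then show ?thesis using assms(2) by (auto simp: lattice_aut_def)
qed

section \<open>Elementary automorphisms of the integer lattice\<close>

lemma lattice_aut_swap:
  assumes "i < n" "j < n"
  shows "lattice_aut n (\<lambda>a. a(i := a j, j := a i))"
  by (rule lattice_aut_inverse_pair[where V = "\<lambda>a. a(i := a j, j := a i)"])
     (use assms in \<open>auto simp: int_lattice_def fun_eq_iff\<close>)

lemma lattice_aut_clear:
  "lattice_aut n (\<lambda>a k. if 0 < k \<and> k < n then a k + c k * a 0 else a k)"
  by (rule lattice_aut_inverse_pair[where V = "\<lambda>a k. if 0 < k \<and> k < n then a k - c k * a 0 else a k"])
     (auto simp: int_lattice_def fun_eq_iff algebra_simps)

lemma lattice_aut_add: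
  assumes "0 < j" "j < n"
  shows "lattice_aut n (\<lambda>a. a(0 := a 0 + a j))"
  by (rule lattice_aut_inverse_pair[where V = "\<lambda>a. a(0 := a 0 - a j)"])
     (use assms in \<open>auto simp: int_lattice_def fun_eq_iff algebra_simps\<close>)

text \<open>Adds a fixed coordinate in front, as the induction on the rank requires.\<close>

lemma lattice_aut_Suc:
  assumes U: "lattice_aut n U"
  shows "lattice_aut (Suc n) (\<lambda>x. case_nat (x 0) (U (\<lambda>i. x (Suc i))))"
proof -
  let ?V = "inv_into (int_lattice n) U"
  have V: "?V a \<in> int_lattice n" "U (?V a) = a" "?V (U a) = a" if "a \<in> int_lattice n" for a
  proof -
    have b: "bij_betw U (int_lattice n) (int_lattice n)" using U by (simp add: lattice_aut_def)
    show "?V a \<in> int_lattice n" using bij_betw_inv_into[OF b] that by (rule bij_betwE[rule_format])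
    show "U (?V a) = a" "?V (U a) = a" using bij_betw_inv_into_right[OF b that] bij_betw_inv_into_left[OF b that] by simp_all
  qed
  have tl: "(\<lambda>i. x (Suc i)) \<in> int_lattice n" if "x \<in> int_lattice (Suc n)" for x
    using that by (auto simp: int_lattice_def)
  have cons: "case_nat c x \<in> int_lattice (Suc n)" if "x \<in> int_lattice n" for c x
    using that by (auto simp: int_lattice_def split: nat.split)
  have case_eta: "case_nat (x 0) (\<lambda>i. x (Suc i)) = x" for x :: "nat \<Rightarrow> int"
    by (auto simp: fun_eq_iff split: nat.split)
  show ?thesis
  proof (rule lattice_aut_inverse_pair[where V = "\<lambda>x. case_nat (x 0) (?V (\<lambda>i. x (Suc i)))"])
    fix x assume "x \<in> int_lattice (Suc n)"
    note t = tl[OF this]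
    show "case_nat (x 0) (U (\<lambda>i. x (Suc i))) \<in> int_lattice (Suc n) \<and>
      case_nat (x 0) (?V (\<lambda>i. x (Suc i))) \<in> int_lattice (Suc n) \<and>
      case_nat (case_nat (x 0) (U (\<lambda>i. x (Suc i))) 0) (?V (\<lambda>i. case_nat (x 0) (U (\<lambda>i. x (Suc i))) (Suc i))) = x \<and>
      case_nat (case_nat (x 0) (?V (\<lambda>i. x (Suc i))) 0) (U (\<lambda>i. case_nat (x 0) (?V (\<lambda>i. x (Suc i))) (Suc i))) = x"
      using V[OF t] cons lattice_aut_in[OF U t] by (simp add: case_eta)
  next
    fix a b c assume "a \<in> int_lattice (Suc n)" "b \<in> int_lattice (Suc n)"
    note t = tl[OF this(1)] tl[OF this(2)]
    show "case_nat (a 0 + c * b 0) (U (\<lambda>i. a (Suc i) + c * b (Suc i))) =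
      (\<lambda>i. case_nat (a 0) (U (\<lambda>i. a (Suc i))) i + c * case_nat (b 0) (U (\<lambda>i. b (Suc i))) i)"
      using lattice_aut_comb[OF U t] by (auto simp: fun_eq_iff split: nat.split)
  qed
qed

text \<open>Minimality over all bases replaces row and column reduction: a nonzero remainder of a
  division by \<open>d\<close> would be a smaller positive coordinate in some basis.\<close>

lemma sublattice_first_step:
  assumes L: "L \<subseteq> int_lattice n" "\<And>a b c. a \<in> L \<Longrightarrow> b \<in> L \<Longrightarrow> (\<lambda>i. a i + c * b i) \<in> L"
    and a0: "a0 \<in> L" "i0 < n" "a0 i0 \<noteq> 0"
  obtains V d a where "lattice_aut n V" "a \<in> L" "V a = (\<lambda>k. if k = 0 then int d else 0)" "0 < n" "0 < d"
    "\<And>b j. b \<in> L \<Longrightarrow> j < n \<Longrightarrow> int d dvd V b j"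
proof -
  (* d is the least positive coordinate of a vector of L in any basis of the lattice. *)
  define P where "P k \<longleftrightarrow> 0 < k \<and> (\<exists>U a i. lattice_aut n U \<and> a \<in> L \<and> i < n \<and> U a i = int k)" for k
  have L0: "(\<lambda>_. 0) \<in> L" using L(2)[of a0 a0 "-1"] a0 by simp
  have "P (nat \<bar>a0 i0\<bar>)"
  proof (cases "a0 i0 > 0")
    case True
    then show ?thesis unfolding P_def using lattice_aut_id a0 by fastforce
  next
    case False
    have m: "(\<lambda>i. - a0 i) \<in> L" using L(2)[OF L0 a0(1), of "-1"] by simp
    have "lattice_aut n (\<lambda>a. a) \<and> (\<lambda>i. - a0 i) \<in> L \<and> i0 < n \<and> - a0 i0 = int (nat \<bar>a0 i0\<bar>)"
      using False m a0 lattice_aut_id by simp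
    moreover have "0 < nat \<bar>a0 i0\<bar>" using a0 by simp
    ultimately show ?thesis unfolding P_def by (intro conjI exI[of _ "\<lambda>a. a"] exI[of _ "\<lambda>i. - a0 i"] exI[of _ i0]) auto
  qed
  define d where "d = (LEAST k. P k)"
  have Pd: "P d" unfolding d_def by (rule LeastI) fact
  have min: "r = 0" if "lattice_aut n U" "a \<in> L" "i < n" "U a i = r" "0 \<le> r" "r < int d" for U a i r
  proof (rule ccontr)
    assume "r \<noteq> 0"
    then have "P (nat r)" unfolding P_def using that by fastforce
    then have "d \<le> nat r" unfolding d_def by (rule Least_le)
    then show False using that by simp
  qed
  obtain U a i where U: "lattice_aut n U" "a \<in> L" "i < n" "U a i = int d" and d: "0 < d"
    using Pd by (auto simp: P_def)
  have n: "0 < n" using U by simp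
  define U1 where "U1 = (\<lambda>a. (U a)(0 := U a i, i := U a 0))"
  have U1: "lattice_aut n U1" unfolding U1_def by (rule lattice_aut_compose[OF U(1) lattice_aut_swap[OF n U(3)]])
  have U1a: "U1 a 0 = int d" using U(4) by (auto simp: U1_def)
  \<comment> \<open>After adding \<open>q k\<close> times coordinate \<open>0\<close>, coordinate
    \<open>k\<close> of \<open>a\<close> becomes its remainder modulo \<open>d\<close>, hence zero
    by minimality.\<close>
  define q where "q k = - (U1 a k div int d)" for k
  define V where "V = (\<lambda>a k. if 0 < k \<and> k < n then U1 a k + q k * U1 a 0 else U1 a k)"
  have V: "lattice_aut n V" unfolding V_def by (rule lattice_aut_compose[OF U1 lattice_aut_clear])
  have Va: "V a = (\<lambda>k. if k = 0 then int d else 0)"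
  proof
    fix k
    consider "k = 0" | "0 < k" "k < n" | "k \<ge> n" by linarith
    then show "V a k = (if k = 0 then int d else 0)"
    proof cases
      case 2
      have "V a k = U1 a k mod int d"
        using 2 U1a by (simp add: V_def q_def minus_div_mult_eq_mod[symmetric] mult.commute)
      then have "V a k = 0" using min[OF V U(2) 2(2), of "V a k"] d by simp
      then show ?thesis using 2 by simp
    next
      case 3
      have "V a \<in> int_lattice n" using lattice_aut_in[OF V] U(2) L(1) by auto
      then show ?thesis using 3 n by (auto simp: int_lattice_def)
    qed (use U1a in \<open>simp add: V_def\<close>)
  qed
  \<comment> \<open>Subtracting a multiple of \<open>a\<close> from \<open>b\<close> leaves the
    remainder of \<open>W b j\<close> modulo \<open>d\<close>, in any basis \<open>W\<close> where
    \<open>a\<close> has \<open>j\<close>-th coordinate \<open>d\<close>.\<close>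
  have red: "int d dvd W b j" if W: "lattice_aut n W" "b \<in> L" "j < n" "W a j = int d" for W b j
  proof -
    have in_l: "b \<in> int_lattice n" "a \<in> int_lattice n" using W U L by auto
    have "W (\<lambda>i. b i + (- (W b j div int d)) * a i) j = W b j mod int d"
      unfolding lattice_aut_comb[OF W(1) in_l] W(4) by (simp add: minus_div_mult_eq_mod[symmetric])
    then have "W b j mod int d = 0"
      using min[OF W(1) L(2)[OF W(2) U(2)] W(3), of "- (W b j div int d)" "W b j mod int d"] d by simp
    then show ?thesis by (simp add: dvd_eq_mod_eq_0)
  qed
  have "int d dvd V b j" if b: "b \<in> L" and j: "j < n" for b j
  proof (cases "j = 0")
    case True
    then show ?thesis using red[OF V b n] Va by simp
  next
    case False
    \<comment> \<open>Adding coordinate \<open>j\<close> to coordinate \<open>0\<close> keeps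
      coordinate \<open>0\<close> of \<open>a\<close> equal to \<open>d\<close>. So \<open>d\<close>
      divides both \<open>V b 0\<close> and \<open>V b 0 + V b j\<close>.\<close>
    have W: "lattice_aut n (\<lambda>a. (V a)(0 := V a 0 + V a j))"
      by (rule lattice_aut_compose[OF V lattice_aut_add]) (use False j in auto)
    have "int d dvd V b 0 + V b j" using red[OF W b n] Va False by simp
    moreover have "int d dvd V b 0" using red[OF V b n] Va by simp
    ultimately show ?thesis using dvd_add_right_iff by blast
  qed
  then show ?thesis using that[OF V U(2) Va n d] by blast
qed

text \<open>Induction on the rank: split off the coordinate that carries the minimal entry, and
  continue with the vectors of \<open>L\<close> that vanish there. An entry \<open>d i = 0\<close>
  forces the coordinate to vanish and thus yields an infinite cyclic factor of the quotient.\<close>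

theorem sublattice_smith_normal_form:
  assumes "L \<subseteq> int_lattice n" "(\<lambda>_. 0) \<in> L" "\<And>a b c. a \<in> L \<Longrightarrow> b \<in> L \<Longrightarrow> (\<lambda>i. a i + c * b i) \<in> L"
  shows "\<exists>U d. lattice_aut n U \<and> (\<forall>a\<in>int_lattice n. a \<in> L \<longleftrightarrow> (\<forall>i<n. int (d i) dvd U a i)) \<and>
     (\<forall>i. Suc i < n \<longrightarrow> d i dvd (d (Suc i) :: nat))"
  using assms
proof (induction n arbitrary: L)
  case 0
  then have "L = {\<lambda>_. 0}" by (auto simp: int_lattice_def)
  then show ?case using lattice_aut_id by (intro exI[of _ "\<lambda>a. a"]) (auto simp: int_lattice_def)
next
  case (Suc n)
  show ?case
  proof (cases "\<exists>a\<in>L. \<exists>i<Suc n. a i \<noteq> 0")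
    case False
    have "a \<in> L \<longleftrightarrow> (\<forall>i<Suc n. int 0 dvd a i)" if "a \<in> int_lattice (Suc n)" for a
    proof
      assume "\<forall>i<Suc n. int 0 dvd a i"
      then have "a i = 0" for i using that by (cases "i < Suc n") (auto simp: int_lattice_def)
      then have "a = (\<lambda>_. 0)" by (simp add: fun_eq_iff)
      then show "a \<in> L" using Suc.prems by simp
    qed (use False in auto)
    then show ?thesis using lattice_aut_id by (intro exI[of _ "\<lambda>a. a"] exI[of _ "\<lambda>_. 0"]) auto
  next
    case True
    then obtain a0 i0 where a0: "a0 \<in> L" "i0 < Suc n" "a0 i0 \<noteq> 0" by blast
    obtain V d a where V: "lattice_aut (Suc n) V" and a: "a \<in> L" and Va: "V a = (\<lambda>k. if k = 0 then int d else 0)"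
      and n: "0 < Suc n" and d: "0 < d" and dvd: "\<And>b j. b \<in> L \<Longrightarrow> j < Suc n \<Longrightarrow> int d dvd V b j"
      by (rule sublattice_first_step[OF Suc.prems(1) Suc.prems(3) a0]) (assumption+, rule that)
    define tl where "tl x = (\<lambda>i. x (Suc i))" for x :: "nat \<Rightarrow> int"
    define L' where "L' = {tl (V b) | b. b \<in> L \<and> V b 0 = 0}"
    have L'I: "x \<in> L'" if "b \<in> L" "V b 0 = 0" "x = tl (V b)" for b x using that by (auto simp: L'_def)
    have L'E: "\<exists>b. b \<in> L \<and> V b 0 = 0 \<and> x = tl (V b)" if "x \<in> L'" for x using that by (auto simp: L'_def)
    have inl: "b \<in> int_lattice (Suc n)" if "b \<in> L" for b using that Suc.prems by auto
    have comb: "V (\<lambda>i. x i + c * y i) = (\<lambda>i. V x i + c * V y i)" if "x \<in> int_lattice (Suc n)" "y \<in> int_lattice (Suc n)" for x y c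
      using V that by (auto simp: lattice_aut_def)
    have tlin: "tl x \<in> int_lattice n" if "x \<in> int_lattice (Suc n)" for x
      using that by (auto simp: int_lattice_def tl_def)
    have sub: "L' \<subseteq> int_lattice n"
      using tlin lattice_aut_in[OF V] inl by (auto simp: L'_def)
    have zero: "(\<lambda>_. 0) \<in> L'"
    proof -
      have "V (\<lambda>_. 0) = (\<lambda>_. 0)" using comb[OF inl[OF Suc.prems(2)] inl[OF Suc.prems(2)], of "-1"] by simp
      then have "(\<lambda>_. 0) = tl (V (\<lambda>_. 0))" "V (\<lambda>_. 0) 0 = 0" by (simp_all add: tl_def)
      then show ?thesis using L'I[OF Suc.prems(2)] by blast
    qed
    have closed: "(\<lambda>i. x i + c * y i) \<in> L'" if xy: "x \<in> L'" "y \<in> L'" for x y c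
    proof -
      obtain b b' where b: "b \<in> L" "b' \<in> L" "V b 0 = 0" "V b' 0 = 0" "x = tl (V b)" "y = tl (V b')"
        using L'E[OF xy(1)] L'E[OF xy(2)] by blast
      show ?thesis
        using L'I[OF Suc.prems(3)[OF b(1,2)], of c] comb[OF inl[OF b(1)] inl[OF b(2)], of c] b by (simp add: tl_def)
    qed
    obtain U' d' where U': "lattice_aut n U'" "\<And>x. x \<in> int_lattice n \<Longrightarrow> x \<in> L' \<longleftrightarrow> (\<forall>i<n. int (d' i) dvd U' x i)"
      "\<And>i. Suc i < n \<Longrightarrow> d' i dvd (d' (Suc i) :: nat)"
      using Suc.IH[OF sub zero closed] by blast
    define U where "U b = case_nat (V b 0) (U' (tl (V b)))" for b
    have U: "lattice_aut (Suc n) U"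
      unfolding U_def tl_def by (rule lattice_aut_compose[OF V lattice_aut_Suc[OF U'(1)]])
    have "b \<in> L \<longleftrightarrow> (\<forall>i<Suc n. int (case_nat d d' i) dvd U b i)" if b: "b \<in> int_lattice (Suc n)" for b
    proof -
      have "(\<forall>i<Suc n. int (case_nat d d' i) dvd U b i) \<longleftrightarrow> int d dvd V b 0 \<and> (\<forall>i<n. int (d' i) dvd U' (tl (V b)) i)"
        by (simp add: All_less_Suc2 U_def)
      also have "\<dots> \<longleftrightarrow> int d dvd V b 0 \<and> tl (V b) \<in> L'"
        using U'(2)[OF tlin[OF lattice_aut_in[OF V b]]] by simp
      also have "\<dots> \<longleftrightarrow> b \<in> L"
      proof
        assume bL: "b \<in> L"
        then have dv: "int d dvd V b 0" using dvd by simp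
        then obtain q where q: "V b 0 = int d * q" by auto
        \<comment> \<open>Removing this multiple of \<open>a\<close> kills the leading coordinate
          and leaves the tail unchanged, since \<open>V a\<close> has no other entry.\<close>
        let ?b = "\<lambda>i. b i + (-q) * a i"
        have "V ?b = (\<lambda>i. V b i + (-q) * V a i)" using comb[OF b inl[OF a]] .
        then have "tl (V b) = tl (V ?b)" "V ?b 0 = 0"
          using q Va by (simp_all add: tl_def)
        then show "int d dvd V b 0 \<and> tl (V b) \<in> L'" using dv L'I[OF Suc.prems(3)[OF bL a, of "-q"]] by simp
      next
        assume as: "int d dvd V b 0 \<and> tl (V b) \<in> L'"
        obtain b' where b1: "b' \<in> L" "V b' 0 = 0" "tl (V b) = tl (V b')"
          using L'E[OF conjunct2[OF as]] by blast
        obtain q where q: "V b 0 = int d * q" using as by blast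
        note b' = b1 q
        let ?b = "\<lambda>i. b' i + q * a i"
        have "V ?b = (\<lambda>i. V b' i + q * V a i)" using comb[OF inl[OF b'(1)] inl[OF a]] .
        moreover have "\<dots> = V b"
        proof
          fix i show "V b' i + q * V a i = V b i"
            using b' Va by (cases i) (auto simp: tl_def fun_eq_iff)
        qed
        ultimately have "V ?b = V b" by simp
        moreover have \<open>?b \<in> L\<close> using Suc.prems(3)[OF b'(1) a] .
        ultimately show "b \<in> L"
          using V b inl[OF \<open>?b \<in> L\<close>] inj_onD[of V "int_lattice (Suc n)" ?b b]
          by (simp add: bij_betw_def lattice_aut_def)
      qed
      finally show ?thesis by simp
    qed
    moreover have "case_nat d d' i dvd case_nat d d' (Suc i)" if i: "Suc i < Suc n" for i
    proof (cases i)
      case (Suc k)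
      then show ?thesis using U'(3)[of k] i by simp
    next
      case 0
      then have n0: "0 < n" using i by simp
      \<comment> \<open>The vector with sole entry \<open>d' 0\<close> comes from an element of
        \<open>L'\<close>, all of whose coordinates are multiples of \<open>d\<close>. Automorphisms
        preserve this divisibility, so \<open>d\<close> divides \<open>d' 0\<close>.\<close>
      let ?y = "\<lambda>k. if k = 0 then int (d' 0) else 0"
      have yl: "?y \<in> int_lattice n" using n0 by (auto simp: int_lattice_def)
      then have "?y \<in> U' ` int_lattice n" using U'(1) by (simp add: lattice_aut_def bij_betw_def)
      then obtain x where x: "x \<in> int_lattice n" "U' x = ?y" by (elim imageE) simp
      have "x \<in> L'" using U'(2)[OF x(1)] x(2) by simp
      then obtain b where b: "b \<in> L" "x = tl (V b)" using L'E by blast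
      have "int d dvd x k" for k
        using dvd[OF b(1), of "Suc k"] x(1) b(2) by (cases "k < n") (auto simp: tl_def int_lattice_def)
      then have xw: "x = (\<lambda>i. 0 + int d * (x i div int d))" by simp
      have wl: "(\<lambda>i. x i div int d) \<in> int_lattice n" using x(1) by (auto simp: int_lattice_def)
      have U0: "U' (\<lambda>_. 0) j = 0" for j
        using lattice_aut_comb[OF U'(1) int_lattice_zero int_lattice_zero, of "-1" j] by simp
      have "U' x 0 = U' (\<lambda>_. 0) 0 + int d * U' (\<lambda>i. x i div int d) 0"
        by (subst xw, rule lattice_aut_comb[OF U'(1) int_lattice_zero wl])
      then have "int d dvd int (d' 0)" using x(2) U0 by simp
      then show ?thesis using 0 by simp
    qed
    ultimately show ?thesis using U by (intro exI[of _ U] exI[of _ "case_nat d d'"]) auto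
  qed
qed

section \<open>The exponential covering of the torus\<close>

lemma continuous_map_Euclidean_space:
  "continuous_map X (Euclidean_space n) f \<longleftrightarrow>
     (\<forall>i<n. continuous_map X euclideanreal (\<lambda>x. f x i)) \<and> (\<forall>x\<in>topspace X. \<forall>i\<ge>n. f x i = 0)"
    (is "?L \<longleftrightarrow> ?R")
proof
  assume ?L
  then show ?R
    by (auto simp: Euclidean_space_def continuous_map_in_subtopology continuous_map_componentwise_UNIV)
next
  assume R: ?R
  have "continuous_map X euclideanreal (\<lambda>x. f x i)" for i
  proof (cases "i < n")
    case False
    then have "continuous_map X euclideanreal (\<lambda>x. 0) \<longleftrightarrow> continuous_map X euclideanreal (\<lambda>x. f x i)"
      by (intro iffI; elim continuous_map_eq) (use R in auto)
    then show ?thesis by simp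
  qed (use R in auto)
  then show ?L
    using R by (auto simp: Euclidean_space_def continuous_map_in_subtopology continuous_map_componentwise_UNIV)
qed

lemma continuous_map_Euclidean_coord: "continuous_map (Euclidean_space n) euclideanreal (\<lambda>x. x i)"
  unfolding Euclidean_space_def
  by (rule continuous_map_from_subtopology) (rule continuous_map_product_projection, simp)

lemma in_Euclidean_space: "x \<in> topspace (Euclidean_space n) \<longleftrightarrow> (\<forall>i\<ge>n. x i = 0)"
  by (simp add: topspace_Euclidean_space)

lemma topspace_torus: "w \<in> topspace (torus n) \<longleftrightarrow> w \<in> extensional {..<n} \<and> (\<forall>i<n. norm (w i) = 1)"
  by (auto simp: torus_def PiE_iff)

lemma continuous_map_torus:
  "continuous_map X (torus n) f \<longleftrightarrow>
     (\<forall>i<n. continuous_map X euclidean (\<lambda>x. f x i)) \<and> (\<forall>x\<in>topspace X. f x \<in> topspace (torus n))"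
proof -
  have "topspace (torus n) = {..<n} \<rightarrow>\<^sub>E sphere 0 1" by (simp add: torus_def)
  then show ?thesis
    unfolding torus_def continuous_map_componentwise
    by (auto simp: continuous_map_in_subtopology Pi_iff PiE_iff image_subset_iff)
qed

lemma continuous_map_torus_coord: "i < n \<Longrightarrow> continuous_map (torus n) euclidean (\<lambda>w. w i)"
  using continuous_map_torus[of "torus n" n "\<lambda>w. w"] by (metis continuous_map_id eq_id_iff)

text \<open>Normalized by \<open>2 * pi\<close> so that the fibres are the orbits of the integer
  lattice.\<close>

definition torus_exp :: "nat \<Rightarrow> (nat \<Rightarrow> real) \<Rightarrow> nat \<Rightarrow> complex" where
  "torus_exp n x = (\<lambda>i\<in>{..<n}. cis (2 * pi * x i))"

lemma torus_exp_in: "torus_exp n x \<in> topspace (torus n)"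
  by (simp add: topspace_torus torus_exp_def)

lemma continuous_map_torus_exp: "continuous_map (Euclidean_space n) (torus n) (torus_exp n)"
proof -
  have "continuous_map (Euclidean_space n) euclidean (\<lambda>x. cis (2 * pi * x i))" for i
  proof -
    have "continuous_map euclideanreal euclidean (\<lambda>t. cis (2 * pi * t))"
      by (simp add: continuous_intros)
    from continuous_map_compose[OF continuous_map_Euclidean_coord this] show ?thesis by (simp add: o_def)
  qed
  then show ?thesis by (simp add: continuous_map_torus torus_exp_in) (simp add: torus_exp_def)
qed

lemma torus_exp_surj:
  assumes "w \<in> topspace (torus n)"
  obtains x where "x \<in> topspace (Euclidean_space n)" "torus_exp n x = w"
proof -
  define x where "x i = (if i < n then Arg (w i) / (2 * pi) else 0)" for i
  have "cis (2 * pi * x i) = w i" if "i < n" for i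
  proof -
    have "norm (w i) = 1" "w i \<noteq> 0" using assms that by (auto simp: topspace_torus)
    then have "cis (Arg (w i)) = w i" by (simp add: cis_Arg sgn_eq)
    then show ?thesis using that by (simp add: x_def)
  qed
  then have "torus_exp n x = w"
    using assms by (auto simp: torus_exp_def topspace_torus extensional_def fun_eq_iff)
  moreover have "x \<in> topspace (Euclidean_space n)" by (simp add: in_Euclidean_space x_def)
  ultimately show ?thesis using that by blast
qed

lemma cis_2pi_eq_iff: "cis (2 * pi * a) = cis (2 * pi * b) \<longleftrightarrow> (\<exists>k::int. b = a + of_int k)"
proof -
  have "cis t = 1 \<longleftrightarrow> (\<exists>k::int. t = of_int k * (2 * pi))" for t
  proof
    assume "cis t = 1"
    then have "cos t = 1" by (metis cis.sel(1) one_complex.sel(1))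
    then show "\<exists>k::int. t = of_int k * (2 * pi)" unfolding cos_one_2pi_int by (simp add: mult.assoc)
  next
    assume "\<exists>k::int. t = of_int k * (2 * pi)"
    then obtain k :: int where "t = of_int k * (2 * pi)" by blast
    then have "cis t = cis (2 * pi * of_int k)" by (simp add: mult.commute)
    then show "cis t = 1" by (simp only: cis_multiple_2pi Ints_of_int)
  qed
  moreover have "cis (2 * pi * a) = cis (2 * pi * b) \<longleftrightarrow> cis (2 * pi * b - 2 * pi * a) = 1"
    unfolding cis_divide[symmetric] by auto
  ultimately have "cis (2 * pi * a) = cis (2 * pi * b) \<longleftrightarrow> (\<exists>k::int. 2 * pi * b - 2 * pi * a = of_int k * (2 * pi))"
    by simp
  also have "\<dots> \<longleftrightarrow> (\<exists>k::int. b = a + of_int k)"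
  proof -
    have "2 * pi * b - 2 * pi * a = of_int k * (2 * pi) \<longleftrightarrow> b = a + of_int k" for k :: int
    proof
      assume "2 * pi * b - 2 * pi * a = of_int k * (2 * pi)"
      then have "(2 * pi) * b = (2 * pi) * (a + of_int k)" by (simp add: algebra_simps)
      then show "b = a + of_int k" by (subst (asm) mult_cancel_left) simp
    qed (simp add: algebra_simps)
    then show ?thesis by blast
  qed
  finally show ?thesis .
qed

definition vec_shift :: "(nat \<Rightarrow> real) \<Rightarrow> (nat \<Rightarrow> int) \<Rightarrow> nat \<Rightarrow> real" where
  "vec_shift x z = (\<lambda>i. x i + of_int (z i))"

lemma vec_shift_in:
  "x \<in> topspace (Euclidean_space n) \<Longrightarrow> z \<in> int_lattice n \<Longrightarrow> vec_shift x z \<in> topspace (Euclidean_space n)"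
  by (simp add: in_Euclidean_space int_lattice_def vec_shift_def)

lemma vec_shift_add: "vec_shift (vec_shift x z) w = vec_shift x (\<lambda>i. z i + w i)"
  by (simp add: vec_shift_def fun_eq_iff)

lemma vec_shift_zero: "vec_shift x (\<lambda>_. 0) = x"
  by (simp add: vec_shift_def)

lemma torus_exp_eq_iff:
  assumes "x \<in> topspace (Euclidean_space n)" "y \<in> topspace (Euclidean_space n)"
  shows "torus_exp n x = torus_exp n y \<longleftrightarrow> (\<exists>z\<in>int_lattice n. y = vec_shift x z)"
proof
  assume "torus_exp n x = torus_exp n y"
  then have "\<forall>i<n. cis (2 * pi * x i) = cis (2 * pi * y i)"
    by (metis torus_exp_def lessThan_iff restrict_apply')
  then have "\<forall>i<n. \<exists>k::int. y i = x i + of_int k" by (simp add: cis_2pi_eq_iff)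
  then obtain k :: "nat \<Rightarrow> int" where k: "\<forall>i<n. y i = x i + of_int (k i)" by metis
  have "y = vec_shift x (\<lambda>i. if i < n then k i else 0)"
    using assms k by (auto simp: vec_shift_def in_Euclidean_space fun_eq_iff)
  moreover have "(\<lambda>i. if i < n then k i else 0) \<in> int_lattice n" by (simp add: int_lattice_def)
  ultimately show "\<exists>z\<in>int_lattice n. y = vec_shift x z" by blast
next
  assume "\<exists>z\<in>int_lattice n. y = vec_shift x z"
  then obtain z where "y = vec_shift x z" by blast
  then have "cis (2 * pi * x i) = cis (2 * pi * y i)" for i
    unfolding cis_2pi_eq_iff by (auto simp: vec_shift_def)
  then show "torus_exp n x = torus_exp n y" by (simp add: torus_exp_def)
qed

lemma torus_exp_shift: "torus_exp n (vec_shift x z) = torus_exp n x"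
proof -
  have "cis (2 * pi * x i) = cis (2 * pi * vec_shift x z i)" for i
    unfolding cis_2pi_eq_iff by (auto simp: vec_shift_def)
  then show ?thesis by (simp add: torus_exp_def)
qed

lemma openin_finite_ball:
  assumes "finite I" "\<And>i. i \<in> I \<Longrightarrow> openin X {x \<in> topspace X. P i x}"
  shows "openin X {x \<in> topspace X. \<forall>i\<in>I. P i x}"
  using assms
proof (induction I rule: finite_induct)
  case (insert i I)
  have "{x \<in> topspace X. \<forall>j\<in>insert i I. P j x} = {x \<in> topspace X. P i x} \<inter> {x \<in> topspace X. \<forall>j\<in>I. P j x}" by auto
  then show ?case using insert by auto
qed simp

lemma openin_lt_finite:
  fixes n :: nat
  assumes "\<And>i. i < n \<Longrightarrow> continuous_map X euclideanreal (f i)"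
  shows "openin X {x \<in> topspace X. \<forall>i<n. f i x < (r::real)}"
proof -
  have eq: "{x \<in> topspace X. \<forall>i<n. f i x < r} = {x \<in> topspace X. \<forall>i\<in>{..<n}. f i x < r}" by auto
  have *: "openin X {x \<in> topspace X. f i x < r}" if "i < n" for i
    using openin_continuous_map_preimage[OF assms[OF that], of "{..<r}"] by simp
  show ?thesis unfolding eq by (rule openin_finite_ball) (use * in auto)
qed

lemma Arg_cis_2pi:
  assumes "\<bar>t\<bar> < 1/2"
  shows "Arg (cis (2 * pi * t)) = 2 * pi * t"
proof (rule Arg_cis)
  have "2 * pi * t < 2 * pi * (1/2)" "2 * pi * (-1/2) < 2 * pi * t" using assms by (intro mult_strict_left_mono; simp)+
  then show "2 * pi * t \<in> {- pi<..pi}" by simp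
qed

lemma Arg_circle_bound:
  assumes "norm u = 1" "u \<noteq> -1"
  shows "\<bar>Arg u / (2 * pi)\<bar> < 1/2" "u \<notin> \<real>\<^sub>\<le>\<^sub>0" "cis (Arg u) = u"
proof -
  have u0: "u \<noteq> 0" using assms by auto
  show neg: "u \<notin> \<real>\<^sub>\<le>\<^sub>0"
  proof
    assume "u \<in> \<real>\<^sub>\<le>\<^sub>0"
    then obtain r where r: "u = of_real r" "r \<le> 0" by (auto elim: nonpos_Reals_cases)
    then have "r = -1" using assms(1) by simp
    then show False using r assms(2) by simp
  qed
  have "Arg u \<noteq> pi"
    using neg by (auto simp: Arg_eq_pi complex_nonpos_Reals_iff)
  then have "-pi < Arg u" "Arg u < pi" using Arg_bounded[of u] by auto
  then show "\<bar>Arg u / (2 * pi)\<bar> < 1/2" by (simp add: abs_if field_simps)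
  show "cis (Arg u) = u" using u0 assms(1) by (simp add: cis_Arg sgn_eq)
qed

theorem covering_map_torus_exp: "covering_map (Euclidean_space n) (torus n) (torus_exp n)"
  unfolding covering_map_def
proof (intro conjI ballI)
  show "continuous_map (Euclidean_space n) (torus n) (torus_exp n)" by (rule continuous_map_torus_exp)
  show "torus_exp n ` topspace (Euclidean_space n) = topspace (torus n)"
    using torus_exp_surj torus_exp_in by (auto simp: image_iff) metis
  fix w0 assume w0: "w0 \<in> topspace (torus n)"
  then obtain a where a: "a \<in> topspace (Euclidean_space n)" "torus_exp n a = w0" by (rule torus_exp_surj)
  let ?R = "Euclidean_space n"
  have w0i: "w0 i = cis (2 * pi * a i)" if "i < n" for i using a(2) that by (auto simp: torus_exp_def)
  \<comment> \<open>The evenly covered set consists of the points with no coordinate opposite to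
    that of \<open>w0\<close>. Its sheets are the open unit cubes centred at the lattice translates
    of \<open>a\<close>, with inverses given by the principal argument.\<close>
  define W where "W = {w \<in> topspace (torus n). \<forall>i\<in>{..<n}. w i / w0 i \<noteq> -1}"
  define V where "V z = {x \<in> topspace ?R. \<forall>i<n. \<bar>x i - a i - of_int (z i)\<bar> < 1/2}" for z :: "nat \<Rightarrow> int"
  define s where "s z w = (\<lambda>i. if i < n then a i + of_int (z i) + Arg (w i / w0 i) / (2 * pi) else 0)"
    for z :: "nat \<Rightarrow> int" and w :: "nat \<Rightarrow> complex"
  have oW: "openin (torus n) W"
    unfolding W_def
  proof (rule openin_finite_ball)
    fix i assume "i \<in> {..<n}"
    then have "continuous_map (torus n) euclidean (\<lambda>w. w i)" by (simp add: continuous_map_torus_coord)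
    moreover have "continuous_map euclidean euclidean (\<lambda>c. c / w0 i)" by (simp add: divide_inverse continuous_intros)
    ultimately have "continuous_map (torus n) euclidean (\<lambda>w. w i / w0 i)"
      using continuous_map_compose[of "torus n" euclidean "\<lambda>w. w i" euclidean "\<lambda>c. c / w0 i"] by (simp add: o_def)
    then have "openin (torus n) {w \<in> topspace (torus n). w i / w0 i \<in> - {-1}}"
      by (rule openin_continuous_map_preimage) (simp add: open_Compl)
    then show "openin (torus n) {w \<in> topspace (torus n). w i / w0 i \<noteq> -1}" by simp
  qed simp
  have oV: "openin ?R (V z)" for z
    unfolding V_def by (rule openin_lt_finite) (intro continuous_intros continuous_map_Euclidean_coord)
  have tW: "topspace (subtopology (torus n) W) = W" using oW by (rule topspace_subtopology_openin)
  have tV: "topspace (subtopology ?R (V z)) = V z" for z using oV by (rule topspace_subtopology_openin)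
  have quot: "torus_exp n x i / w0 i = cis (2 * pi * (x i - a i - of_int (z i)))" if "i < n" for x i and z :: "nat \<Rightarrow> int"
  proof -
    have "torus_exp n x i / w0 i = cis (2 * pi * (x i - a i))"
      using w0i[OF that] that by (simp add: torus_exp_def cis_divide algebra_simps)
    also have "\<dots> = cis (2 * pi * (x i - a i - of_int (z i)))"
      unfolding cis_2pi_eq_iff by (rule exI[of _ "- z i"]) simp
    finally show ?thesis .
  qed
  have VW: "torus_exp n x \<in> W" and sexp: "s z (torus_exp n x) = x" if x: "x \<in> V z" for x z
  proof -
    have A: "Arg (torus_exp n x i / w0 i) = 2 * pi * (x i - a i - of_int (z i))" if "i < n" for i
      unfolding quot[OF that, of x z] by (rule Arg_cis_2pi) (use x that in \<open>auto simp: V_def\<close>)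
    have "torus_exp n x i / w0 i \<noteq> -1" if "i < n" for i
    proof
      assume "torus_exp n x i / w0 i = -1"
      moreover have "Arg (-1) = pi" by (simp add: Arg_eq_pi)
      ultimately have "2 * pi * (x i - a i - of_int (z i)) = pi" using A[OF that] by simp
      then have "x i - a i - of_int (z i) = 1/2" by simp
      then show False using x that by (auto simp: V_def)
    qed
    then show "torus_exp n x \<in> W" by (simp add: W_def torus_exp_in)
    show "s z (torus_exp n x) = x"
      using A x by (auto simp: s_def V_def in_Euclidean_space fun_eq_iff)
  qed
  have u: "norm (w i / w0 i) = 1" "w i / w0 i \<noteq> -1" "w0 i \<noteq> 0" if "w \<in> W" "i < n" for w i
    using that w0 by (auto simp: W_def topspace_torus norm_divide)
  have sV: "s z w \<in> V z" and exps: "torus_exp n (s z w) = w" if w: "w \<in> W" and z: "z \<in> int_lattice n" for w z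
  proof -
    show "s z w \<in> V z"
      using Arg_circle_bound(1)[OF u(1,2)[OF w]] by (auto simp: V_def s_def in_Euclidean_space)
    have "torus_exp n (s z w) i = w i" for i
    proof (cases "i < n")
      case True
      have "torus_exp n (s z w) i / w0 i = cis (2 * pi * (s z w i - a i - of_int (z i)))" by (rule quot[OF True])
      also have "\<dots> = cis (Arg (w i / w0 i))" using True by (simp add: s_def)
      also have "\<dots> = w i / w0 i" by (rule Arg_circle_bound(3)[OF u(1,2)[OF w True]])
      finally show ?thesis using u(3)[OF w True] by simp
    next
      case False
      then show ?thesis using w by (simp add: torus_exp_def W_def topspace_torus extensional_def)
    qed
    then show "torus_exp n (s z w) = w" by blast
  qed
  have cs: "continuous_map (subtopology (torus n) W) ?R (s z)" for z
    unfolding continuous_map_Euclidean_space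
  proof (intro conjI allI impI ballI)
    fix i assume i: "i < n"
    have u2: "w i / w0 i \<notin> \<real>\<^sub>\<le>\<^sub>0" if "w \<in> W" for w
      by (rule Arg_circle_bound(2)[OF u(1)[OF that i] u(2)[OF that i]])
    have "continuous_map (torus n) euclidean (\<lambda>w. w i)" using i by (simp add: continuous_map_torus_coord)
    then have "continuous_map (subtopology (torus n) W) (top_of_set {c. c / w0 i \<notin> \<real>\<^sub>\<le>\<^sub>0}) (\<lambda>w. w i)"
      using u2 tW
      by (auto simp: continuous_map_in_subtopology continuous_map_from_subtopology)
    moreover have "continuous_map (top_of_set {c. c / w0 i \<notin> \<real>\<^sub>\<le>\<^sub>0}) euclideanreal (\<lambda>c. a i + of_int (z i) + Arg (c / w0 i) / (2 * pi))"
      unfolding continuous_map_iff_continuous using w0i[OF i] by (intro continuous_intros) auto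
    ultimately show "continuous_map (subtopology (torus n) W) euclideanreal (\<lambda>w. s z w i)"
      using continuous_map_compose[of "subtopology (torus n) W" "top_of_set {c. c / w0 i \<notin> \<real>\<^sub>\<le>\<^sub>0}" "\<lambda>w. w i" euclideanreal "\<lambda>c. a i + of_int (z i) + Arg (c / w0 i) / (2 * pi)"]
      using i by (simp add: s_def o_def)
  qed (simp add: s_def)
  have hom: "homeomorphic_map (subtopology ?R (V z)) (subtopology (torus n) W) (torus_exp n)" if z: "z \<in> int_lattice n" for z
  proof -
    have "homeomorphic_maps (subtopology ?R (V z)) (subtopology (torus n) W) (torus_exp n) (s z)"
      unfolding homeomorphic_maps_def tV tW
    proof (intro conjI ballI)
      show "continuous_map (subtopology ?R (V z)) (subtopology (torus n) W) (torus_exp n)"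
        using VW tV continuous_map_torus_exp by (auto simp: continuous_map_in_subtopology continuous_map_from_subtopology)
      show "continuous_map (subtopology (torus n) W) (subtopology ?R (V z)) (s z)"
        using sV[OF _ z] tW cs by (auto simp: continuous_map_in_subtopology)
    qed (use sexp exps[OF _ z] in auto)
    then show ?thesis using homeomorphic_map_maps by blast
  qed
  have un: "\<Union> (V ` int_lattice n) = {x \<in> topspace ?R. torus_exp n x \<in> W}"
  proof (intro equalityI subsetI)
    fix x assume "x \<in> {x \<in> topspace ?R. torus_exp n x \<in> W}"
    then have x: "x \<in> topspace ?R" "torus_exp n x \<in> W" by auto
    \<comment> \<open>Rounding to the nearest integer; the boundary value \<open>-1/2\<close> would
      make a coordinate opposite to that of \<open>w0\<close>.\<close>
    define z where "z i = (if i < n then \<lfloor>x i - a i + 1/2\<rfloor> else 0)" for i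
    have "\<bar>x i - a i - of_int (z i)\<bar> < 1/2" if i: "i < n" for i
    proof -
      let ?t = "x i - a i - of_int (z i)"
      have zi: "z i = \<lfloor>x i - a i + 1/2\<rfloor>" using i by (simp add: z_def)
      have "-1/2 \<le> ?t" "?t < 1/2" unfolding zi by linarith+
      moreover have "?t \<noteq> -1/2"
      proof
        assume t: "?t = -1/2"
        have "torus_exp n x i / w0 i = cis (2 * pi * ?t)" by (rule quot[OF i])
        also have "\<dots> = -1" unfolding t by (simp add: complex_eq_iff)
        finally show False using x(2) i by (auto simp: W_def)
      qed
      ultimately show ?thesis by linarith
    qed
    then have "x \<in> V z" using x by (simp add: V_def)
    moreover have "z \<in> int_lattice n" by (simp add: z_def int_lattice_def)
    ultimately show "x \<in> \<Union> (V ` int_lattice n)" by blast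
  next
    fix x assume "x \<in> \<Union> (V ` int_lattice n)"
    then show "x \<in> {x \<in> topspace ?R. torus_exp n x \<in> W}" using VW by (auto simp: V_def)
  qed
  have disj: "pairwise disjnt (V ` int_lattice n)"
  proof (clarsimp simp: pairwise_def)
    fix z z' assume z: "z \<in> int_lattice n" "z' \<in> int_lattice n" "V z \<noteq> V z'"
    show "disjnt (V z) (V z')"
    proof (rule ccontr)
      assume "\<not> disjnt (V z) (V z')"
      then obtain x where x: "x \<in> V z" "x \<in> V z'" by (auto simp: disjnt_def)
      have "z i = z' i" for i
      proof (cases "i < n")
        case True
        then have "\<bar>x i - a i - of_int (z i)\<bar> < 1/2" "\<bar>x i - a i - of_int (z' i)\<bar> < 1/2" using x by (auto simp: V_def)
        then have "\<bar>of_int (z i) - of_int (z' i)\<bar> < (1::real)" by linarith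
        then show ?thesis by linarith
      qed (use z in \<open>auto simp: int_lattice_def\<close>)
      then have "z = z'" by blast
      then show False using z by simp
    qed
  qed
  have "w0 \<in> W" using w0 w0i by (auto simp: W_def)
  then show "\<exists>U. openin (torus n) U \<and> w0 \<in> U \<and> (\<exists>\<V>. \<Union> \<V> = {e \<in> topspace ?R. torus_exp n e \<in> U} \<and> pairwise disjnt \<V> \<and>
        (\<forall>V\<in>\<V>. openin ?R V \<and> homeomorphic_map (subtopology ?R V) (subtopology (torus n) U) (torus_exp n)))"
    using oW oV un disj hom by (intro exI[of _ W] exI[of _ "V ` int_lattice n"] conjI) auto
qed

text \<open>The straight-line contraction to \<open>a\<close> is lifted from the constant map at
  \<open>e\<close>. The contraction fixes \<open>a\<close>, so the lift is constant over
  \<open>a\<close> and the end map takes the value \<open>e\<close> there.\<close>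

lemma lift_from_Euclidean_space:
  assumes cov: "covering_map E X p" and f: "continuous_map (Euclidean_space n) X f"
    and a: "a \<in> topspace (Euclidean_space n)" and e: "e \<in> topspace E" "p e = f a"
  obtains g where "continuous_map (Euclidean_space n) E g" "\<And>x. x \<in> topspace (Euclidean_space n) \<Longrightarrow> p (g x) = f x" "g a = e"
proof -
  let ?R = "Euclidean_space n"
  define c where "c = (\<lambda>(t::real, x) i. a i + t * (x i - a i))"
  have "continuous_map (prod_topology (top_of_set {0..1}) ?R) euclideanreal (\<lambda>z. a i + fst z * (snd z i - a i))" for i
  proof -
    have "continuous_map (prod_topology (top_of_set {0..1}) ?R) euclideanreal fst"
      using continuous_map_fst continuous_map_into_fulltopology by blast
    moreover have "continuous_map (prod_topology (top_of_set {0..1::real}) ?R) euclideanreal (\<lambda>z. snd z i)"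
      using continuous_map_compose[OF continuous_map_snd continuous_map_Euclidean_coord[of n i]] by (simp add: o_def)
    ultimately show ?thesis by (intro continuous_intros)
  qed
  then have c: "continuous_map (prod_topology (top_of_set {0..1}) ?R) ?R c"
    using a by (auto simp: continuous_map_Euclidean_space c_def case_prod_unfold in_Euclidean_space)
  have H: "continuous_map (prod_topology (top_of_set {0..1}) ?R) X (\<lambda>z. f (c z))"
    using continuous_map_compose[OF c f] by (simp add: o_def)
  obtain G where G: "continuous_map (prod_topology (top_of_set {0..1}) ?R) E G"
    "\<And>t s. t \<in> {0..1} \<Longrightarrow> s \<in> topspace ?R \<Longrightarrow> p (G (t,s)) = f (c (t,s))" "\<And>s. s \<in> topspace ?R \<Longrightarrow> G (0,s) = e"
  proof (rule homotopy_lifting[OF cov H, of "\<lambda>_. e"])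
    show "continuous_map ?R E (\<lambda>_. e)" using e by simp
    show "p e = f (c (0, s))" for s using e by (simp add: c_def)
  qed (rule that)
  have cg: "continuous_map ?R E (\<lambda>x. G (1, x))"
  proof -
    have "continuous_map ?R (prod_topology (top_of_set {0..1::real}) ?R) (\<lambda>s. (1, s))"
      by (intro continuous_map_pairedI) auto
    from continuous_map_compose[OF this G(1)] show ?thesis by (simp add: o_def)
  qed
  have c1: "c (1, x) = x" for x by (simp add: c_def)
  have ca: "c (t, a) = a" for t by (simp add: c_def)
  have "G (1, a) = e"
  proof -
    have path: "pathin E (\<lambda>t. G (t, a))"
    proof -
      have "continuous_map (top_of_set {0..1}) (prod_topology (top_of_set {0..1::real}) ?R) (\<lambda>t. (t, a))"
        by (intro continuous_map_pairedI) (use a in \<open>auto simp: continuous_on_id\<close>)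
      from continuous_map_compose[OF this G(1)] show ?thesis by (simp add: o_def pathin_def)
    qed
    have "G (1, a) = (\<lambda>_. e) 1"
      by (rule path_lifts_unique[OF cov path _ _ _ _, of "\<lambda>_. e" 0]) (use G a e ca in auto)
    then show ?thesis by simp
  qed
  then show ?thesis by (intro that[of "\<lambda>x. G (1, x)"] cg) (use G(2)[of 1] c1 in auto)
qed

lemma homotopic_paths_Euclidean_space:
  assumes g: "pathin (Euclidean_space n) g" and h: "pathin (Euclidean_space n) h"
    and eq: "g 0 = x" "h 0 = x" "g 1 = y" "h 1 = y"
  shows "homotopic_with (\<lambda>r. r 0 = x \<and> r 1 = y) (top_of_set {0..1}) (Euclidean_space n) g h"
  unfolding homotopic_with_def
proof (intro exI[of _ "\<lambda>(t, s) i. (1 - t) * g s i + t * h s i"] conjI allI ballI)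
  let ?I = "top_of_set {0..1::real}"
  have gc: "continuous_map ?I euclideanreal (\<lambda>s. g s i)" "continuous_map ?I euclideanreal (\<lambda>s. h s i)" for i
    using continuous_map_compose[OF g[unfolded pathin_def] continuous_map_Euclidean_coord[of n i]]
      continuous_map_compose[OF h[unfolded pathin_def] continuous_map_Euclidean_coord[of n i]] by (simp_all only: o_def)
  have z: "g s i = 0" "h s i = 0" if "s \<in> {0..1}" "i \<ge> n" for s i
    using continuous_map_in_topspace[OF g[unfolded pathin_def], of s] continuous_map_in_topspace[OF h[unfolded pathin_def], of s] that
    by (auto simp: in_Euclidean_space)
  have "continuous_map (prod_topology ?I ?I) euclideanreal (\<lambda>z. (1 - fst z) * g (snd z) i + fst z * h (snd z) i)" for i
  proof -
    have f: "continuous_map (prod_topology ?I ?I) euclideanreal fst"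
      using continuous_map_fst continuous_map_into_fulltopology by blast
    have gs: "continuous_map (prod_topology ?I ?I) euclideanreal (\<lambda>z. g (snd z) i)" "continuous_map (prod_topology ?I ?I) euclideanreal (\<lambda>z. h (snd z) i)"
      using continuous_map_compose[OF continuous_map_snd gc(1)[of i]] continuous_map_compose[OF continuous_map_snd gc(2)[of i]]
      by (simp_all only: o_def)
    show ?thesis using f gs by (intro continuous_intros)
  qed
  then show "continuous_map (prod_topology ?I ?I) (Euclidean_space n) (\<lambda>(t, s) i. (1 - t) * g s i + t * h s i)"
    unfolding continuous_map_Euclidean_space using z by (auto simp: case_prod_unfold)
qed (use eq in \<open>auto simp: fun_eq_iff algebra_simps\<close>)

section \<open>Coverings of the torus\<close>

text \<open>No base point is prescribed: the total space may be disconnected, and different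
  components are reached by different lifts.\<close>

definition torus_lift :: "nat \<Rightarrow> 'e topology \<Rightarrow> ('e \<Rightarrow> nat \<Rightarrow> complex) \<Rightarrow> ((nat \<Rightarrow> real) \<Rightarrow> 'e) \<Rightarrow> bool" where
  "torus_lift n E p l \<longleftrightarrow> continuous_map (Euclidean_space n) E l \<and>
     (\<forall>x\<in>topspace (Euclidean_space n). p (l x) = torus_exp n x)"

text \<open>The kernel of the action of the integer lattice on a fibre, as
  \<open>deck_eq_iff\<close> shows.\<close>

definition periods :: "nat \<Rightarrow> 'e topology \<Rightarrow> ('e \<Rightarrow> nat \<Rightarrow> complex) \<Rightarrow> (nat \<Rightarrow> int) set" where
  "periods n E p = {z \<in> int_lattice n. \<forall>l. torus_lift n E p l \<longrightarrow>
     (\<forall>x\<in>topspace (Euclidean_space n). l (vec_shift x z) = l x)}"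

lemma torus_liftD:
  assumes "torus_lift n E p l" "x \<in> topspace (Euclidean_space n)"
  shows "p (l x) = torus_exp n x" "l x \<in> topspace E"
  using assms continuous_map_in_topspace[of "Euclidean_space n" E l x] by (auto simp: torus_lift_def)

lemma torus_lift_exists:
  assumes "covering_map E (torus n) p" "a \<in> topspace (Euclidean_space n)" "e \<in> topspace E" "p e = torus_exp n a"
  obtains l where "torus_lift n E p l" "l a = e"
proof -
  obtain g where "continuous_map (Euclidean_space n) E g"
    "\<And>x. x \<in> topspace (Euclidean_space n) \<Longrightarrow> p (g x) = torus_exp n x" "g a = e"
    by (rule lift_from_Euclidean_space[OF assms(1) continuous_map_torus_exp assms(2-4)]) (rule that)
  then show ?thesis by (intro that[of g]) (auto simp: torus_lift_def)
qed

lemma torus_lift_eq: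
  assumes "covering_map E (torus n) p" "torus_lift n E p l" "torus_lift n E p l'"
    and "a \<in> topspace (Euclidean_space n)" "l a = l' a" "x \<in> topspace (Euclidean_space n)"
  shows "l x = l' x"
proof (rule lifts_unique[where S = "Euclidean_space n" and g = l and h = l' and a = a])
  show "covering_map E (torus n) p" by (rule assms(1))
qed (use assms in \<open>auto simp: torus_lift_def connected_Euclidean_space\<close>)

lemma continuous_map_vec_shift:
  assumes "z \<in> int_lattice n"
  shows "continuous_map (Euclidean_space n) (Euclidean_space n) (\<lambda>x. vec_shift x z)"
  unfolding continuous_map_Euclidean_space vec_shift_def
  using assms by (auto simp: in_Euclidean_space int_lattice_def intro!: continuous_map_add continuous_map_Euclidean_coord)

lemma torus_lift_shift:
  assumes "torus_lift n E p l" "z \<in> int_lattice n"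
  shows "torus_lift n E p (\<lambda>x. l (vec_shift x z))"
  using continuous_map_compose[OF continuous_map_vec_shift[OF assms(2)], of E l] assms vec_shift_in[OF _ assms(2)]
  by (auto simp: torus_lift_def o_def torus_exp_shift)

lemma periods_in: "z \<in> periods n E p \<Longrightarrow> z \<in> int_lattice n"
  by (simp add: periods_def)

lemma periodsD:
  "z \<in> periods n E p \<Longrightarrow> torus_lift n E p l \<Longrightarrow> x \<in> topspace (Euclidean_space n) \<Longrightarrow> l (vec_shift x z) = l x"
  by (simp add: periods_def)

lemma periodsI:
  assumes "z \<in> int_lattice n" "\<And>l x. torus_lift n E p l \<Longrightarrow> x \<in> topspace (Euclidean_space n) \<Longrightarrow> l (vec_shift x z) = l x"
  shows "z \<in> periods n E p"
  using assms by (simp add: periods_def)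

lemma periods_zero: "(\<lambda>_. 0) \<in> periods n E p"
  by (rule periodsI) (simp_all add: int_lattice_zero vec_shift_zero)

lemma periods_add:
  assumes "a \<in> periods n E p" "b \<in> periods n E p"
  shows "(\<lambda>i. a i + b i) \<in> periods n E p"
proof (rule periodsI)
  show "(\<lambda>i. a i + b i) \<in> int_lattice n"
    using assms[THEN periods_in] by (auto simp: int_lattice_def)
  fix l x assume l: "torus_lift n E p l" and x: "x \<in> topspace (Euclidean_space n)"
  have "l (vec_shift (vec_shift x a) b) = l (vec_shift x a)"
    by (rule periodsD[OF assms(2) l vec_shift_in[OF x periods_in[OF assms(1)]]])
  also have "\<dots> = l x" by (rule periodsD[OF assms(1) l x])
  finally show "l (vec_shift x (\<lambda>i. a i + b i)) = l x" by (simp add: vec_shift_add)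
qed

lemma periods_neg:
  assumes "a \<in> periods n E p"
  shows "(\<lambda>i. - a i) \<in> periods n E p"
proof (rule periodsI)
  show m: "(\<lambda>i. - a i) \<in> int_lattice n"
    using periods_in[OF assms] by (auto simp: int_lattice_def)
  fix l x assume l: "torus_lift n E p l" and x: "x \<in> topspace (Euclidean_space n)"
  have "l (vec_shift (vec_shift x (\<lambda>i. - a i)) a) = l (vec_shift x (\<lambda>i. - a i))"
    by (rule periodsD[OF assms l vec_shift_in[OF x m]])
  then show "l (vec_shift x (\<lambda>i. - a i)) = l x" by (simp add: vec_shift_add vec_shift_zero)
qed

lemma periods_comb:
  assumes "a \<in> periods n E p" "b \<in> periods n E p"
  shows "(\<lambda>i. a i + c * b i) \<in> periods n E p"
proof (induction c rule: int_induct[where k = 0])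
  case base
  then show ?case using assms by simp
next
  case (step1 c)
  from periods_add[OF step1(2) assms(2)] show ?case by (simp add: algebra_simps)
next
  case (step2 c)
  from periods_add[OF step2(2) periods_neg[OF assms(2)]] show ?case by (simp add: algebra_simps)
qed

text \<open>The lifts together cover the total space by local homeomorphisms, so continuity can be tested on them.\<close>

lemma continuous_map_torus_lifts:
  assumes cov: "covering_map E (torus n) p"
    and h: "\<And>l. torus_lift n E p l \<Longrightarrow> continuous_map (Euclidean_space n) Z (\<lambda>x. h (l x))"
  shows "continuous_map E Z h"
proof (rule continuous_map_eq_openin_nhds)
  fix e assume e: "e \<in> topspace E"
  have cp: "continuous_map E (torus n) p" by (rule covering_mapD(1)[OF cov])
  obtain a where a: "a \<in> topspace (Euclidean_space n)" "torus_exp n a = p e"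
    using torus_exp_surj[OF continuous_map_in_topspace[OF cp e]] .
  obtain l where l: "torus_lift n E p l" "l a = e"
    using torus_lift_exists[OF cov a(1) e a(2)[symmetric]] .
  obtain U V s where U: "openin (torus n) U" "openin (Euclidean_space n) V" "a \<in> V"
    and s: "continuous_map (subtopology (torus n) U) (Euclidean_space n) s"
    and sV: "\<And>v. v \<in> V \<Longrightarrow> torus_exp n v \<in> U \<and> s (torus_exp n v) = v"
    and sU: "\<And>u. u \<in> U \<Longrightarrow> s u \<in> V \<and> torus_exp n (s u) = u"
    by (rule covering_local_inverse[OF covering_map_torus_exp a(1)]) (rule that)
  define W where "W = {e' \<in> topspace E. p e' \<in> U}"
  have oW: "openin E W" unfolding W_def by (rule openin_continuous_map_preimage[OF cp U(1)])
  have tW: "topspace (subtopology E W) = W" by (rule topspace_subtopology_openin[OF oW])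
  have cpW: "continuous_map (subtopology E W) (subtopology (torus n) U) p"
    using cp tW by (auto simp: continuous_map_in_subtopology continuous_map_from_subtopology W_def)
  have csp: "continuous_map (subtopology E W) (Euclidean_space n) (\<lambda>e'. s (p e'))"
    using continuous_map_compose[OF cpW s] by (simp add: o_def)
  have cl: "continuous_map (subtopology E W) E (\<lambda>e'. l (s (p e')))"
    using continuous_map_compose[OF csp, of E l] l(1) by (simp add: o_def torus_lift_def)
  have sR: "s u \<in> topspace (Euclidean_space n)" if "u \<in> U" for u
    using sU[OF that] openin_subset[OF U(2)] by blast
  \<comment> \<open>Both \<open>e' \<mapsto> l (s (p e'))\<close> and the identity are lifts of
    \<open>p\<close>, and they agree at \<open>e\<close>. Hence they agree on an open set
    \<open>T\<close>, on which \<open>h\<close> is \<open>h \<circ> l\<close> after a continuous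
    map.\<close>
  define T where "T = {e' \<in> topspace (subtopology E W). l (s (p e')) = e'}"
  have "openin (subtopology E W) T"
    unfolding T_def
  proof (rule lifts_agree_openin[OF cov cl, of "\<lambda>e'. e'"])
    show "continuous_map (subtopology E W) E (\<lambda>e'. e')" using continuous_map_id_subt[of E W] by (simp add: id_def)
    show "p (l (s (p e'))) = p e'" if "e' \<in> topspace (subtopology E W)" for e'
    proof -
      have "p e' \<in> U" using that tW by (simp add: W_def)
      then show ?thesis using torus_liftD(1)[OF l(1) sR] sU by simp
    qed
  qed
  then have oT: "openin E T" using oW openin_trans_full by blast
  have TW: "T \<subseteq> W" unfolding T_def tW by auto
  have "e \<in> T" using sV[OF U(3)] a(2) e l(2) tW by (simp add: T_def W_def)
  moreover have "continuous_map (subtopology E T) Z h"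
  proof (rule continuous_map_eq)
    show "continuous_map (subtopology E T) Z (\<lambda>e'. h (l (s (p e'))))"
      using continuous_map_compose[OF continuous_map_from_subtopology_mono[OF csp TW] h[OF l(1)]] by (simp add: o_def)
    show "h (l (s (p e'))) = h e'" if "e' \<in> topspace (subtopology E T)" for e'
      using that by (simp add: T_def)
  qed
  ultimately show "\<exists>W. openin E W \<and> e \<in> W \<and> continuous_map (subtopology E W) Z h" using oT by blast
qed

text \<open>Every point of either total space lies on a lift, so a correspondence \<open>th\<close>
  of lifts determines a map of points by \<open>l a \<mapsto> th l a\<close>. The condition
  \<open>eq\<close> makes it well defined and injective, and \<open>surj\<close> makes it
  onto.\<close>

lemma isomorphic_coverings_torusI:
  assumes covE: "covering_map E (torus n) p" and covF: "covering_map F (torus n) q"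
    and th: "\<And>l. torus_lift n E p l \<Longrightarrow> torus_lift n F q (th l)"
    and surj: "\<And>m. torus_lift n F q m \<Longrightarrow> \<exists>l. torus_lift n E p l \<and> (\<forall>x\<in>topspace (Euclidean_space n). th l x = m x)"
    and eq: "\<And>l l' a a'. torus_lift n E p l \<Longrightarrow> torus_lift n E p l' \<Longrightarrow> a \<in> topspace (Euclidean_space n) \<Longrightarrow>
       a' \<in> topspace (Euclidean_space n) \<Longrightarrow> l a = l' a' \<longleftrightarrow> th l a = th l' a'"
  shows "isomorphic_coverings (torus n) E p F q"
proof -
  let ?R = "Euclidean_space n"
  define P where "P e v \<longleftrightarrow> (\<exists>l a. torus_lift n E p l \<and> a \<in> topspace ?R \<and> l a = e \<and> th l a = v)" for e v
  define h where "h e = (SOME v. P e v)" for e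
  define g where "g v = (SOME e. P e v)" for v
  have hl: "h (l a) = th l a" if l: "torus_lift n E p l" and a: "a \<in> topspace ?R" for l a
  proof -
    have "P (l a) (th l a)" using l a unfolding P_def by blast
    then have "P (l a) (h (l a))" unfolding h_def by (rule someI)
    then show ?thesis unfolding P_def using eq[OF _ l _ a] by metis
  qed
  have gl: "g (th l a) = l a" if l: "torus_lift n E p l" and a: "a \<in> topspace ?R" for l a
  proof -
    have "P (l a) (th l a)" using l a unfolding P_def by blast
    then have "P (g (th l a)) (th l a)" unfolding g_def by (rule someI)
    then show ?thesis unfolding P_def using eq[OF _ l _ a] by metis
  qed
  have onto: "\<exists>l a. torus_lift n E p l \<and> a \<in> topspace ?R \<and> l a = e" if e: "e \<in> topspace E" for e
  proof -
    obtain a where a: "a \<in> topspace ?R" "torus_exp n a = p e"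
      using torus_exp_surj[OF continuous_map_in_topspace[OF covering_mapD(1)[OF covE] e]] .
    obtain l where "torus_lift n E p l" "l a = e"
      using torus_lift_exists[OF covE a(1) e a(2)[symmetric]] .
    then show ?thesis using a by blast
  qed
  have ontoF: "\<exists>l a. torus_lift n E p l \<and> a \<in> topspace ?R \<and> th l a = e" if e: "e \<in> topspace F" for e
  proof -
    obtain a where a: "a \<in> topspace ?R" "torus_exp n a = q e"
      using torus_exp_surj[OF continuous_map_in_topspace[OF covering_mapD(1)[OF covF] e]] .
    obtain m where "torus_lift n F q m" "m a = e"
      using torus_lift_exists[OF covF a(1) e a(2)[symmetric]] .
    then show ?thesis using a surj[of m] by metis
  qed
  have "continuous_map E F h"
  proof (rule continuous_map_torus_lifts[OF covE])
    fix l assume l: "torus_lift n E p l"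
    show "continuous_map ?R F (\<lambda>x. h (l x))"
      by (rule continuous_map_eq[of _ _ "th l"]) (use th[OF l] hl[OF l] in \<open>auto simp: torus_lift_def\<close>)
  qed
  moreover have "continuous_map F E g"
  proof (rule continuous_map_torus_lifts[OF covF])
    fix m assume m: "torus_lift n F q m"
    obtain l where l: "torus_lift n E p l" "\<forall>x\<in>topspace ?R. th l x = m x" using surj[OF m] by blast
    show "continuous_map ?R E (\<lambda>x. g (m x))"
    proof (rule continuous_map_eq[of _ _ l])
      show "continuous_map ?R E l" using l(1) by (simp add: torus_lift_def)
      show "l x = g (m x)" if "x \<in> topspace ?R" for x using gl[OF l(1) that] l(2) that by simp
    qed
  qed
  moreover have "g (h e) = e" "q (h e) = p e" if e: "e \<in> topspace E" for e
  proof -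
    obtain l a where l: "torus_lift n E p l" "a \<in> topspace ?R" "l a = e" using onto[OF e] by blast
    show "g (h e) = e" using hl[OF l(1,2)] gl[OF l(1,2)] l(3) by simp
    show "q (h e) = p e" using hl[OF l(1,2)] torus_liftD(1)[OF th[OF l(1)] l(2)] torus_liftD(1)[OF l(1,2)] l(3) by simp
  qed
  moreover have "h (g v) = v" if v: "v \<in> topspace F" for v
  proof -
    obtain l a where l: "torus_lift n E p l" "a \<in> topspace ?R" "th l a = v" using ontoF[OF v] by blast
    show ?thesis using hl[OF l(1,2)] gl[OF l(1,2)] l(3) by simp
  qed
  ultimately have "homeomorphic_maps E F h g" "\<forall>e\<in>topspace E. q (h e) = p e"
    by (simp_all add: homeomorphic_maps_def)
  then show ?thesis
    unfolding isomorphic_coverings_def using covE covF homeomorphic_map_maps by blast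
qed

subsection \<open>The monodromy group\<close>

text \<open>The action of \<open>z\<close> on the fibre: follow the lift through \<open>e\<close> to
  the translate of \<open>a\<close>. That lift is unique on Euclidean space by
  \<open>torus_lift_eq\<close>, so \<open>SOME\<close> is harmless.\<close>

definition deck :: "nat \<Rightarrow> 'e topology \<Rightarrow> ('e \<Rightarrow> nat \<Rightarrow> complex) \<Rightarrow> (nat \<Rightarrow> real) \<Rightarrow> (nat \<Rightarrow> int) \<Rightarrow> 'e \<Rightarrow> 'e" where
  "deck n E p a z = (\<lambda>e\<in>covering_fiber E (torus_exp n a) p.
     (SOME l. torus_lift n E p l \<and> l a = e) (vec_shift a z))"

lemma deck_eq:
  assumes "covering_map E (torus n) p" "a \<in> topspace (Euclidean_space n)" "torus_lift n E p l" "z \<in> int_lattice n"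
  shows "deck n E p a z (l a) = l (vec_shift a z)"
proof -
  define m where "m = (SOME m. torus_lift n E p m \<and> m a = l a)"
  have "torus_lift n E p m \<and> m a = l a" unfolding m_def by (rule someI[of _ l]) (use assms in simp)
  then have "m (vec_shift a z) = l (vec_shift a z)"
    using torus_lift_eq[OF assms(1) _ assms(3,2)] vec_shift_in[OF assms(2,4)] by blast
  moreover have "l a \<in> covering_fiber E (torus_exp n a) p"
    using torus_liftD[OF assms(3,2)] by (simp add: covering_fiber_def)
  ultimately show ?thesis by (simp add: deck_def m_def)
qed

lemma fiber_lift:
  assumes "covering_map E (torus n) p" "a \<in> topspace (Euclidean_space n)" "e \<in> covering_fiber E (torus_exp n a) p"
  obtains l where "torus_lift n E p l" "l a = e"
  using torus_lift_exists[OF assms(1,2), of e] assms(3) by (auto simp: covering_fiber_def)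

lemma deck_in_fiber:
  assumes "covering_map E (torus n) p" "a \<in> topspace (Euclidean_space n)" "z \<in> int_lattice n"
    "e \<in> covering_fiber E (torus_exp n a) p"
  shows "deck n E p a z e \<in> covering_fiber E (torus_exp n a) p"
proof -
  obtain l where l: "torus_lift n E p l" "l a = e" using fiber_lift[OF assms(1,2,4)] .
  show ?thesis
    using deck_eq[OF assms(1,2) l(1) assms(3)] l torus_liftD[OF l(1) vec_shift_in[OF assms(2,3)]]
    by (simp add: covering_fiber_def torus_exp_shift)
qed

text \<open>A translate of a lift is a lift again, and the one translated by \<open>w\<close> passes
  over \<open>a\<close> through the point to which \<open>w\<close> moves \<open>e\<close>.\<close>

lemma deck_add:
  assumes "covering_map E (torus n) p" "a \<in> topspace (Euclidean_space n)" "z \<in> int_lattice n" "w \<in> int_lattice n"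
    "e \<in> covering_fiber E (torus_exp n a) p"
  shows "deck n E p a (\<lambda>i. z i + w i) e = deck n E p a z (deck n E p a w e)"
proof -
  obtain l where l: "torus_lift n E p l" "l a = e" using fiber_lift[OF assms(1,2,5)] .
  have zw: "(\<lambda>i. z i + w i) \<in> int_lattice n" using assms(3,4) by (auto simp: int_lattice_def)
  have "deck n E p a z (deck n E p a w e) = deck n E p a z (l (vec_shift a w))"
    using deck_eq[OF assms(1,2) l(1) assms(4)] l by simp
  also have "\<dots> = l (vec_shift (vec_shift a z) w)"
    using deck_eq[OF assms(1,2) torus_lift_shift[OF l(1) assms(4)] assms(3)] by simp
  also have "\<dots> = deck n E p a (\<lambda>i. z i + w i) e"
    using deck_eq[OF assms(1,2) l(1) zw] l by (simp add: vec_shift_add)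
  finally show ?thesis by simp
qed

lemma deck_zero:
  assumes "covering_map E (torus n) p" "a \<in> topspace (Euclidean_space n)"
    "e \<in> covering_fiber E (torus_exp n a) p"
  shows "deck n E p a (\<lambda>_. 0) e = e"
proof -
  obtain l where l: "torus_lift n E p l" "l a = e" using fiber_lift[OF assms] .
  show ?thesis using deck_eq[OF assms(1,2) l(1) int_lattice_zero] l by (simp add: vec_shift_zero)
qed

text \<open>Two translates of a lift that agree over \<open>a\<close> agree everywhere, so a
  coincidence on a single fibre already forces a common period.\<close>

lemma deck_eq_iff:
  assumes cov: "covering_map E (torus n) p" and a: "a \<in> topspace (Euclidean_space n)"
    and z: "z \<in> int_lattice n" and w: "w \<in> int_lattice n"
  shows "deck n E p a z = deck n E p a w \<longleftrightarrow> (\<lambda>i. z i - w i) \<in> periods n E p"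
proof
  assume eq: "deck n E p a z = deck n E p a w"
  have mw: "(\<lambda>i. - w i) \<in> int_lattice n" using w by (auto simp: int_lattice_def)
  show "(\<lambda>i. z i - w i) \<in> periods n E p"
  proof (rule periodsI)
    show "(\<lambda>i. z i - w i) \<in> int_lattice n" using z w by (auto simp: int_lattice_def)
    fix l x assume l: "torus_lift n E p l" and x: "x \<in> topspace (Euclidean_space n)"
    have "l (vec_shift a z) = l (vec_shift a w)"
      using deck_eq[OF cov a l z] deck_eq[OF cov a l w] eq by simp
    then have "l (vec_shift (vec_shift x (\<lambda>i. - w i)) z) = l (vec_shift (vec_shift x (\<lambda>i. - w i)) w)"
      using torus_lift_eq[OF cov torus_lift_shift[OF l z] torus_lift_shift[OF l w] a _ vec_shift_in[OF x mw]] by blast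
    then show "l (vec_shift x (\<lambda>i. z i - w i)) = l x" by (simp add: vec_shift_add vec_shift_zero)
  qed
next
  assume per: "(\<lambda>i. z i - w i) \<in> periods n E p"
  show "deck n E p a z = deck n E p a w"
  proof
    fix e show "deck n E p a z e = deck n E p a w e"
    proof (cases "e \<in> covering_fiber E (torus_exp n a) p")
      case True
      obtain l where l: "torus_lift n E p l" "l a = e" using fiber_lift[OF cov a True] .
      have "l (vec_shift (vec_shift a w) (\<lambda>i. z i - w i)) = l (vec_shift a w)"
        by (rule periodsD[OF per l(1) vec_shift_in[OF a w]])
      then show ?thesis using deck_eq[OF cov a l(1) z] deck_eq[OF cov a l(1) w] l(2) by (simp add: vec_shift_add)
    qed (simp add: deck_def)
  qed
qed

lemma deck_Bij:
  assumes cov: "covering_map E (torus n) p" and a: "a \<in> topspace (Euclidean_space n)" and z: "z \<in> int_lattice n"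
  shows "deck n E p a z \<in> Bij (covering_fiber E (torus_exp n a) p)"
proof -
  let ?S = "covering_fiber E (torus_exp n a) p"
  have mz: "(\<lambda>i. - z i) \<in> int_lattice n" using z by (auto simp: int_lattice_def)
  have "bij_betw (deck n E p a z) ?S ?S"
  proof (rule bij_betw_byWitness[where f' = "deck n E p a (\<lambda>i. - z i)"])
    show "\<forall>e\<in>?S. deck n E p a (\<lambda>i. - z i) (deck n E p a z e) = e"
      using deck_add[OF cov a mz z] deck_zero[OF cov a] by simp
    show "\<forall>e\<in>?S. deck n E p a z (deck n E p a (\<lambda>i. - z i) e) = e"
      using deck_add[OF cov a z mz] deck_zero[OF cov a] by simp
  qed (use deck_in_fiber[OF cov a z] deck_in_fiber[OF cov a mz] in auto)
  then show ?thesis by (simp add: Bij_def deck_def)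
qed

text \<open>\<open>monodromy\<close> runs from the end of a lift back to its start, whence the sign.
  The lift of the loop that ends at \<open>e\<close> is \<open>l\<close> along the path
  \<open>h\<close> translated by \<open>- z\<close>.\<close>

lemma monodromy_loop_class:
  assumes cov: "covering_map E (torus n) p" and a: "a \<in> topspace (Euclidean_space n)" and z: "z \<in> int_lattice n"
    and g: "g \<in> loops (torus n) (torus_exp n a)"
    and h: "pathin (Euclidean_space n) h" "\<And>t. t \<in> {0..1} \<Longrightarrow> torus_exp n (h t) = g t" "h 0 = a" "h 1 = vec_shift a z"
  shows "monodromy E (torus_exp n a) p (loop_class (torus n) (torus_exp n a) g) = deck n E p a (\<lambda>i. - z i)"
proof
  let ?x = "torus_exp n a"
  let ?S = "covering_fiber E ?x p"
  let ?m = "\<lambda>i. - z i"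
  have m: "?m \<in> int_lattice n" using z by (auto simp: int_lattice_def)
  fix e
  show "monodromy E ?x p (loop_class (torus n) ?x g) e = deck n E p a ?m e"
  proof (cases "e \<in> ?S")
    case True
    obtain l where l: "torus_lift n E p l" "l a = e" using fiber_lift[OF cov a True] .
    define k where "k t = l (vec_shift (h t) ?m)" for t
    have k1: "k 1 = e" using h(4) l(2) by (simp add: k_def vec_shift_add vec_shift_zero)
    have k0: "k 0 = deck n E p a ?m e" using deck_eq[OF cov a l(1) m] l(2) h(3) by (simp add: k_def)
    have pk: "pathin E k"
      using continuous_map_compose[OF h(1)[unfolded pathin_def], of E "\<lambda>x. l (vec_shift x ?m)"] torus_lift_shift[OF l(1) m]
      by (simp add: pathin_def torus_lift_def o_def k_def[abs_def])
    have hR: "h t \<in> topspace (Euclidean_space n)" if "t \<in> {0..1}" for t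
      using continuous_map_in_topspace[OF h(1)[unfolded pathin_def], of t] that by simp
    have pkg: "(p \<circ> k) t = g t" if "t \<in> {0..1}" for t
      using torus_liftD(1)[OF l(1) vec_shift_in[OF hR[OF that] m]] h(2)[OF that] by (simp add: k_def torus_exp_shift)
    have hom: "homotopic_with (\<lambda>r. r 0 = ?x \<and> r 1 = ?x) (top_of_set {0..1}) (torus n) g (p \<circ> k)"
    proof (rule homotopic_with_equal)
      show "continuous_map (top_of_set {0..1}) (torus n) g" using g by (simp add: loops_def pathin_def)
      show "g 0 = ?x \<and> g 1 = ?x" using g by (simp add: loops_def)
      then show "(p \<circ> k) 0 = ?x \<and> (p \<circ> k) 1 = ?x" using pkg[of 0] pkg[of 1] by simp
    qed (use pkg in auto)
    have "(THE e'. \<exists>r. pathin E r \<and> p \<circ> r \<in> loop_class (torus n) ?x g \<and> r 0 = e' \<and> r 1 = e) = k 0"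
    proof (rule the_equality)
      show "\<exists>r. pathin E r \<and> p \<circ> r \<in> loop_class (torus n) ?x g \<and> r 0 = k 0 \<and> r 1 = e"
        using pk k1 hom by (intro exI[of _ k]) (simp add: loop_class_def)
      \<comment> \<open>Any other lift of a member of the class that ends at \<open>e\<close> starts
        at the same point by homotopy lifting.\<close>
      fix e' assume "\<exists>r. pathin E r \<and> p \<circ> r \<in> loop_class (torus n) ?x g \<and> r 0 = e' \<and> r 1 = e"
      then obtain r where r: "pathin E r" "homotopic_with (\<lambda>r. r 0 = ?x \<and> r 1 = ?x) (top_of_set {0..1}) (torus n) g (p \<circ> r)"
        "r 0 = e'" "r 1 = e" by (auto simp: loop_class_def)
      have "homotopic_with (\<lambda>r. r 0 = ?x \<and> r 1 = ?x) (top_of_set {0..1}) (torus n) (p \<circ> r) (p \<circ> k)"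
        by (rule homotopic_with_trans[OF homotopic_with_symD[OF r(2)] hom])
      from path_lifts_homotopic[OF cov r(1) pk this] show "e' = k 0" using r(3,4) k1 by simp
    qed
    then show ?thesis using True k0 by (simp add: monodromy_def)
  qed (simp add: monodromy_def deck_def)
qed

lemma carrier_monodromy_group_torus:
  assumes cov: "covering_map E (torus n) p" and a: "a \<in> topspace (Euclidean_space n)"
  shows "carrier (monodromy_group E (torus n) (torus_exp n a) p) = deck n E p a ` int_lattice n"
proof -
  let ?x = "torus_exp n a"
  have "monodromy E ?x p ` loop_class (torus n) ?x ` loops (torus n) ?x = deck n E p a ` int_lattice n"
  proof (intro equalityI subsetI)
    fix f assume "f \<in> monodromy E ?x p ` loop_class (torus n) ?x ` loops (torus n) ?x"
    then obtain g where g: "g \<in> loops (torus n) ?x" "f = monodromy E ?x p (loop_class (torus n) ?x g)" by blast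
    then have gp: "pathin (torus n) g" "torus_exp n a = g 0" "g 1 = ?x" by (auto simp: loops_def)
    obtain h where h: "pathin (Euclidean_space n) h" "\<And>t. t \<in> {0..1} \<Longrightarrow> torus_exp n (h t) = g t" "h 0 = a"
      by (rule path_lifting[OF covering_map_torus_exp gp(1), where e = a]) (use a gp(2) that in auto)
    have h1: "h 1 \<in> topspace (Euclidean_space n)"
      using continuous_map_in_topspace[OF h(1)[unfolded pathin_def], of 1] by simp
    have "torus_exp n a = torus_exp n (h 1)" using h(2)[of 1] gp(3) by simp
    then obtain z where z: "z \<in> int_lattice n" "h 1 = vec_shift a z" using torus_exp_eq_iff[OF a h1] by blast
    have "f = deck n E p a (\<lambda>i. - z i)"
      unfolding g(2) by (rule monodromy_loop_class[OF cov a z(1) g(1) h z(2)])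
    moreover have "(\<lambda>i. - z i) \<in> int_lattice n" using z(1) by (auto simp: int_lattice_def)
    ultimately show "f \<in> deck n E p a ` int_lattice n" by blast
  next
    fix f assume "f \<in> deck n E p a ` int_lattice n"
    then obtain w where w: "w \<in> int_lattice n" "f = deck n E p a w" by blast
    define z where "z = (\<lambda>i. - w i)"
    have z: "z \<in> int_lattice n" using w(1) by (auto simp: z_def int_lattice_def)
    \<comment> \<open>The straight segment from \<open>a\<close> to its translate realizes a given
      lattice vector by a loop.\<close>
    define h where "h t = (\<lambda>i. a i + t * of_int (z i))" for t
    have h: "pathin (Euclidean_space n) h"
      unfolding pathin_def continuous_map_Euclidean_space h_def
      using a z by (auto simp: in_Euclidean_space int_lattice_def intro!: continuous_intros)
    have h01: "h 0 = a" "h 1 = vec_shift a z" by (simp_all add: h_def vec_shift_def)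
    have g: "torus_exp n \<circ> h \<in> loops (torus n) ?x"
      using pathin_compose[OF h continuous_map_torus_exp] by (simp add: loops_def h01 torus_exp_shift)
    have "monodromy E ?x p (loop_class (torus n) ?x (torus_exp n \<circ> h)) = deck n E p a (\<lambda>i. - z i)"
      by (rule monodromy_loop_class[OF cov a z g h _ h01]) simp
    then have "f = monodromy E ?x p (loop_class (torus n) ?x (torus_exp n \<circ> h))" using w(2) by (simp add: z_def)
    then show "f \<in> monodromy E ?x p ` loop_class (torus n) ?x ` loops (torus n) ?x" using g by blast
  qed
  then show ?thesis by (simp add: monodromy_group_def fundamental_group_def)
qed

lemma mult_monodromy_group_torus:
  assumes cov: "covering_map E (torus n) p" and a: "a \<in> topspace (Euclidean_space n)"
    and z: "z \<in> int_lattice n" and w: "w \<in> int_lattice n"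
  shows "deck n E p a z \<otimes>\<^bsub>monodromy_group E (torus n) (torus_exp n a) p\<^esub> deck n E p a w = deck n E p a (\<lambda>i. z i + w i)"
proof
  fix e
  show "(deck n E p a z \<otimes>\<^bsub>monodromy_group E (torus n) (torus_exp n a) p\<^esub> deck n E p a w) e = deck n E p a (\<lambda>i. z i + w i) e"
    using deck_Bij[OF cov a z] deck_Bij[OF cov a w] deck_add[OF cov a z w, of e]
    by (auto simp: monodromy_group_def BijGroup_def compose_def deck_def restrict_def)
qed

subsection \<open>Quotients of the integer lattice as sums of cyclic groups\<close>

lemma direct_sum_of_invariant_factors:
  assumes carrier: "carrier M = D ` int_lattice n"
    and mult: "\<And>z w. z \<in> int_lattice n \<Longrightarrow> w \<in> int_lattice n \<Longrightarrow> D z \<otimes>\<^bsub>M\<^esub> D w = D (\<lambda>i. z i + w i)"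
    and eq: "\<And>z w. z \<in> int_lattice n \<Longrightarrow> w \<in> int_lattice n \<Longrightarrow> D z = D w \<longleftrightarrow> (\<lambda>i. z i - w i) \<in> L"
    and U: "lattice_aut n U"
    and L: "\<And>a. a \<in> int_lattice n \<Longrightarrow> a \<in> L \<longleftrightarrow> (\<forall>i<n. int (d i) dvd U a i)"
    and triv: "\<And>i. i + k < n \<Longrightarrow> d i = 1"
  shows "direct_sum_of_cyclic_groups k M"
proof -
  let ?Z = "int_lattice n"
  \<comment> \<open>\<open>s\<close> enumerates the last \<open>k\<close> coordinates. If
    \<open>k\<close> exceeds \<open>n\<close>, truncated subtraction makes \<open>s\<close> the
    identity, and indices from \<open>n\<close> on receive the trivial group through
    \<open>e j = 1\<close>.\<close>
  define s where "s j = j + (n - k)" for j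
  define e where "e j = (if s j < n then d (s j) else 1)" for j
  define C where "C j = integer_mod_group (e j)" for j
  define T where "T a = (\<lambda>j\<in>{..<k}. U a (s j) mod int (e j))" for a
  define h where "h m = T (SOME a. a \<in> ?Z \<and> D a = m)" for m
  have grp: "group (C j)" for j by (simp add: C_def)
  have Uz: "U a i = 0" if "a \<in> ?Z" "n \<le> i" for a i
    using lattice_aut_in[OF U that(1)] that(2) by (simp add: int_lattice_def)
  have U_diff: "U (\<lambda>i. a i - b i) j = U a j - U b j" if "a \<in> ?Z" "b \<in> ?Z" for a b j
    using lattice_aut_comb[OF U that, of "-1" j] by simp
  have U_add: "U (\<lambda>i. a i + b i) j = U a j + U b j" if "a \<in> ?Z" "b \<in> ?Z" for a b j
    using lattice_aut_comb[OF U that, of 1 j] by simp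
  have diff_in: "(\<lambda>i. a i - b i) \<in> ?Z" and add_in: "(\<lambda>i. a i + b i) \<in> ?Z" if "a \<in> ?Z" "b \<in> ?Z" for a b
    using that by (auto simp: int_lattice_def)
  \<comment> \<open>Coordinates before \<open>n - k\<close> impose no condition because their
    factors are \<open>1\<close>.\<close>
  have L': "a \<in> L \<longleftrightarrow> (\<forall>j<k. int (e j) dvd U a (s j))" if a: "a \<in> ?Z" for a
  proof
    assume R: "\<forall>j<k. int (e j) dvd U a (s j)"
    have "int (d i) dvd U a i" if i: "i < n" for i
    proof (cases "i + k < n")
      case False
      define j where "j = i - (n - k)"
      have "s j = i" "j < k" using False i by (auto simp: s_def j_def)
      then show ?thesis using R i by (auto simp: e_def)
    qed (simp add: triv)
    then show "a \<in> L" using L[OF a] by blast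
  next
    assume "a \<in> L"
    then show "\<forall>j<k. int (e j) dvd U a (s j)" using L[OF a] by (auto simp: e_def)
  qed
  have T_eq: "T a = T b \<longleftrightarrow> D a = D b" if ab: "a \<in> ?Z" "b \<in> ?Z" for a b
  proof -
    have "T a = T b \<longleftrightarrow> (\<forall>j<k. U a (s j) mod int (e j) = U b (s j) mod int (e j))"
      unfolding T_def by (auto simp: fun_eq_iff restrict_def)
    also have "\<dots> \<longleftrightarrow> (\<lambda>i. a i - b i) \<in> L"
      unfolding L'[OF diff_in[OF ab]] U_diff[OF ab] by (simp add: mod_eq_dvd_iff)
    also have "\<dots> \<longleftrightarrow> D a = D b" using eq[OF ab] by simp
    finally show ?thesis .
  qed
  have hT: "h (D a) = T a" if a: "a \<in> ?Z" for a
  proof -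
    let ?b = "SOME b. b \<in> ?Z \<and> D b = D a"
    have "?b \<in> ?Z \<and> D ?b = D a" by (rule someI[of _ a]) (use a in simp)
    then show ?thesis using T_eq[of ?b a] a by (simp add: h_def)
  qed
  have csum: "carrier (sum_group {..<k} C) = (\<Pi>\<^sub>E j\<in>{..<k}. carrier (C j))"
    by (subst carrier_sum_group) (auto simp: grp)
  have T_in: "T a \<in> carrier (sum_group {..<k} C)" for a
    unfolding csum by (auto simp: T_def C_def carrier_integer_mod_group)
  have "h \<in> hom M (sum_group {..<k} C)"
  proof (rule homI)
    fix x assume "x \<in> carrier M"
    then show "h x \<in> carrier (sum_group {..<k} C)" using carrier hT T_in by auto
  next
    fix x y assume "x \<in> carrier M" "y \<in> carrier M"
    then obtain a b where ab: "a \<in> ?Z" "b \<in> ?Z" "x = D a" "y = D b" using carrier by auto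
    have "h (x \<otimes>\<^bsub>M\<^esub> y) = T (\<lambda>i. a i + b i)" using mult[OF ab(1,2)] hT[OF add_in[OF ab(1,2)]] ab by simp
    also have "\<dots> = T a \<otimes>\<^bsub>sum_group {..<k} C\<^esub> T b"
      by (simp add: T_def C_def U_add[OF ab(1,2)] mod_add_eq cong: restrict_cong)
    finally show "h (x \<otimes>\<^bsub>M\<^esub> y) = h x \<otimes>\<^bsub>sum_group {..<k} C\<^esub> h y" using hT ab by simp
  qed
  moreover have "bij_betw h (carrier M) (carrier (sum_group {..<k} C))"
    unfolding bij_betw_def
  proof
    show "inj_on h (carrier M)"
      unfolding carrier by (rule inj_onI) (use hT T_eq in auto)
    show "h ` carrier M = carrier (sum_group {..<k} C)"
    proof (intro equalityI subsetI)
      fix y assume y: "y \<in> carrier (sum_group {..<k} C)"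
      \<comment> \<open>Place the entries of \<open>y\<close> in the last coordinates and pull the
        vector back along the automorphism.\<close>
      define u where "u i = (if n - k \<le> i \<and> i < n then y (i - (n - k)) else 0)" for i
      have "u \<in> ?Z" by (auto simp: u_def int_lattice_def)
      then have "u \<in> U ` ?Z" using U by (simp add: lattice_aut_def bij_betw_def)
      then obtain a where a: "a \<in> ?Z" "u = U a" by blast
      have yC: "y j \<in> carrier (C j)" if "j < k" for j using y that unfolding csum by auto
      have "U a (s j) mod int (e j) = y j" if j: "j < k" for j
      proof (cases "s j < n")
        case True
        then have "U a (s j) = y j" unfolding a(2)[symmetric] by (simp add: u_def s_def)
        then show ?thesis using yC[OF j] by (auto simp: C_def carrier_integer_mod_group split: if_splits)
      next
        case False
        then show ?thesis using yC[OF j] by (simp add: C_def carrier_integer_mod_group e_def)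
      qed
      then have "T a j = y j" for j using y unfolding csum by (cases "j < k") (auto simp: T_def)
      then have "T a = y" by blast
      then have "y = h (D a)" using hT[OF a(1)] by simp
      then show "y \<in> h ` carrier M" using a(1) unfolding carrier by simp
    qed (use carrier hT T_in in auto)
  qed
  ultimately have "M \<cong> sum_group {..<k} C" unfolding is_iso_def iso_def by blast
  moreover have "cyclic_group (C j)" for j
  proof -
    interpret group "C j" by (rule grp)
    \<comment> \<open>The generator is \<open>0\<close> when \<open>e j = 1\<close> and
      \<open>1\<close> otherwise, including the infinite cyclic group for
      \<open>e j = 0\<close>.\<close>
    have "carrier (C j) = range (\<lambda>m::int. (1 mod int (e j)) [^]\<^bsub>C j\<^esub> m)"
    proof (intro equalityI subsetI)
      fix x assume "x \<in> carrier (C j)"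
      then have "x = (1 mod int (e j)) [^]\<^bsub>C j\<^esub> x"
        by (auto simp: C_def int_pow_integer_mod_group carrier_integer_mod_group mod_mult_right_eq split: if_splits)
      then show "x \<in> range (\<lambda>m::int. (1 mod int (e j)) [^]\<^bsub>C j\<^esub> m)" by blast
    next
      fix x assume "x \<in> range (\<lambda>m::int. (1 mod int (e j)) [^]\<^bsub>C j\<^esub> m)"
      then show "x \<in> carrier (C j)"
        by (auto simp: C_def int_pow_integer_mod_group carrier_integer_mod_group)
    qed
    moreover have "1 mod int (e j) \<in> carrier (C j)" by (auto simp: C_def carrier_integer_mod_group)
    ultimately show ?thesis using cyclic_group by blast
  qed
  ultimately show ?thesis
    unfolding direct_sum_of_cyclic_groups_def using grp by (intro exI[of _ C]) simp
qed

lemma (in group) additive_eq_int_pow: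
  assumes "\<And>w. f w \<in> carrier G" "\<And>w v. f (w + v) = f w \<otimes> f v"
  shows "f w = f 1 [^] (w::int)"
proof -
  have "f 0 = f 0 \<otimes> f 0" using assms(2)[of 0 0] by simp
  then have f0: "f 0 = \<one>" using assms(1)[of 0] by (metis l_cancel_one')
  show ?thesis
  proof (induction w rule: int_induct[where k = 0])
    case base
    then show ?case by (simp add: f0)
  next
    case (step1 i)
    then show ?case using assms(2)[of i 1] int_pow_mult[OF assms(1)[of 1], of i 1] assms(1) by simp
  next
    case (step2 i)
    have "f (i - 1) \<otimes> f 1 = f 1 [^] (i - 1) \<otimes> f 1"
      using assms(2)[of "i - 1" 1] int_pow_mult[OF assms(1)[of 1], of "i - 1" 1] assms(1) step2 by simp
    then show ?case using assms(1) by (metis int_pow_closed right_cancel)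
  qed
qed

text \<open>Vectors that map to generators of the cyclic summands serve as \<open>z\<close>. Two
  lattice vectors with equal components in all summands differ by an element of
  \<open>L\<close>.\<close>

lemma generators_of_direct_sum:
  assumes carrier: "carrier M = D ` int_lattice n"
    and mult: "\<And>z w. z \<in> int_lattice n \<Longrightarrow> w \<in> int_lattice n \<Longrightarrow> D z \<otimes>\<^bsub>M\<^esub> D w = D (\<lambda>i. z i + w i)"
    and eq: "\<And>z w. z \<in> int_lattice n \<Longrightarrow> w \<in> int_lattice n \<Longrightarrow> D z = D w \<longleftrightarrow> (\<lambda>i. z i - w i) \<in> L"
    and sum: "direct_sum_of_cyclic_groups k M"
  shows "\<exists>z. (\<forall>i<k. z i \<in> int_lattice n) \<and> (\<forall>a\<in>int_lattice n. \<exists>w. (\<lambda>t. a t - (\<Sum>i<k. w i * z i t)) \<in> L)"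
proof -
  let ?Z = "int_lattice n"
  obtain C :: "nat \<Rightarrow> int monoid" where C: "\<And>i. i < k \<Longrightarrow> group (C i)" "\<And>i. i < k \<Longrightarrow> cyclic_group (C i)"
    and iso: "M \<cong> sum_group {..<k} C"
    using sum unfolding direct_sum_of_cyclic_groups_def by blast
  let ?S = "sum_group {..<k} C"
  obtain h where h: "h \<in> hom M ?S" "bij_betw h (carrier M) (carrier ?S)"
    using iso unfolding is_iso_def iso_def by blast
  have csum: "carrier ?S = (\<Pi>\<^sub>E j\<in>{..<k}. carrier (C j))"
    by (subst carrier_sum_group) (auto simp: C)
  define f where "f i a = h (D a) i" for i a
  have Dm: "D a \<in> carrier M" if "a \<in> ?Z" for a using carrier that by blast
  have hS: "h (D a) \<in> carrier ?S" if "a \<in> ?Z" for a using h(1) Dm[OF that] by (auto simp: hom_def)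
  have f_in: "f i a \<in> carrier (C i)" if "i < k" "a \<in> ?Z" for i a
    using hS[OF that(2)] that(1) unfolding csum f_def by auto
  have f_add: "f i (\<lambda>t. a t + b t) = f i a \<otimes>\<^bsub>C i\<^esub> f i b" if "i < k" "a \<in> ?Z" "b \<in> ?Z" for i a b
    using hom_mult[OF h(1) Dm[OF that(2)] Dm[OF that(3)]] mult[OF that(2,3)] that(1) by (simp add: f_def)
  have scale_in: "(\<lambda>t. w * a t) \<in> ?Z" if "a \<in> ?Z" for a w using that by (auto simp: int_lattice_def)
  have f_scale: "f i (\<lambda>t. w * a t) = f i a [^]\<^bsub>C i\<^esub> w" if i: "i < k" and a: "a \<in> ?Z" for i a w
  proof -
    interpret group "C i" by (rule C(1)[OF i])
    have "(\<lambda>w. f i (\<lambda>t. w * a t)) w = (\<lambda>w. f i (\<lambda>t. w * a t)) 1 [^]\<^bsub>C i\<^esub> w"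
    proof (rule additive_eq_int_pow)
      show "f i (\<lambda>t. w * a t) \<in> carrier (C i)" for w using f_in[OF i scale_in[OF a]] .
      show "f i (\<lambda>t. (w + v) * a t) = f i (\<lambda>t. w * a t) \<otimes>\<^bsub>C i\<^esub> f i (\<lambda>t. v * a t)" for w v
        using f_add[OF i scale_in[OF a] scale_in[OF a], of w v] by (simp add: distrib_right)
    qed
    then show ?thesis by simp
  qed
  have f_zero: "f i (\<lambda>_. 0) = \<one>\<^bsub>C i\<^esub>" if "i < k" for i
    using f_scale[OF that int_lattice_zero, of 0] by simp
  have "\<exists>c. c \<in> carrier (C i) \<and> carrier (C i) = range (\<lambda>n::int. c [^]\<^bsub>C i\<^esub> n)" if "i < k" for i
    using C[OF that] group.cyclic_group by blast
  then obtain c where c: "\<And>i. i < k \<Longrightarrow> c i \<in> carrier (C i)" "\<And>i. i < k \<Longrightarrow> carrier (C i) = range (\<lambda>n::int. c i [^]\<^bsub>C i\<^esub> n)"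
    by metis
  define u where "u i = (\<lambda>j\<in>{..<k}. if j = i then c i else \<one>\<^bsub>C j\<^esub>)" for i
  have "\<exists>z. z \<in> ?Z \<and> h (D z) = u i" if i: "i < k" for i
  proof -
    have "u i \<in> carrier ?S"
      unfolding csum using c(1) C(1) i by (auto simp: u_def group.is_monoid monoid.one_closed)
    then have "u i \<in> h ` carrier M" using h(2) by (simp add: bij_betw_def)
    then show ?thesis unfolding carrier by auto
  qed
  then obtain z where z: "\<And>i. i < k \<Longrightarrow> z i \<in> ?Z" "\<And>i. i < k \<Longrightarrow> h (D (z i)) = u i" by metis
  have sum_in: "(\<lambda>t. \<Sum>i<m. w i * z i t) \<in> ?Z" if "m \<le> k" for w :: "nat \<Rightarrow> int" and m
    using z(1) that by (auto simp: int_lattice_def intro!: sum.neutral)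
  have f_sum: "f j (\<lambda>t. \<Sum>i<m. w i * z i t) = (if j < m then c j [^]\<^bsub>C j\<^esub> w j else \<one>\<^bsub>C j\<^esub>)"
    if "m \<le> k" and j: "j < k" for m j w
    using that(1)
  proof (induction m)
    case 0
    then show ?case using f_zero[OF j] by simp
  next
    case (Suc m)
    interpret group "C j" by (rule C(1)[OF j])
    have m: "m < k" "m \<le> k" using Suc.prems by auto
    have fz: "f j (z m) = (if j = m then c j else \<one>\<^bsub>C j\<^esub>)" using z(2)[OF m(1)] j by (auto simp: f_def u_def)
    have "f j (\<lambda>t. \<Sum>i<Suc m. w i * z i t) = f j (\<lambda>t. \<Sum>i<m. w i * z i t) \<otimes>\<^bsub>C j\<^esub> f j (\<lambda>t. w m * z m t)"
      using f_add[OF j sum_in[OF m(2)] scale_in[OF z(1)[OF m(1)]]] by simp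
    also have "\<dots> = (if j < m then c j [^]\<^bsub>C j\<^esub> w j else \<one>\<^bsub>C j\<^esub>) \<otimes>\<^bsub>C j\<^esub> (if j = m then c j else \<one>\<^bsub>C j\<^esub>) [^]\<^bsub>C j\<^esub> w m"
      using Suc.IH m f_scale[OF j z(1)[OF m(1)]] fz by simp
    also have "\<dots> = (if j < Suc m then c j [^]\<^bsub>C j\<^esub> w j else \<one>\<^bsub>C j\<^esub>)"
    proof -
      have "\<one>\<^bsub>C j\<^esub> \<otimes>\<^bsub>C j\<^esub> c j [^]\<^bsub>C j\<^esub> w j = c j [^]\<^bsub>C j\<^esub> w j"
        "c j [^]\<^bsub>C j\<^esub> w j \<otimes>\<^bsub>C j\<^esub> \<one>\<^bsub>C j\<^esub> = c j [^]\<^bsub>C j\<^esub> w j"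
        using c(1)[OF j] by simp_all
      then show ?thesis by (cases "j = m"; cases "j < m") (simp_all add: less_Suc_eq int_pow_one)
    qed
    finally show ?case .
  qed
  have "\<exists>w. (\<lambda>t. a t - (\<Sum>i<k. w i * z i t)) \<in> L" if a: "a \<in> ?Z" for a
  proof -
    have "\<exists>w. f i a = c i [^]\<^bsub>C i\<^esub> (w::int)" if "i < k" for i
      using f_in[OF that a] c(2)[OF that] by auto
    then obtain w :: "nat \<Rightarrow> int" where w: "\<And>i. i < k \<Longrightarrow> f i a = c i [^]\<^bsub>C i\<^esub> w i" by metis
    let ?s = "\<lambda>t. \<Sum>i<k. w i * z i t"
    have sZ: "?s \<in> ?Z" using sum_in[of k w] by simp
    have "h (D a) = h (D ?s)"
    proof (rule PiE_ext)
      show "h (D a) \<in> (\<Pi>\<^sub>E j\<in>{..<k}. carrier (C j))" "h (D ?s) \<in> (\<Pi>\<^sub>E j\<in>{..<k}. carrier (C j))"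
        using hS[OF a] hS[OF sZ] unfolding csum by auto
      show "h (D a) j = h (D ?s) j" if "j \<in> {..<k}" for j
        using w[of j] f_sum[of k j w] that by (simp add: f_def)
    qed
    then have "D a = D ?s" using h(2) Dm[OF a] Dm[OF sZ] by (auto simp: bij_betw_def inj_on_def)
    then show ?thesis using eq[OF a sZ] by blast
  qed
  then show ?thesis using z(1) by blast
qed

subsection \<open>Coverings induced from a torus of smaller dimension\<close>

lemma torus_map_from_lattice_map:
  assumes A: "continuous_map (Euclidean_space n) (Euclidean_space k) A"
    and shift: "\<And>x z. x \<in> topspace (Euclidean_space n) \<Longrightarrow> z \<in> int_lattice n \<Longrightarrow>
      torus_exp k (A (vec_shift x z)) = torus_exp k (A x)"
  obtains f where "continuous_map (torus n) (torus k) f"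
    "\<And>x. x \<in> topspace (Euclidean_space n) \<Longrightarrow> f (torus_exp n x) = torus_exp k (A x)"
proof -
  let ?R = "Euclidean_space n"
  define f where "f w = torus_exp k (A (SOME x. x \<in> topspace ?R \<and> torus_exp n x = w))" for w
  have fe: "f (torus_exp n x) = torus_exp k (A x)" if x: "x \<in> topspace ?R" for x
  proof -
    let ?y = "SOME y. y \<in> topspace ?R \<and> torus_exp n y = torus_exp n x"
    have y: "?y \<in> topspace ?R \<and> torus_exp n ?y = torus_exp n x" by (rule someI[of _ x]) (use x in simp)
    then obtain z where "z \<in> int_lattice n" "?y = vec_shift x z"
      using torus_exp_eq_iff[OF x, of ?y] by auto
    then show ?thesis using shift[OF x] by (simp add: f_def)
  qed
  \<comment> \<open>The identity is a covering whose lifts are \<open>torus_exp\<close> itself,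
    which makes continuity of \<open>f\<close> testable on Euclidean space.\<close>
  have cov: "covering_map (torus n) (torus n) (\<lambda>w. w)"
    unfolding covering_map_def
  proof (intro conjI ballI)
    show "continuous_map (torus n) (torus n) (\<lambda>w. w)" using continuous_map_id by (simp add: id_def)
    fix x assume "x \<in> topspace (torus n)"
    moreover have "homeomorphic_map (subtopology (torus n) (topspace (torus n))) (subtopology (torus n) (topspace (torus n))) (\<lambda>w. w)"
      using homeomorphic_map_id[of "torus n" "torus n"] by (simp add: id_def)
    ultimately show "\<exists>U. openin (torus n) U \<and> x \<in> U \<and> (\<exists>\<V>. \<Union> \<V> = {e \<in> topspace (torus n). e \<in> U} \<and> pairwise disjnt \<V> \<and>
         (\<forall>V\<in>\<V>. openin (torus n) V \<and> homeomorphic_map (subtopology (torus n) V) (subtopology (torus n) U) (\<lambda>w. w)))"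
      by (intro exI[of _ "topspace (torus n)"] conjI exI[of _ "{topspace (torus n)}"]) auto
  qed simp
  have "continuous_map (torus n) (torus k) f"
  proof (rule continuous_map_torus_lifts[OF cov])
    fix l assume "torus_lift n (torus n) (\<lambda>w. w) l"
    then have l: "l x = torus_exp n x" if "x \<in> topspace ?R" for x using that by (simp add: torus_lift_def)
    show "continuous_map ?R (torus k) (\<lambda>x. f (l x))"
    proof (rule continuous_map_eq)
      show "continuous_map ?R (torus k) (torus_exp k \<circ> A)"
        by (rule continuous_map_compose[OF A continuous_map_torus_exp])
    qed (simp add: l fe)
  qed
  then show ?thesis using that fe by blast
qed

text \<open>The inducing covering over the \<open>k\<close>-torus is a pullback of \<open>E\<close>,
  so its points are pairs; this is the origin of the product type.\<close>

theorem inducible_from_torus: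
  fixes E :: "'e topology"
  assumes cov: "covering_map E (torus n) p" and ne: "e0 \<in> topspace E"
    and z: "\<And>i. i < k \<Longrightarrow> z i \<in> int_lattice n"
    and gen: "\<And>a. a \<in> int_lattice n \<Longrightarrow> \<exists>w. (\<lambda>t. a t - (\<Sum>i<k. w i * z i t)) \<in> periods n E p"
  shows "inducible_from TYPE((nat \<Rightarrow> complex) \<times> 'e) E (torus n) p (torus k)"
proof -
  let ?R = "Euclidean_space n"
  define unit where "unit j = (\<lambda>t. if t = j then 1 else 0 :: int)" for j :: nat
  have unit: "unit j \<in> int_lattice n" if "j < n" for j using that by (auto simp: unit_def int_lattice_def)
  have "\<exists>w. (\<lambda>t. unit j t - (\<Sum>i<k. w i * z i t)) \<in> periods n E p" if "j < n" for j
    using gen[OF unit[OF that]] .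
  then obtain W where W: "\<And>j. j < n \<Longrightarrow> (\<lambda>t. unit j t - (\<Sum>i<k. W j i * z i t)) \<in> periods n E p" by metis
  \<comment> \<open>\<open>A\<close> and \<open>B\<close> are the linear maps given by the matrices
    \<open>W\<close> and \<open>z\<close>, and \<open>CZ\<close> is the effect of
    \<open>B \<circ> A\<close> on lattice vectors.\<close>
  define A where "A x = (\<lambda>i. if i < k then \<Sum>j<n. of_int (W j i) * x j else 0 :: real)" for x :: "nat \<Rightarrow> real"
  define B where "B y = (\<lambda>t. \<Sum>i<k. y i * of_int (z i t) :: real)" for y :: "nat \<Rightarrow> real"
  define CZ where "CZ a = (\<lambda>t. \<Sum>i<k. (\<Sum>j<n. W j i * a j) * z i t)" for a :: "nat \<Rightarrow> int"
  have zz: "z i t = 0" if "i < k" "n \<le> t" for i t using z[OF that(1)] that(2) by (simp add: int_lattice_def)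
  have cA: "continuous_map ?R (Euclidean_space k) A"
    unfolding continuous_map_Euclidean_space A_def
    by (auto intro!: continuous_map_sum continuous_map_real_mult continuous_map_Euclidean_coord)
  have cB: "continuous_map (Euclidean_space k) ?R B"
    unfolding continuous_map_Euclidean_space B_def
    by (auto intro!: continuous_map_sum continuous_map_real_mult continuous_map_Euclidean_coord simp: zz)
  have A_shift: "A (vec_shift x a) = vec_shift (A x) (\<lambda>i. if i < k then \<Sum>j<n. W j i * a j else 0)" for x a
    by (auto simp: A_def vec_shift_def fun_eq_iff distrib_left sum.distrib)
  have B_shift: "B (vec_shift y b) = vec_shift (B y) (\<lambda>t. \<Sum>i<k. b i * z i t)" for y b
    by (auto simp: B_def vec_shift_def fun_eq_iff distrib_right sum.distrib)
  have C_shift: "B (A (vec_shift x a)) = vec_shift (B (A x)) (CZ a)" for x a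
    unfolding A_shift B_shift by (simp add: CZ_def vec_shift_def)
  have CZ_in: "CZ a \<in> int_lattice n" for a by (auto simp: CZ_def int_lattice_def zz)
  have CZ_per: "(\<lambda>t. a t - CZ a t) \<in> periods n E p" if a: "a \<in> int_lattice n" for a
  proof -
    \<comment> \<open>A lattice vector is a combination of unit vectors, for which \<open>W\<close>
      gives the claim, and periods are closed under such combinations.\<close>
    have "(\<lambda>t. \<Sum>j<m. a j * (unit j t - (\<Sum>i<k. W j i * z i t))) \<in> periods n E p" if "m \<le> n" for m
      using that
    proof (induction m)
      case 0
      then show ?case by (simp add: periods_zero)
    next
      case (Suc m)
      from periods_comb[OF Suc.IH W[of m], of "a m"] Suc.prems show ?case by (simp add: add.commute)
    qed
    from this[of n] have "(\<lambda>t. \<Sum>j<n. a j * (unit j t - (\<Sum>i<k. W j i * z i t))) \<in> periods n E p" by simp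
    moreover have "(\<Sum>j<n. a j * (unit j t - (\<Sum>i<k. W j i * z i t))) = a t - CZ a t" for t
    proof -
      have "(\<Sum>j<n. a j * unit j t) = a t"
        using a by (cases "t < n") (auto simp: unit_def int_lattice_def if_distrib[of "\<lambda>x. _ * x"] cong: if_cong)
      moreover have "(\<Sum>j<n. a j * (\<Sum>i<k. W j i * z i t)) = CZ a t"
        unfolding CZ_def sum_distrib_left sum_distrib_right
        by (subst sum.swap) (simp add: mult_ac)
      ultimately show ?thesis by (simp add: right_diff_distrib sum_subtractf)
    qed
    ultimately show ?thesis by simp
  qed
  obtain f where f: "continuous_map (torus n) (torus k) f"
    "\<And>x. x \<in> topspace ?R \<Longrightarrow> f (torus_exp n x) = torus_exp k (A x)"
    by (rule torus_map_from_lattice_map[OF cA]) (simp add: A_shift torus_exp_shift, rule that)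
  obtain b where b: "continuous_map (torus k) (torus n) b"
    "\<And>x. x \<in> topspace (Euclidean_space k) \<Longrightarrow> b (torus_exp k x) = torus_exp n (B x)"
    by (rule torus_map_from_lattice_map[OF cB]) (simp add: B_shift torus_exp_shift, rule that)
  have AR: "A x \<in> topspace (Euclidean_space k)" for x by (simp add: in_Euclidean_space A_def)
  have BR: "B y \<in> topspace ?R" for y by (auto simp: in_Euclidean_space B_def zz)
  let ?F = "pullback_space (torus k) b E p"
  let ?G = "pullback_space (torus n) f ?F fst"
  have covF: "covering_map ?F (torus k) fst" by (rule covering_map_pullback[OF cov b(1)])
  have covG: "covering_map ?G (torus n) fst" by (rule covering_map_pullback[OF covF f(1)])
  \<comment> \<open>A lift \<open>l\<close> is sent to the lift of the double pullback whose
    component in \<open>E\<close> is \<open>l\<close> along \<open>B \<circ> A\<close>.\<close>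
  define th where "th l = (\<lambda>x. (torus_exp n x, (f (torus_exp n x), l (B (A x)))))" for l :: "(nat \<Rightarrow> real) \<Rightarrow> 'e"
  have cBA: "continuous_map ?R ?R (\<lambda>x. B (A x))" using continuous_map_compose[OF cA cB] by (simp add: o_def)
  have bf: "b (f (torus_exp n x)) = torus_exp n (B (A x))" if "x \<in> topspace ?R" for x
    using f(2)[OF that] b(2)[OF AR] by simp
  have "isomorphic_coverings (torus n) E p ?G fst"
  proof (rule isomorphic_coverings_torusI[OF cov covG, of th])
    fix l assume l: "torus_lift n E p l"
    have "continuous_map ?R E (\<lambda>x. l (B (A x)))"
      using continuous_map_compose[OF cBA, of E l] l by (simp add: o_def torus_lift_def)
    moreover have "continuous_map ?R (torus k) (\<lambda>x. f (torus_exp n x))"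
      using continuous_map_compose[OF continuous_map_torus_exp f(1)] by (simp add: o_def)
    ultimately show "torus_lift n ?G fst (th l)"
      using bf torus_liftD(1)[OF l BR]
      by (simp add: torus_lift_def continuous_map_pullback_iff th_def o_def continuous_map_torus_exp)
  next
    fix m assume m: "torus_lift n ?G fst m"
    then have cm: "continuous_map ?R ?G m" and m1: "\<And>x. x \<in> topspace ?R \<Longrightarrow> fst (m x) = torus_exp n x"
      by (auto simp: torus_lift_def)
    have c2: "continuous_map ?R ?F (\<lambda>x. snd (m x))" and m2: "\<And>x. x \<in> topspace ?R \<Longrightarrow> f (torus_exp n x) = fst (snd (m x))"
      using cm m1 by (auto simp: continuous_map_pullback_iff o_def)
    have c3: "continuous_map ?R E (\<lambda>x. snd (snd (m x)))" and m3: "\<And>x. x \<in> topspace ?R \<Longrightarrow> p (snd (snd (m x))) = b (fst (snd (m x)))"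
      using c2 by (auto simp: continuous_map_pullback_iff o_def)
    \<comment> \<open>\<open>B \<circ> A\<close> fixes the origin, so a lift \<open>m\<close> of the
      pullback is recovered from its value there.\<close>
    let ?o = "\<lambda>_::nat. 0::real"
    have o: "?o \<in> topspace ?R" by (simp add: in_Euclidean_space)
    have BAo: "B (A ?o) = ?o" by (simp add: A_def B_def)
    have "snd (snd (m ?o)) \<in> topspace E" using continuous_map_in_topspace[OF c3 o] .
    moreover have "p (snd (snd (m ?o))) = torus_exp n ?o"
      using m3[OF o] m2[OF o] bf[OF o] BAo by simp
    ultimately obtain l where l: "torus_lift n E p l" "l ?o = snd (snd (m ?o))"
      using torus_lift_exists[OF cov o] by blast
    have "l (B (A x)) = snd (snd (m x))" if x: "x \<in> topspace ?R" for x
    proof (rule lifts_unique[where S = ?R and g = "\<lambda>x. l (B (A x))" and h = "\<lambda>x. snd (snd (m x))" and a = ?o])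
      show "covering_map E (torus n) p" by (rule cov)
      show "continuous_map ?R E (\<lambda>x. l (B (A x)))"
        using continuous_map_compose[OF cBA, of E l] l(1) by (simp add: o_def torus_lift_def)
      show "p (l (B (A s))) = p (snd (snd (m s)))" if "s \<in> topspace ?R" for s
        using m3[OF that] m2[OF that] bf[OF that] torus_liftD(1)[OF l(1) BR] by simp
    qed (use c3 o x l BAo in \<open>simp_all add: connected_Euclidean_space\<close>)
    then have "\<forall>x\<in>topspace ?R. th l x = m x"
      using m1 m2 by (simp add: th_def prod_eq_iff)
    then show "\<exists>l. torus_lift n E p l \<and> (\<forall>x\<in>topspace ?R. th l x = m x)" using l(1) by blast
  next
    fix l l' a a' assume l: "torus_lift n E p l" "torus_lift n E p l'" and a: "a \<in> topspace ?R" "a' \<in> topspace ?R"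
    show "l a = l' a' \<longleftrightarrow> th l a = th l' a'"
    proof (cases "torus_exp n a = torus_exp n a'")
      case True
      then obtain w where w: "w \<in> int_lattice n" "a' = vec_shift a w" using torus_exp_eq_iff[OF a] by blast
      have ls: "torus_lift n E p (\<lambda>x. l' (vec_shift x w))" by (rule torus_lift_shift[OF l(2) w(1)])
      \<comment> \<open>\<open>w\<close> and \<open>CZ w\<close> differ by a period, so exchanging
        the two translations does not change the value of \<open>l'\<close>.\<close>
      have "l' (vec_shift (vec_shift (B (A a)) (CZ w)) (\<lambda>t. w t - CZ w t)) = l' (vec_shift (B (A a)) (CZ w))"
        by (rule periodsD[OF CZ_per[OF w(1)] l(2) vec_shift_in[OF BR CZ_in]])
      then have *: "l' (B (A a')) = l' (vec_shift (B (A a)) w)"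
        unfolding w(2) C_shift by (simp add: vec_shift_add)
      have "l a = l' a' \<longleftrightarrow> l (B (A a)) = l' (B (A a'))"
        unfolding * unfolding w(2)
        using torus_lift_eq[OF cov l(1) ls a(1) _ BR] torus_lift_eq[OF cov l(1) ls BR _ a(1)] by blast
      then show ?thesis using True by (simp add: th_def)
    next
      case False
      then show ?thesis using torus_liftD(1)[OF l(1) a(1)] torus_liftD(1)[OF l(2) a(2)] by (auto simp: th_def)
    qed
  qed
  moreover have "\<exists>u0 y0. pointed_covering ?F u0 (torus k) y0 fst"
  proof -
    have "torus_exp k (\<lambda>_. 0) \<in> fst ` topspace ?F"
      unfolding covering_mapD(2)[OF covF] by (rule torus_exp_in)
    then obtain u0 where "u0 \<in> topspace ?F" by blast
    moreover have "connected_space (torus k)"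
    proof -
      have "torus_exp k ` topspace (Euclidean_space k) = topspace (torus k)"
        using covering_mapD(2)[OF covering_map_torus_exp] .
      then show ?thesis
        using connectedin_continuous_map_image[OF continuous_map_torus_exp, of k "topspace (Euclidean_space k)"]
        by (simp add: connectedin_topspace connected_Euclidean_space)
    qed
    ultimately show ?thesis using covF unfolding pointed_covering_def by (intro exI[of _ u0] exI[of _ "fst u0"]) simp
  qed
  ultimately show ?thesis
    unfolding inducible_from_def using f(1) by blast
qed

section \<open>Covers of Euclidean space that are periodic under a lattice\<close>

text \<open>Smallness in the first \<open>n\<close> coordinates suffices, since points of the space
  agree in all the others.\<close>

lemma openin_Euclidean_space_box:
  assumes "openin (Euclidean_space n) T" "x \<in> T"
  obtains r where "r > 0" "\<And>y. y \<in> topspace (Euclidean_space n) \<Longrightarrow> \<forall>t<n. \<bar>y t - x t\<bar> < r \<Longrightarrow> y \<in> T"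
proof -
  obtain T' where T': "openin (powertop_real UNIV) T'" "T = T' \<inter> {x. \<forall>i\<ge>n. x i = 0}"
    using assms(1) unfolding Euclidean_space_def openin_subtopology by blast
  then have xT: "x \<in> T'" using assms(2) by blast
  obtain U where U: "\<forall>i\<in>UNIV. openin euclideanreal (U i)" "x \<in> Pi\<^sub>E UNIV U" "Pi\<^sub>E UNIV U \<subseteq> T'"
    using T'(1) xT unfolding openin_product_topology_alt by blast
  have "\<exists>r>0. \<forall>y. \<bar>y - x i\<bar> < r \<longrightarrow> y \<in> U i" for i
  proof -
    have "open (U i)" "x i \<in> U i" using U(1,2) by (auto simp: PiE_iff)
    then show ?thesis unfolding open_dist dist_real_def by blast
  qed
  then obtain r where r: "\<And>i. r i > 0" "\<And>i y. \<bar>y - x i\<bar> < r i \<Longrightarrow> y \<in> U i" by metis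
  \<comment> \<open>The inserted \<open>1\<close> keeps the minimum defined for
    \<open>n = 0\<close>.\<close>
  define d where "d = Min (insert 1 (r ` {..<n}))"
  have d: "d > 0" "\<And>i. i < n \<Longrightarrow> d \<le> r i" using r(1) by (auto simp: d_def)
  show ?thesis
  proof (rule that[OF d(1)])
    fix y assume y: "y \<in> topspace (Euclidean_space n)" "\<forall>t<n. \<bar>y t - x t\<bar> < d"
    have "y i \<in> U i" for i
    proof (cases "i < n")
      case True
      then show ?thesis using y(2) d(2) r(2) by (meson less_le_trans)
    next
      case False
      then have "y i = x i" using y(1) assms(2) T'(2) by (auto simp: in_Euclidean_space)
      then show ?thesis using r(1)[of i] r(2)[where i = i and y = "x i"] by simp
    qed
    then have "y \<in> T'" using U(3) by (auto simp: PiE_iff)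
    then show "y \<in> T" using T'(2) y(1) by (simp add: in_Euclidean_space)
  qed
qed

text \<open>A Lebesgue number for the cover of the unit cube by boxes of varying radii. It also
  bounds the radius of the box that is found, so a displacement below \<open>\<delta>\<close> stays
  within twice that radius.\<close>

lemma cube_lebesgue:
  fixes \<rho> :: "(nat \<Rightarrow> real) \<Rightarrow> real" and m :: nat
  assumes "\<And>s. \<rho> s > 0"
  obtains \<delta> where "\<delta> > 0" "\<forall>s. (\<forall>t<m. 0 \<le> s t \<and> s t \<le> 1) \<longrightarrow>
    (\<exists>c. \<rho> c \<ge> \<delta> \<and> (\<forall>t<m. \<bar>s t - c t\<bar> < \<rho> c))"
proof -
  \<comment> \<open>Coordinates from \<open>m\<close> on are set to \<open>0\<close>, so that the
    cube is a product of compact sets.\<close>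
  define K where "K = Pi\<^sub>E UNIV (\<lambda>t. if t < m then {0..1::real} else {0})"
  define O' where "O' c = {s \<in> topspace (powertop_real UNIV). \<forall>t\<in>{..<m}. \<bar>s t - c t\<bar> < \<rho> c}" for c
  have K: "compactin (powertop_real UNIV) K" unfolding K_def by (subst compactin_PiE) auto
  have O: "openin (powertop_real UNIV) (O' c)" for c
    unfolding O'_def
  proof (rule openin_finite_ball)
    fix t
    have "continuous_map (powertop_real UNIV) euclideanreal (\<lambda>s. \<bar>s t - c t\<bar>)"
      by (intro continuous_intros) auto
    from openin_continuous_map_preimage[OF this, of "{..<\<rho> c}"]
    show "openin (powertop_real UNIV) {s \<in> topspace (powertop_real UNIV). \<bar>s t - c t\<bar> < \<rho> c}" by simp
  qed simp
  have "K \<subseteq> \<Union> (O' ` K)" using assms by (auto simp: O'_def)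
  then obtain F where F: "finite F" "F \<subseteq> O' ` K" "K \<subseteq> \<Union> F"
    using K O unfolding compactin_def by (metis (no_types, lifting) imageE)
  then obtain F' where F': "finite F'" "F' \<subseteq> K" "F = O' ` F'" using finite_subset_image by metis
  define \<delta> where "\<delta> = Min (insert 1 (\<rho> ` F'))"
  have \<delta>: "\<delta> > 0" "\<And>c. c \<in> F' \<Longrightarrow> \<delta> \<le> \<rho> c" using F'(1) assms by (auto simp: \<delta>_def)
  show ?thesis
  proof (rule that[OF \<delta>(1)], intro allI impI)
    fix s :: "nat \<Rightarrow> real" assume s: "\<forall>t<m. 0 \<le> s t \<and> s t \<le> 1"
    define s' where "s' t = (if t < m then s t else 0)" for t
    have "s' \<in> K" using s by (auto simp: K_def s'_def PiE_iff)
    then obtain c where "c \<in> F'" "s' \<in> O' c" using F(3) F'(3) by auto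
    then show "\<exists>c. \<rho> c \<ge> \<delta> \<and> (\<forall>t<m. \<bar>s t - c t\<bar> < \<rho> c)"
      using \<delta>(2) by (intro exI[of _ c]) (auto simp: O'_def s'_def)
  qed
qed

text \<open>The vectors \<open>b j\<close> are dual to the \<open>\<kappa> i\<close>, so sampling
  the \<open>\<phi> i\<close> on the parallelepiped that they span gives the situation of
  \<open>periodic_grid_nonconstant\<close>. The sets \<open>B i\<close> may fail to be open, so a
  sample point need not lie in the set attached to its cube; witnesses bridge this gap.\<close>

theorem lattice_cover_bound:
  fixes B :: "nat \<Rightarrow> (nat \<Rightarrow> real) set" and \<phi> :: "nat \<Rightarrow> (nat \<Rightarrow> real) \<Rightarrow> int"
    and \<kappa> :: "nat \<Rightarrow> (nat \<Rightarrow> int) \<Rightarrow> int"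
  assumes BR: "\<And>i. B i \<subseteq> topspace (Euclidean_space n)"
    and cover: "\<And>x. x \<in> topspace (Euclidean_space n) \<Longrightarrow> \<exists>i<m. x \<in> B i"
    and loc: "\<And>i x. i < m \<Longrightarrow> x \<in> B i \<Longrightarrow> \<exists>r>0. \<forall>y\<in>B i. (\<forall>t<n. \<bar>y t - x t\<bar> < r) \<longrightarrow> q dvd \<phi> i y - \<phi> i x"
    and per: "\<And>i x z. i < m \<Longrightarrow> x \<in> B i \<Longrightarrow> z \<in> int_lattice n \<Longrightarrow>
       vec_shift x z \<in> B i \<and> q dvd \<phi> i (vec_shift x z) - \<phi> i x - \<kappa> i z"
    and b: "\<And>j. j < m \<Longrightarrow> b j \<in> int_lattice n"
    and \<kappa>b: "\<And>i w. i < m \<Longrightarrow> \<kappa> i (\<lambda>t. \<Sum>j<m. w j * b j t) = w i"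
  shows "q dvd 1"
proof -
  let ?R = "Euclidean_space n"
  define near where "near x y r \<longleftrightarrow> (\<forall>t<n. \<bar>y t - x t\<bar> < r)" for x y :: "nat \<Rightarrow> real" and r
  \<comment> \<open>The value at \<open>x\<close> is read off from a nearby point \<open>y\<close>
    of \<open>B i\<close>; halving the radius makes any two such readings agree modulo
    \<open>q\<close>.\<close>
  define wit where "wit i x y r \<longleftrightarrow> y \<in> B i \<and> r > 0 \<and> near y x (r/2) \<and>
     (\<forall>y'\<in>B i. near y y' r \<longrightarrow> q dvd \<phi> i y' - \<phi> i y)" for i x y r
  (* \<psi> i extends \<phi> i modulo q to a neighbourhood of B i: each point of B i contributes the box of half
     the radius on which \<phi> i is constant. *)
  define \<psi> where "\<psi> i x = \<phi> i (SOME y. \<exists>r. wit i x y r)" for i x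
  \<comment> \<open>Of two half-size boxes through the same \<open>x\<close>, the full box of the
    larger one contains the other centre.\<close>
  have near_tri: "near y y' r" if "near y x (r/2)" "near y' x (r'/2)" "r' \<le> r" for x y y' r r'
    unfolding near_def
  proof (intro allI impI)
    fix t assume "t < n"
    then have "\<bar>x t - y t\<bar> < r/2" "\<bar>x t - y' t\<bar> < r'/2" using that by (auto simp: near_def)
    then show "\<bar>y' t - y t\<bar> < r" using that(3) by linarith
  qed
  have wit_eq: "q dvd \<phi> i y' - \<phi> i y" if w: "wit i x y r" "wit i x y' r'" for i x y r y' r'
  proof (cases "r' \<le> r")
    case True
    then have "near y y' r" using near_tri w by (auto simp: wit_def)
    then show ?thesis using w by (auto simp: wit_def)
  next
    case False
    then have "near y' y r'" using near_tri[of y' x r' y r] w by (auto simp: wit_def)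
    then have "q dvd \<phi> i y - \<phi> i y'" using w by (auto simp: wit_def)
    then show ?thesis by (simp add: dvd_diff_commute)
  qed
  have \<psi>_eq: "q dvd \<psi> i x - \<phi> i y" if w: "wit i x y r" for i x y r
  proof -
    have "\<exists>r. wit i x (SOME y. \<exists>r. wit i x y r) r"
      by (rule someI[of "\<lambda>y. \<exists>r. wit i x y r" y]) (use w in blast)
    then show ?thesis unfolding \<psi>_def using wit_eq[OF w] by blast
  qed
  have unshift: "vec_shift (vec_shift x z) (\<lambda>i. - z i) = x" for x z
    by (simp add: vec_shift_def)
  \<comment> \<open>A point of \<open>B i\<close> near the translated witness is translated back,
    compared with the original witness, and translated forth again; the two contributions of
    \<open>\<kappa> i z\<close> cancel.\<close>
  have wit_shift: "wit i (vec_shift x z) (vec_shift y z) r"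
    if i: "i < m" and w: "wit i x y r" and z: "z \<in> int_lattice n" for i x y r z
    unfolding wit_def
  proof (intro conjI ballI impI)
    have yB: "y \<in> B i" and r: "r > 0" using w by (auto simp: wit_def)
    show "vec_shift y z \<in> B i" "r > 0" using per[OF i yB z] r by auto
    show "near (vec_shift y z) (vec_shift x z) (r/2)" using w by (simp add: wit_def near_def vec_shift_def)
    fix y' assume y': "y' \<in> B i" "near (vec_shift y z) y' r"
    let ?mz = "\<lambda>i. - z i"
    have mz: "?mz \<in> int_lattice n" using z by (auto simp: int_lattice_def)
    let ?u = "vec_shift y' ?mz"
    have u: "?u \<in> B i" using per[OF i y'(1) mz] by blast
    have "near y ?u r" using y'(2) by (simp add: near_def vec_shift_def algebra_simps)
    then have 1: "q dvd \<phi> i ?u - \<phi> i y" using w u by (auto simp: wit_def)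
    have "vec_shift ?u z = y'" by (simp add: vec_shift_def)
    then have 2: "q dvd \<phi> i y' - \<phi> i ?u - \<kappa> i z" using per[OF i u z] by simp
    have 3: "q dvd \<phi> i (vec_shift y z) - \<phi> i y - \<kappa> i z" using per[OF i yB z] by blast
    have "\<phi> i y' - \<phi> i (vec_shift y z) =
      (\<phi> i y' - \<phi> i ?u - \<kappa> i z) + (\<phi> i ?u - \<phi> i y) - (\<phi> i (vec_shift y z) - \<phi> i y - \<kappa> i z)" by simp
    then show "q dvd \<phi> i y' - \<phi> i (vec_shift y z)" using 1 2 3 by (metis dvd_add dvd_diff)
  qed
  define P where "P s = (\<lambda>t. \<Sum>j<m. s j * of_int (b j t) :: real)" for s :: "nat \<Rightarrow> real"
  \<comment> \<open>A Lipschitz constant of \<open>P\<close> for maximum norms, increased by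
    \<open>1\<close> to be positive.\<close>
  define Q where "Q = 1 + (\<Sum>t<n. \<Sum>j<m. \<bar>of_int (b j t) :: real\<bar>)"
  have Q: "Q > 0" unfolding Q_def by (intro add_pos_nonneg sum_nonneg) auto
  have P_near: "\<bar>P s t - P s' t\<bar> \<le> \<epsilon> * Q" if "\<And>j. j < m \<Longrightarrow> \<bar>s j - s' j\<bar> \<le> \<epsilon>" "0 \<le> \<epsilon>" "t < n" for s s' t \<epsilon>
  proof -
    have "P s t - P s' t = (\<Sum>j<m. (s j - s' j) * of_int (b j t))"
      by (simp add: P_def sum_subtractf left_diff_distrib)
    then have "\<bar>P s t - P s' t\<bar> \<le> (\<Sum>j<m. \<bar>(s j - s' j) * of_int (b j t)\<bar>)" by simp
    also have "\<dots> \<le> (\<Sum>j<m. \<epsilon> * \<bar>of_int (b j t)\<bar>)"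
      using that by (intro sum_mono) (auto simp: abs_mult intro!: mult_right_mono)
    also have "\<dots> = \<epsilon> * (\<Sum>j<m. \<bar>of_int (b j t)\<bar>)" by (simp add: sum_distrib_left)
    also have "\<dots> \<le> \<epsilon> * Q"
    proof (intro mult_left_mono that)
      have "(\<Sum>j<m. \<bar>of_int (b j t) :: real\<bar>) \<le> (\<Sum>t<n. \<Sum>j<m. \<bar>of_int (b j t) :: real\<bar>)"
        by (rule member_le_sum[of t "{..<n}" "\<lambda>t. \<Sum>j<m. \<bar>of_int (b j t) :: real\<bar>"]) (use that in \<open>auto intro: sum_nonneg\<close>)
      then show "(\<Sum>j<m. \<bar>of_int (b j t) :: real\<bar>) \<le> Q" by (simp add: Q_def)
    qed
    finally show ?thesis .
  qed
  have PR: "P s \<in> topspace ?R" for s using b by (auto simp: in_Euclidean_space P_def int_lattice_def)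
  have "\<exists>i r. i < m \<and> wit i (P s) (P s) r" for s
  proof -
    obtain i where i: "i < m" "P s \<in> B i" using cover[OF PR] by blast
    obtain r where "r > 0" "\<forall>y\<in>B i. (\<forall>t<n. \<bar>y t - P s t\<bar> < r) \<longrightarrow> q dvd \<phi> i y - \<phi> i (P s)"
      using loc[OF i] by blast
    then have "wit i (P s) (P s) r" using i by (auto simp: wit_def near_def)
    then show ?thesis using i by blast
  qed
  then obtain ii rr where ir: "\<And>s. ii s < m" "\<And>s. wit (ii s) (P s) (P s) (rr s)" by metis
  have rr: "rr s > 0" for s using ir(2)[of s] by (simp add: wit_def)
  \<comment> \<open>With this radius, parameters closer than \<open>2 * \<rho> s\<close> to
    \<open>s\<close> are mapped by \<open>P\<close> to within \<open>rr s / 2\<close> of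
    \<open>P s\<close>.\<close>
  define \<rho> where "\<rho> s = rr s / (4 * Q)" for s
  have \<rho>: "\<rho> s > 0" for s using rr[of s] Q by (simp add: \<rho>_def)
  obtain \<delta> where \<delta>: "\<delta> > 0" "\<forall>s. (\<forall>t<m. 0 \<le> s t \<and> s t \<le> 1) \<longrightarrow>
    (\<exists>c. \<rho> c \<ge> \<delta> \<and> (\<forall>t<m. \<bar>s t - c t\<bar> < \<rho> c))"
    by (rule cube_lebesgue[of \<rho> m, OF \<rho>]) (rule that)
  \<comment> \<open>The mesh is below \<open>\<delta>\<close>, so a whole grid cube stays within
    twice the radius of the box found for its lowest corner.\<close>
  obtain N :: nat where N: "N > 0" "1 / real N < \<delta>"
    using \<delta>(1) by (metis nat_approx_posE zero_less_Suc)
  define pt where "pt v = (\<lambda>j. of_int (v j) / real N)" for v :: "nat \<Rightarrow> int"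
  \<comment> \<open>Sampling at residues modulo \<open>N\<close> and adding the quotient makes the
    periodicity of \<open>H i\<close> exact over the integers, whereas translation changes
    \<open>\<phi> i\<close> by a known amount only modulo \<open>q\<close>.\<close>
  define H where "H i v = \<psi> i (P (pt (\<lambda>j. v j mod int N))) + v i div int N" for i v
  show "q dvd 1"
  proof (rule periodic_grid_nonconstant[of m H N])
    fix i d v assume "i < m" "d < m"
    have "(\<lambda>j. (v(d := v d + int N)) j mod int N) = (\<lambda>j. v j mod int N)" by auto
    then show "H i (v(d := v d + int N)) = H i v + (if d = i then 1 else 0)"
      using N by (simp add: H_def)
  next
    fix v assume v: "v \<in> grid_box N {0..<m}"
    have "0 \<le> pt v t \<and> pt v t \<le> 1" if "t < m" for t
    proof -
      have "0 \<le> v t" "v t \<le> int N" using v that by (auto simp: grid_box_def less_imp_le)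
      then have "of_int (v t) \<le> (real N)" by linarith
      then show ?thesis using \<open>0 \<le> v t\<close> N by (simp add: pt_def)
    qed
    then obtain c where c: "\<rho> c \<ge> \<delta>" "\<forall>t<m. \<bar>pt v t - c t\<bar> < \<rho> c" using \<delta>(2)[rule_format, of "pt v"] by blast
    let ?i = "ii c"
    have "q dvd H ?i w - \<phi> ?i (P c)" if w: "w \<in> grid_cube {0..<m} v" for w
    proof -
      have wit1: "wit ?i (P c) (P c) (rr c)" by (rule ir(2))
      have strict: "\<bar>pt w j - c j\<bar> < 2 * \<rho> c" if "j < m" for j
      proof -
        have "w j = v j \<or> w j = v j + 1" using w that by (auto simp: grid_cube_def)
        then have "\<bar>pt w j - pt v j\<bar> \<le> 1 / real N" by (auto simp: pt_def add_divide_distrib)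
        moreover have "\<bar>pt v j - c j\<bar> < \<rho> c" using c(2) that by blast
        ultimately show ?thesis using c(1) N(2) by linarith
      qed
      obtain \<epsilon> where eps: "0 \<le> \<epsilon>" "\<epsilon> < 2 * \<rho> c" "\<And>j. j < m \<Longrightarrow> \<bar>pt w j - c j\<bar> \<le> \<epsilon>"
      proof -
        let ?M = "Max (insert 0 ((\<lambda>j. \<bar>pt w j - c j\<bar>) ` {..<m}))"
        have "?M < 2 * \<rho> c" using strict \<rho>[of c] by simp
        moreover have "0 \<le> ?M" "\<And>j. j < m \<Longrightarrow> \<bar>pt w j - c j\<bar> \<le> ?M" by simp_all
        ultimately show ?thesis using that by blast
      qed
      have "\<bar>P (pt w) t - P c t\<bar> < rr c / 2" if "t < n" for t
      proof -
        have "\<bar>P (pt w) t - P c t\<bar> \<le> \<epsilon> * Q" by (rule P_near) (use eps that in auto)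
        also have "\<dots> < 2 * \<rho> c * Q" using eps Q by simp
        also have "\<dots> = rr c / 2" using Q by (simp add: \<rho>_def)
        finally show ?thesis .
      qed
      then have wit2: "wit ?i (P (pt w)) (P c) (rr c)" using wit1 by (simp add: wit_def near_def)
      \<comment> \<open>The translation that reducing \<open>w\<close> modulo \<open>N\<close>
        induces on the sampled point. Its value under \<open>\<kappa>\<close> cancels the quotient
        that \<open>H\<close> adds.\<close>
      define z where "z = (\<lambda>t. \<Sum>j<m. (- (w j div int N)) * b j t)"
      have z: "z \<in> int_lattice n" using b by (auto simp: z_def int_lattice_def intro!: sum.neutral)
      have "P (pt (\<lambda>j. w j mod int N)) = vec_shift (P (pt w)) z"
      proof
        fix t
        have "pt (\<lambda>j. w j mod int N) j = pt w j - of_int (w j div int N)" for j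
        proof -
          have "w j mod int N = w j - int N * (w j div int N)" by (simp add: minus_mult_div_eq_mod)
          then have "pt (\<lambda>j. w j mod int N) j = (of_int (w j) - real N * of_int (w j div int N)) / real N"
            unfolding pt_def by (metis of_int_diff of_int_mult of_int_of_nat_eq)
          then show ?thesis using N(1) by (simp add: pt_def diff_divide_distrib)
        qed
        then have "P (pt (\<lambda>j. w j mod int N)) t = (\<Sum>j<m. (pt w j - of_int (w j div int N)) * of_int (b j t))"
          by (simp add: P_def)
        then show "P (pt (\<lambda>j. w j mod int N)) t = vec_shift (P (pt w)) z t"
          by (simp add: vec_shift_def z_def P_def left_diff_distrib sum_subtractf sum_negf)
      qed
      then have 1: "q dvd \<psi> ?i (P (pt (\<lambda>j. w j mod int N))) - \<phi> ?i (vec_shift (P c) z)"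
        using \<psi>_eq[OF wit_shift[OF ir(1) wit2 z]] by simp
      have "P c \<in> B ?i" using wit1 by (simp add: wit_def)
      then have 2: "q dvd \<phi> ?i (vec_shift (P c) z) - \<phi> ?i (P c) - \<kappa> ?i z" using per[OF ir(1) _ z] by blast
      have 3: "\<kappa> ?i z = - (w ?i div int N)" unfolding z_def by (rule \<kappa>b[OF ir(1)])
      have "H ?i w - \<phi> ?i (P c) = (\<psi> ?i (P (pt (\<lambda>j. w j mod int N))) - \<phi> ?i (vec_shift (P c) z))
          + (\<phi> ?i (vec_shift (P c) z) - \<phi> ?i (P c) - \<kappa> ?i z)"
        unfolding 3 by (simp add: H_def)
      then show ?thesis using 1 2 by (metis dvd_add)
    qed
    then have "q dvd H ?i w - H ?i w'" if "w \<in> grid_cube {0..<m} v" "w' \<in> grid_cube {0..<m} v" for w w'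
    proof -
      have "H ?i w - H ?i w' = (H ?i w - \<phi> ?i (P c)) - (H ?i w' - \<phi> ?i (P c))" by simp
      then show ?thesis using \<open>\<And>w. w \<in> grid_cube {0..<m} v \<Longrightarrow> q dvd H ?i w - \<phi> ?i (P c)\<close> that by (metis dvd_diff)
    qed
    then show "\<exists>i<m. \<forall>w\<in>grid_cube {0..<m} v. \<forall>w'\<in>grid_cube {0..<m} v. q dvd H i w - H i w'"
      using ir(1) by blast
  qed
qed

section \<open>CW-complexes\<close>

lemma continuous_map_sum_squares: "continuous_map (powertop_real UNIV) euclideanreal (\<lambda>x. \<Sum>i<d. (x (i::nat))\<^sup>2)"
  by (intro continuous_map_sum continuous_map_real_pow continuous_map_product_projection) auto

text \<open>Both are closed subsets of a product of compact intervals and points.\<close>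

lemma compactin_cw_disk: "compactin (Euclidean_space d) (cw_disk d)"
  and compactin_cw_sphere: "compactin (Euclidean_space d) (cw_disk d - cw_open_disk d)"
proof -
  let ?P = "powertop_real (UNIV :: nat set)"
  let ?B = "Pi\<^sub>E UNIV (\<lambda>i. if i < d then {-1..1::real} else {0})"
  have cB: "compactin ?P ?B" by (subst compactin_PiE) auto
  have "x i \<in> {-1..1}" if "(\<Sum>i<d. (x i)\<^sup>2) \<le> 1" "i < d" for x :: "nat \<Rightarrow> real" and i
  proof -
    have "(x i)\<^sup>2 \<le> (\<Sum>i<d. (x i)\<^sup>2)" by (rule member_le_sum) (use that in auto)
    then have "(x i)\<^sup>2 \<le> 1" using that by linarith
    then show ?thesis by (simp add: abs_square_le_1 abs_le_iff)
  qed
  then have sub: "cw_disk d \<subseteq> ?B" by (auto simp: cw_disk_def in_Euclidean_space PiE_iff)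
  have "closedin ?P {x \<in> topspace ?P. (\<Sum>i<d. (x i)\<^sup>2) \<in> {..1}}"
    by (rule closedin_continuous_map_preimage[OF continuous_map_sum_squares]) simp
  then have "closedin ?P (topspace (Euclidean_space d) \<inter> {x \<in> topspace ?P. (\<Sum>i<d. (x i)\<^sup>2) \<in> {..1}})"
    by (intro closedin_Int closedin_Euclidean_space)
  moreover have "topspace (Euclidean_space d) \<inter> {x \<in> topspace ?P. (\<Sum>i<d. (x i)\<^sup>2) \<in> {..1}} = cw_disk d"
    by (auto simp: cw_disk_def)
  ultimately have cl: "closedin ?P (cw_disk d)" by simp
  have "closedin ?P {x \<in> topspace ?P. (\<Sum>i<d. (x i)\<^sup>2) \<in> {1..}}"
    by (rule closedin_continuous_map_preimage[OF continuous_map_sum_squares]) simp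
  with cl have "closedin ?P (cw_disk d \<inter> {x \<in> topspace ?P. (\<Sum>i<d. (x i)\<^sup>2) \<in> {1..}})" by (rule closedin_Int)
  moreover have "cw_disk d \<inter> {x \<in> topspace ?P. (\<Sum>i<d. (x i)\<^sup>2) \<in> {1..}} = cw_disk d - cw_open_disk d"
    by (auto simp: cw_disk_def cw_open_disk_def)
  ultimately have cl2: "closedin ?P (cw_disk d - cw_open_disk d)" by simp
  have subE: "cw_disk d \<subseteq> {x. \<forall>i\<ge>d. x i = 0}" by (auto simp: cw_disk_def in_Euclidean_space)
  show "compactin (Euclidean_space d) (cw_disk d)"
    unfolding Euclidean_space_def compactin_subtopology using closed_compactin[OF cB sub cl] subE by blast
  show "compactin (Euclidean_space d) (cw_disk d - cw_open_disk d)"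
    unfolding Euclidean_space_def compactin_subtopology
    using closed_compactin[OF cB _ cl2] sub subE by blast
qed

lemma cw_open_disk_subset: "cw_open_disk d \<subseteq> cw_disk d"
  by (auto simp: cw_disk_def cw_open_disk_def)

lemma cw_structureD:
  assumes "cw_structure K C"
  shows "Hausdorff_space K"
    "\<And>d \<phi>. (d, \<phi>) \<in> C \<Longrightarrow> continuous_map (subtopology (Euclidean_space d) (cw_disk d)) K \<phi>"
    "\<And>d \<phi>. (d, \<phi>) \<in> C \<Longrightarrow> homeomorphic_map (subtopology (Euclidean_space d) (cw_open_disk d))
                         (subtopology K (\<phi> ` cw_open_disk d)) \<phi>"
    "\<And>x. x \<in> topspace K \<longleftrightarrow> (\<exists>d \<phi>. (d, \<phi>) \<in> C \<and> x \<in> \<phi> ` cw_open_disk d)"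
    "\<And>d \<phi> d' \<phi>' x. (d, \<phi>) \<in> C \<Longrightarrow> (d', \<phi>') \<in> C \<Longrightarrow> x \<in> \<phi> ` cw_open_disk d \<Longrightarrow> x \<in> \<phi>' ` cw_open_disk d' \<Longrightarrow> (d, \<phi>) = (d', \<phi>')"
    "\<And>d \<phi>. (d, \<phi>) \<in> C \<Longrightarrow> \<exists>D \<subseteq> C. finite D \<and> (\<forall>(d', \<phi>') \<in> D. d' < d) \<and>
        \<phi> ` (cw_disk d - cw_open_disk d) \<subseteq> (\<Union>(d', \<phi>') \<in> D. \<phi>' ` cw_open_disk d')"
    "\<And>A. A \<subseteq> topspace K \<Longrightarrow> (\<And>d \<phi>. (d, \<phi>) \<in> C \<Longrightarrow> closedin K (A \<inter> \<phi> ` cw_disk d)) \<Longrightarrow> closedin K A"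
proof -
  note c = assms[unfolded cw_structure_def]
  show "Hausdorff_space K" using c by blast
  show "\<And>d \<phi>. (d, \<phi>) \<in> C \<Longrightarrow> continuous_map (subtopology (Euclidean_space d) (cw_disk d)) K \<phi>"
    "\<And>d \<phi>. (d, \<phi>) \<in> C \<Longrightarrow> homeomorphic_map (subtopology (Euclidean_space d) (cw_open_disk d))
                         (subtopology K (\<phi> ` cw_open_disk d)) \<phi>"
    using conjunct1[OF conjunct2[OF c]] by auto
  show "x \<in> topspace K \<longleftrightarrow> (\<exists>d \<phi>. (d, \<phi>) \<in> C \<and> x \<in> \<phi> ` cw_open_disk d)" for x
    unfolding conjunct1[OF conjunct2[OF conjunct2[OF c]], symmetric]
    by (simp only: UN_iff Bex_def split_paired_Ex prod.case)
  show "(d, \<phi>) = (d', \<phi>')" if "(d, \<phi>) \<in> C" "(d', \<phi>') \<in> C" "x \<in> \<phi> ` cw_open_disk d" "x \<in> \<phi>' ` cw_open_disk d'" for d \<phi> d' \<phi>' x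
  proof (rule ccontr)
    assume "(d, \<phi>) \<noteq> (d', \<phi>')"
    from pairwiseD[OF conjunct1[OF conjunct2[OF conjunct2[OF conjunct2[OF c]]]] that(1,2) this]
    show False using that(3,4) by (simp add: disjnt_iff)
  qed
  show "\<exists>D \<subseteq> C. finite D \<and> (\<forall>(d', \<phi>') \<in> D. d' < d) \<and>
        \<phi> ` (cw_disk d - cw_open_disk d) \<subseteq> (\<Union>(d', \<phi>') \<in> D. \<phi>' ` cw_open_disk d')" if "(d, \<phi>) \<in> C" for d \<phi>
    using bspec[OF conjunct1[OF conjunct2[OF conjunct2[OF conjunct2[OF conjunct2[OF c]]]]] that] by simp
  show "closedin K A" if "A \<subseteq> topspace K" "\<And>d \<phi>. (d, \<phi>) \<in> C \<Longrightarrow> closedin K (A \<inter> \<phi> ` cw_disk d)" for A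
    using conjunct2[OF conjunct2[OF conjunct2[OF conjunct2[OF conjunct2[OF c]]]]] that by auto
qed

text \<open>By the weak topology it suffices to intersect with closed cells. A cell outside
  \<open>J\<close> meets the union only in its boundary, and closure-finiteness leaves finitely many
  closed cells of \<open>J\<close> there.\<close>

lemma cw_subcomplex_closedin:
  assumes cw: "cw_structure K C" and J: "J \<subseteq> C"
    and sub: "\<And>d \<phi>. (d, \<phi>) \<in> J \<Longrightarrow> \<phi> ` (cw_disk d - cw_open_disk d) \<subseteq> (\<Union>(d', \<phi>') \<in> J. \<phi>' ` cw_open_disk d')"
  shows "closedin K (\<Union>(d, \<phi>) \<in> J. \<phi> ` cw_open_disk d)"
proof (rule cw_structureD(7)[OF cw])
  let ?J = "\<Union>(d, \<phi>) \<in> J. \<phi> ` cw_open_disk d"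
  have disk: "closedin K (\<phi> ` cw_disk d)" "closedin K (\<phi> ` (cw_disk d - cw_open_disk d))" if "(d, \<phi>) \<in> C" for d \<phi>
  proof -
    note cont = cw_structureD(2)[OF cw that]
    have "compactin (subtopology (Euclidean_space d) (cw_disk d)) (cw_disk d)"
      "compactin (subtopology (Euclidean_space d) (cw_disk d)) (cw_disk d - cw_open_disk d)"
      by (auto simp: compactin_subtopology compactin_cw_disk compactin_cw_sphere)
    then show "closedin K (\<phi> ` cw_disk d)" "closedin K (\<phi> ` (cw_disk d - cw_open_disk d))"
      using image_compactin[OF _ cont] compactin_imp_closedin[OF cw_structureD(1)[OF cw]] by auto
  qed
  have Jdisk: "\<phi> ` cw_disk d \<subseteq> ?J" if "(d, \<phi>) \<in> J" for d \<phi>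
  proof -
    have 1: "\<phi> ` cw_disk d \<subseteq> \<phi> ` (cw_disk d - cw_open_disk d) \<union> \<phi> ` cw_open_disk d" by blast
    have 2: "\<phi> ` cw_open_disk d \<subseteq> ?J" using that by force
    show ?thesis by (rule order_trans[OF 1 Un_least[OF sub[OF that] 2]])
  qed
  show "?J \<subseteq> topspace K"
  proof
    fix x assume "x \<in> ?J"
    then obtain d1 \<phi>1 where "(d1, \<phi>1) \<in> J" "x \<in> \<phi>1 ` cw_open_disk d1" by auto
    then show "x \<in> topspace K" using cw_structureD(4)[OF cw, of x] J by blast
  qed
  fix d \<phi> assume c: "(d, \<phi>) \<in> C"
  show "closedin K (?J \<inter> \<phi> ` cw_disk d)"
  proof (cases "(d, \<phi>) \<in> J")
    case True
    have "?J \<inter> \<phi> ` cw_disk d = \<phi> ` cw_disk d" by (rule Int_absorb1[OF Jdisk[OF True]])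
    then show ?thesis using disk(1)[OF c] by simp
  next
    case False
    obtain D where D: "D \<subseteq> C" "finite D" "\<phi> ` (cw_disk d - cw_open_disk d) \<subseteq> (\<Union>(d', \<phi>') \<in> D. \<phi>' ` cw_open_disk d')"
      using cw_structureD(6)[OF cw c] by auto
    have "?J \<inter> \<phi> ` cw_disk d = \<phi> ` (cw_disk d - cw_open_disk d) \<inter> (\<Union>(d', \<phi>') \<in> D \<inter> J. \<phi>' ` cw_disk d')"
    proof (intro equalityI subsetI)
      fix x assume x: "x \<in> ?J \<inter> \<phi> ` cw_disk d"
      then obtain d1 \<phi>1 where 1: "(d1, \<phi>1) \<in> J" "x \<in> \<phi>1 ` cw_open_disk d1" by auto
      have "x \<notin> \<phi> ` cw_open_disk d"
        using cw_structureD(5)[OF cw c, of d1 \<phi>1 x] 1 J False by auto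
      then have xs: "x \<in> \<phi> ` (cw_disk d - cw_open_disk d)" using x by blast
      then obtain d2 \<phi>2 where 2: "(d2, \<phi>2) \<in> D" "x \<in> \<phi>2 ` cw_open_disk d2" using subsetD[OF D(3) xs] by auto
      have "(d1, \<phi>1) = (d2, \<phi>2)"
        by (rule cw_structureD(5)[OF cw _ _ 1(2) 2(2)]) (use 1(1) 2(1) J D(1) in blast)+
      then have "(d1, \<phi>1) \<in> D \<inter> J" "x \<in> \<phi>1 ` cw_disk d1" using 1 2 cw_open_disk_subset[of d1] by auto
      then show "x \<in> \<phi> ` (cw_disk d - cw_open_disk d) \<inter> (\<Union>(d', \<phi>') \<in> D \<inter> J. \<phi>' ` cw_disk d')" using xs by blast
    next
      fix x assume "x \<in> \<phi> ` (cw_disk d - cw_open_disk d) \<inter> (\<Union>(d', \<phi>') \<in> D \<inter> J. \<phi>' ` cw_disk d')"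
      then obtain d1 \<phi>1 where "(d1, \<phi>1) \<in> J" "x \<in> \<phi>1 ` cw_disk d1" "x \<in> \<phi> ` cw_disk d" by auto
      then show "x \<in> ?J \<inter> \<phi> ` cw_disk d" using subsetD[OF Jdisk] by (intro IntI)
    qed
    moreover have "closedin K (\<Union>(d', \<phi>') \<in> D \<inter> J. \<phi>' ` cw_disk d')"
      using D disk(1) by (intro closedin_Union) auto
    ultimately show ?thesis using disk(2)[OF c] by (simp add: closedin_Int)
  qed
qed

text \<open>The other cells of dimension at most \<open>d\<close> form a subcomplex, because
  boundaries lie in cells of smaller dimension; \<open>V\<close> is its complement. This is the
  separation of equidimensional cells behind the local constancy.\<close>

lemma cw_cell_relatively_open:
  assumes cw: "cw_structure K C" and c: "(d, \<phi>) \<in> C"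
  obtains V where "openin K V" "\<phi> ` cw_open_disk d \<subseteq> V"
    "\<And>\<phi>' x. (d, \<phi>') \<in> C \<Longrightarrow> x \<in> V \<Longrightarrow> x \<in> \<phi>' ` cw_open_disk d \<Longrightarrow> x \<in> \<phi> ` cw_open_disk d"
proof -
  define J where "J = {(d', \<phi>') \<in> C. d' \<le> d \<and> (d', \<phi>') \<noteq> (d, \<phi>)}"
  let ?J = "\<Union>(d', \<phi>') \<in> J. \<phi>' ` cw_open_disk d'"
  have cl: "closedin K ?J"
  proof (rule cw_subcomplex_closedin[OF cw])
    show "J \<subseteq> C" by (auto simp: J_def)
    fix d1 \<phi>1 assume 1: "(d1, \<phi>1) \<in> J"
    then have "(d1, \<phi>1) \<in> C" by (simp add: J_def)
    from cw_structureD(6)[OF cw this]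
    obtain D where D: "D \<subseteq> C" "\<forall>(d', \<phi>') \<in> D. d' < d1"
      "\<phi>1 ` (cw_disk d1 - cw_open_disk d1) \<subseteq> (\<Union>(d', \<phi>') \<in> D. \<phi>' ` cw_open_disk d')" by auto
    have "D \<subseteq> J" using D(1,2) 1 by (force simp: J_def)
    then show "\<phi>1 ` (cw_disk d1 - cw_open_disk d1) \<subseteq> ?J" using D(3) by blast
  qed
  show ?thesis
  proof (rule that[of "topspace K - ?J"])
    show "openin K (topspace K - ?J)" using cl by (simp add: closedin_def)
    show "\<phi> ` cw_open_disk d \<subseteq> topspace K - ?J"
    proof
      fix x assume x: "x \<in> \<phi> ` cw_open_disk d"
      have "x \<notin> ?J"
      proof
        assume "x \<in> ?J"
        then obtain d1 \<phi>1 where 1: "(d1, \<phi>1) \<in> J" "x \<in> \<phi>1 ` cw_open_disk d1" by auto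
        then have "(d, \<phi>) = (d1, \<phi>1)" using cw_structureD(5)[OF cw c _ x 1(2)] by (auto simp: J_def)
        then show False using 1(1) by (simp add: J_def)
      qed
      moreover have "x \<in> topspace K" using cw_structureD(4)[OF cw] c x by blast
      ultimately show "x \<in> topspace K - ?J" by blast
    qed
    fix \<phi>' x assume "(d, \<phi>') \<in> C" "x \<in> topspace K - ?J" "x \<in> \<phi>' ` cw_open_disk d"
    then show "x \<in> \<phi> ` cw_open_disk d" by (cases "\<phi>' = \<phi>") (auto simp: J_def)
  qed
qed

text \<open>After passing to the complex, \<open>f\<close> on \<open>P\<close> runs through a single
  open disk, which contracts to its centre; returning to \<open>Y\<close> changes \<open>f\<close>
  only by a homotopy. The constant map lifts, and homotopy lifting carries the lift over to
  \<open>f\<close>.\<close>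

lemma lift_over_cell:
  assumes cov: "covering_map U Y u" and cw: "cw_structure K C" and c: "(d, \<phi>) \<in> C"
    and a: "continuous_map Y K a" and b: "continuous_map K Y b" and hom: "homotopic_with (\<lambda>_. True) Y Y (b \<circ> a) id"
    and f: "continuous_map X Y f"
    and P: "P = {x \<in> topspace X. a (f x) \<in> \<phi> ` cw_open_disk d}"
  obtains g where "continuous_map (subtopology X P) U g" "\<And>x. x \<in> P \<Longrightarrow> u (g x) = f x"
proof -
  let ?X = "subtopology X P"
  let ?D = "subtopology (Euclidean_space d) (cw_open_disk d)"
  let ?I = "top_of_set {0..1::real}"
  have tX: "topspace ?X = P" using P by auto
  have tD: "topspace ?D = cw_open_disk d" by (auto simp: cw_open_disk_def)
  obtain s where s: "homeomorphic_maps ?D (subtopology K (\<phi> ` cw_open_disk d)) \<phi> s"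
    using cw_structureD(3)[OF cw c] homeomorphic_map_maps by blast
  have c\<phi>: "continuous_map ?D K \<phi>" and cs: "continuous_map (subtopology K (\<phi> ` cw_open_disk d)) ?D s"
    and \<phi>s: "\<And>y. y \<in> topspace (subtopology K (\<phi> ` cw_open_disk d)) \<Longrightarrow> \<phi> (s y) = y"
    using s by (auto simp: homeomorphic_maps_def continuous_map_in_subtopology)
  have af: "continuous_map ?X (subtopology K (\<phi> ` cw_open_disk d)) (\<lambda>x. a (f x))"
    using continuous_map_from_subtopology[OF continuous_map_compose[OF f a], of P] tX P
    by (auto simp: continuous_map_in_subtopology o_def)
  define r where "r x = s (a (f x))" for x
  have cr: "continuous_map ?X ?D r"
    using continuous_map_compose[OF af cs] by (simp add: o_def r_def[abs_def])
  have \<phi>r: "\<phi> (r x) = a (f x)" if "x \<in> P" for x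
  proof -
    have "x \<in> topspace ?X" using that tX by simp
    from \<phi>s[OF continuous_map_in_topspace[OF af this]] show ?thesis by (simp add: r_def)
  qed
  define H where "H = (\<lambda>(t, x) i. t * r x i)"
  have scale: "(\<lambda>i. t * y i) \<in> cw_open_disk d" if "y \<in> cw_open_disk d" "0 \<le> t" "t \<le> 1" for t y
  proof -
    have "(\<Sum>i<d. (t * y i)\<^sup>2) = t\<^sup>2 * (\<Sum>i<d. (y i)\<^sup>2)" by (simp add: power_mult_distrib sum_distrib_left)
    also have "\<dots> \<le> 1 * (\<Sum>i<d. (y i)\<^sup>2)"
      using that by (intro mult_right_mono) (auto simp: power_le_one sum_nonneg)
    finally show ?thesis using that(1) by (auto simp: cw_open_disk_def in_Euclidean_space)
  qed
  have rD: "r x \<in> cw_open_disk d" if "x \<in> P" for x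
  proof -
    have "x \<in> topspace ?X" using that tX by simp
    from continuous_map_in_topspace[OF cr this] show ?thesis by simp
  qed
  have cH: "continuous_map (prod_topology ?I ?X) ?D H"
  proof (rule continuous_map_into_subtopology)
    have cri: "continuous_map ?X euclideanreal (\<lambda>x. r x i)" for i
      using continuous_map_compose[OF continuous_map_into_fulltopology[OF cr] continuous_map_Euclidean_coord[of d i]]
      by (simp add: o_def)
    have "continuous_map (prod_topology ?I ?X) euclideanreal (\<lambda>z. fst z * r (snd z) i)" for i
    proof -
      have "continuous_map (prod_topology ?I ?X) euclideanreal fst"
        using continuous_map_fst continuous_map_into_fulltopology by blast
      moreover have "continuous_map (prod_topology ?I ?X) euclideanreal (\<lambda>z. r (snd z) i)"
        using continuous_map_compose[OF continuous_map_snd cri[of i]] by (simp add: o_def)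
      ultimately show ?thesis by (intro continuous_intros)
    qed
    then show "continuous_map (prod_topology ?I ?X) (Euclidean_space d) H"
      unfolding continuous_map_Euclidean_space H_def using rD tX
      by (auto simp: case_prod_unfold cw_open_disk_def in_Euclidean_space)
    show "H \<in> topspace (prod_topology ?I ?X) \<rightarrow> cw_open_disk d"
      using scale rD tX by (auto simp: H_def)
  qed
  have "homotopic_with (\<lambda>_. True) ?X K (\<lambda>x. \<phi> (\<lambda>i. 0)) (\<lambda>x. \<phi> (r x))"
    unfolding homotopic_with_def
    by (intro exI[of _ "\<phi> \<circ> H"] conjI continuous_map_compose[OF cH c\<phi>]) (auto simp: H_def)
  then have "homotopic_with (\<lambda>_. True) ?X K (\<lambda>x. \<phi> (\<lambda>i. 0)) (\<lambda>x. a (f x))"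
    by (rule homotopic_with_eq) (use \<phi>r tX in auto)
  then have "homotopic_with (\<lambda>_. True) ?X Y (b \<circ> (\<lambda>x. \<phi> (\<lambda>i. 0))) (b \<circ> (\<lambda>x. a (f x)))"
    by (rule homotopic_with_compose_continuous_map_left) (use b in auto)
  moreover have "homotopic_with (\<lambda>_. True) ?X Y ((b \<circ> a) \<circ> f) (id \<circ> f)"
    by (rule homotopic_with_compose_continuous_map_right[OF hom]) (use f continuous_map_from_subtopology in auto)
  ultimately have h: "homotopic_with (\<lambda>_. True) ?X Y (\<lambda>x. b (\<phi> (\<lambda>i. 0))) f"
    using homotopic_with_trans by (simp add: o_def) blast
  have "(\<lambda>i. 0) \<in> cw_open_disk d" by (auto simp: cw_open_disk_def in_Euclidean_space)
  then have "\<phi> (\<lambda>i. 0) \<in> topspace K" using cw_structureD(4)[OF cw] c by blast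
  then have "b (\<phi> (\<lambda>i. 0)) \<in> topspace Y" by (rule continuous_map_in_topspace[OF b])
  then have "b (\<phi> (\<lambda>i. 0)) \<in> u ` topspace U" using covering_mapD(2)[OF cov] by simp
  then obtain e where e: "e \<in> topspace U" "u e = b (\<phi> (\<lambda>i. 0))" by auto
  obtain g where "continuous_map ?X U g" "\<And>x. x \<in> topspace ?X \<Longrightarrow> u (g x) = f x"
    by (rule lift_exists_homotopic[OF cov h, of "\<lambda>_. e"]) (use e that in auto)
  then show ?thesis using that tX by blast
qed

section \<open>Coverings induced from spaces of small dimension\<close>

text \<open>If translation by \<open>z\<close> preserves \<open>l\<close>, the segment from
  \<open>x\<close> to its translate becomes a loop in the simply connected \<open>U\<close>. The
  loop is contractible there, so its image in \<open>Y\<close> lifts to a closed path in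
  \<open>F\<close>, and the induced covering inherits the period.\<close>

lemma period_of_universal_lift:
  assumes sc: "simply_connected_space U" and covU: "covering_map U Y u" and covF: "covering_map F Y q"
    and f: "continuous_map (torus n) Y f"
    and iso: "isomorphic_coverings (torus n) E p (pullback_space (torus n) f F q) fst"
    and l: "continuous_map (Euclidean_space n) U l" "\<And>x. x \<in> topspace (Euclidean_space n) \<Longrightarrow> u (l x) = f (torus_exp n x)"
    and z: "z \<in> int_lattice n" and per: "\<And>x. x \<in> topspace (Euclidean_space n) \<Longrightarrow> l (vec_shift x z) = l x"
  shows "z \<in> periods n E p"
proof (rule periodsI[OF z])
  let ?R = "Euclidean_space n"
  let ?G = "pullback_space (torus n) f F q"
  fix m x assume m: "torus_lift n E p m" and x: "x \<in> topspace ?R"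
  obtain h where h: "homeomorphic_map E ?G h" "\<And>e. e \<in> topspace E \<Longrightarrow> fst (h e) = p e"
    using iso by (auto simp: isomorphic_coverings_def)
  have ch: "continuous_map E ?G h" and inj: "inj_on h (topspace E)"
    using h(1) by (auto simp: homeomorphic_eq_everything_map)
  \<comment> \<open>The component of the lift \<open>m\<close> in \<open>F\<close>; it lifts
    \<open>f \<circ> torus_exp n\<close> through \<open>q\<close>.\<close>
  define \<mu> where "\<mu> x = snd (h (m x))" for x
  have hm: "continuous_map ?R ?G (h \<circ> m)"
    using m ch by (auto simp: torus_lift_def intro: continuous_map_compose)
  have c\<mu>: "continuous_map ?R F \<mu>" and q\<mu>: "\<And>y. y \<in> topspace ?R \<Longrightarrow> q (\<mu> y) = f (torus_exp n y)"
    using hm torus_liftD[OF m] h(2) by (auto simp: continuous_map_pullback_iff o_def \<mu>_def[abs_def])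
  define s where "s t = (\<lambda>i. x i + t * of_int (z i))" for t :: real
  have s: "pathin ?R s"
    unfolding pathin_def continuous_map_Euclidean_space s_def
    using x z by (auto simp: in_Euclidean_space int_lattice_def intro!: continuous_intros)
  have s01: "s 0 = x" "s 1 = vec_shift x z" by (simp_all add: s_def vec_shift_def)
  have sR: "s t \<in> topspace ?R" for t using x z by (simp add: in_Euclidean_space int_lattice_def s_def)
  have lx: "l x \<in> topspace U" by (rule continuous_map_in_topspace[OF l(1) x])
  let ?P = "\<lambda>r. r 0 = l x \<and> r 1 = l x"
  have ls: "l \<circ> s \<in> loops U (l x)"
    using pathin_compose[OF s l(1)] s01 per[OF x] by (simp add: loops_def)
  have "loop_class U (l x) (l \<circ> s) \<in> carrier (fundamental_group U (l x))"
    using ls by (simp add: fundamental_group_def)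
  then have "loop_class U (l x) (l \<circ> s) = loop_class U (l x) (\<lambda>_. l x)"
    using sc lx by (simp add: simply_connected_space_def fundamental_group_def)
  moreover have "l \<circ> s \<in> loop_class U (l x) (l \<circ> s)"
    using ls by (simp add: loop_class_def loops_def pathin_def)
  ultimately have "homotopic_with ?P (top_of_set {0..1}) U (\<lambda>_. l x) (l \<circ> s)"
    by (simp add: loop_class_def)
  then have "homotopic_with (\<lambda>r. r 0 = u (l x) \<and> r 1 = u (l x)) (top_of_set {0..1}) Y (u \<circ> (\<lambda>_. l x)) (u \<circ> (l \<circ> s))"
    by (rule homotopic_with_compose_continuous_map_left) (use covering_mapD(1)[OF covU] in auto)
  then have "homotopic_with (\<lambda>r. r 0 = u (l x) \<and> r 1 = u (l x)) (top_of_set {0..1}) Y (q \<circ> (\<lambda>_. \<mu> x)) (q \<circ> (\<mu> \<circ> s))"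
    by (rule homotopic_with_eq) (use l(2) q\<mu> sR x in auto)
  from path_lifts_homotopic[OF covF _ _ this] have "\<mu> x = \<mu> (vec_shift x z)"
    using pathin_compose[OF s c\<mu>] continuous_map_in_topspace[OF c\<mu> x] s01 by simp
  moreover have "fst (h (m (vec_shift x z))) = fst (h (m x))"
    using h(2) torus_liftD[OF m x] torus_liftD[OF m vec_shift_in[OF x z]] by (simp add: torus_exp_shift)
  ultimately have "h (m (vec_shift x z)) = h (m x)" by (simp add: \<mu>_def prod_eq_iff)
  then show "m (vec_shift x z) = m x"
    using inj torus_liftD(2)[OF m x] torus_liftD(2)[OF m vec_shift_in[OF x z]] by (auto simp: inj_on_def)
qed

lemma lattice_aut_sum:
  fixes m :: nat
  assumes U: "lattice_aut n U" and b: "\<And>j. j < m \<Longrightarrow> b j \<in> int_lattice n"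
  shows "U (\<lambda>t. \<Sum>j<m. w j * b j t) i = (\<Sum>j<m. w j * U (b j) i)"
  using b
proof (induction m)
  case 0
  then show ?case using lattice_aut_comb[OF U int_lattice_zero int_lattice_zero, of "-1" i] by simp
next
  case (Suc m)
  have "(\<lambda>t. \<Sum>j<m. w j * b j t) \<in> int_lattice n"
    using Suc.prems by (auto simp: int_lattice_def intro!: sum.neutral)
  from lattice_aut_comb[OF U this Suc.prems[of m], of "w m" i] Suc show ?case by simp
qed

theorem direct_sum_of_inducible:
  assumes cov: "covering_map E (torus n) p" and x0: "x0 \<in> topspace (torus n)"
    and ind: "inducible_from_dim_at_most TYPE('y) TYPE('c) TYPE('f) k E (torus n) p"
  shows "direct_sum_of_cyclic_groups k (monodromy_group E (torus n) x0 p)"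
proof -
  let ?R = "Euclidean_space n"
  let ?Z = "int_lattice n"
  let ?L = "periods n E p"
  obtain x where x: "x \<in> topspace ?R" "torus_exp n x = x0" using torus_exp_surj[OF x0] .
  obtain A d where A: "lattice_aut n A" and AL: "\<And>a. a \<in> ?Z \<Longrightarrow> a \<in> ?L \<longleftrightarrow> (\<forall>i<n. int (d i) dvd A a i)"
    and chain: "\<And>i. Suc i < n \<Longrightarrow> d i dvd (d (Suc i) :: nat)"
    using sublattice_smith_normal_form[of ?L n, OF _ periods_zero periods_comb] periods_in by blast
  show ?thesis
  \<comment> \<open>If all invariant factors but the last \<open>k\<close> are trivial, those
    \<open>k\<close> give the sum. Otherwise a nontrivial \<open>d i0\<close> divides the
    \<open>k + 1\<close> invariant factors with indices from \<open>i0\<close> to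
    \<open>i0 + k\<close>.\<close>
  proof (cases "\<forall>i. i + k < n \<longrightarrow> d i = 1")
    case True
    show ?thesis
      unfolding x(2)[symmetric]
      by (rule direct_sum_of_invariant_factors[OF carrier_monodromy_group_torus[OF cov x(1)]
            mult_monodromy_group_torus[OF cov x(1)] deck_eq_iff[OF cov x(1)] A AL]) (use True in auto)
  next
    case False
    then obtain i0 where i0: "i0 + k < n" "d i0 \<noteq> 1" by blast
    obtain Y :: "'y topology" where Y: "space_of_dim_at_most TYPE('c) k Y" "inducible_from TYPE('f) E (torus n) p Y"
      using ind unfolding inducible_from_dim_at_most_def by blast
    obtain U :: "(real \<Rightarrow> 'y) set topology" and u where U: "simply_connected_space U" "covering_map U Y u"
      using Y(1) unfolding space_of_dim_at_most_def admits_universal_covering_def by blast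
    obtain K :: "'c topology" and C where cw: "cw_structure K C" "\<forall>(d, \<phi>) \<in> C. d \<le> k" "Y homotopy_equivalent_space K"
      using Y(1) unfolding space_of_dim_at_most_def by blast
    obtain a b where ab: "continuous_map Y K a" "continuous_map K Y b" "homotopic_with (\<lambda>_. True) Y Y (b \<circ> a) id"
      using cw(3) unfolding homotopy_equivalent_space_def by blast
    obtain F :: "'f topology" and u0 y0 q f where F: "pointed_covering F u0 Y y0 q" "continuous_map (torus n) Y f"
      "isomorphic_coverings (torus n) E p (pullback_space (torus n) f F q) fst"
      using Y(2) unfolding inducible_from_def by blast
    have covF: "covering_map F Y q" using F(1) by (simp add: pointed_covering_def)
    define LF where "LF l \<longleftrightarrow> continuous_map ?R U l \<and> (\<forall>x\<in>topspace ?R. u (l x) = f (torus_exp n x))" for l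
    have fe: "continuous_map ?R Y (\<lambda>x. f (torus_exp n x))"
      using continuous_map_compose[OF continuous_map_torus_exp F(2)] by (simp add: o_def)
    have LF_unique: "l y = l' y" if "LF l" "LF l'" "x \<in> topspace ?R" "l x = l' x" "y \<in> topspace ?R" for l l' x y
      by (rule lifts_unique[where E = U and X = Y and p = u and S = ?R and g = l and h = l' and a = x])
         (use that U(2) in \<open>auto simp: LF_def connected_Euclidean_space\<close>)
    have LF_shift: "LF (\<lambda>x. l (vec_shift x z))" if l: "LF l" and z: "z \<in> ?Z" for l z
      using continuous_map_compose[OF continuous_map_vec_shift[OF z], of U l] l vec_shift_in[OF _ z]
      by (auto simp: LF_def o_def torus_exp_shift)
    have neg: "(\<lambda>i. - z i) \<in> ?Z" and add: "(\<lambda>i. z i + w i) \<in> ?Z" if "z \<in> ?Z" "w \<in> ?Z" for z w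
      using that by (auto simp: int_lattice_def)
    \<comment> \<open>Two translations with the same effect on a lift differ by a period of the
      covering; the simple connectivity of \<open>U\<close> enters here.\<close>
    have key: "(\<lambda>i. z i - w i) \<in> ?L"
      if l: "LF l" and zw: "z \<in> ?Z" "w \<in> ?Z" and eq: "\<And>y. y \<in> topspace ?R \<Longrightarrow> l (vec_shift y z) = l (vec_shift y w)" for l z w
    proof (rule period_of_universal_lift[OF U covF F(2,3)])
      show "continuous_map ?R U l" using l by (simp add: LF_def)
      show "u (l x) = f (torus_exp n x)" if "x \<in> topspace ?R" for x using l that by (simp add: LF_def)
      show "(\<lambda>i. z i - w i) \<in> ?Z" using zw by (auto simp: int_lattice_def)
      show "l (vec_shift x (\<lambda>i. z i - w i)) = l x" if "x \<in> topspace ?R" for x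
        using eq[OF vec_shift_in[OF that neg[OF zw(2) zw(2)]]] by (simp add: vec_shift_add vec_shift_zero)
    qed
    (* cc l is the position of the lift l in its orbit under translations, relative to a representative of
       the orbit; it is determined up to a period. *)
    define orb where "orb l r \<longleftrightarrow> LF r \<and> (\<exists>z\<in>?Z. \<forall>y\<in>topspace ?R. l y = r (vec_shift y z))" for l r
    define rep where "rep l = (SOME r. orb l r)" for l
    define cc where "cc l = (SOME z. z \<in> ?Z \<and> (\<forall>y\<in>topspace ?R. l y = rep l (vec_shift y z)))" for l
    have rep: "LF (rep l) \<and> cc l \<in> ?Z \<and> (\<forall>y\<in>topspace ?R. l y = rep l (vec_shift y (cc l)))" if l: "LF l" for l
    proof -
      have "orb l l" using l int_lattice_zero unfolding orb_def by (auto intro!: bexI[of _ "\<lambda>_. 0"] simp: vec_shift_zero)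
      then have o: "orb l (rep l)" unfolding rep_def by (rule someI[of "orb l"])
      then obtain z where "z \<in> ?Z \<and> (\<forall>y\<in>topspace ?R. l y = rep l (vec_shift y z))" unfolding orb_def by blast
      then have "cc l \<in> ?Z \<and> (\<forall>y\<in>topspace ?R. l y = rep l (vec_shift y (cc l)))" unfolding cc_def
        by (rule someI[of "\<lambda>z. z \<in> ?Z \<and> (\<forall>y\<in>topspace ?R. l y = rep l (vec_shift y z))"])
      then show ?thesis using o unfolding orb_def by blast
    qed
    have cc_shift: "(\<lambda>i. cc l' i - (v i + cc l i)) \<in> ?L"
      if l: "LF l" "LF l'" and v: "v \<in> ?Z" and eq: "\<And>y. y \<in> topspace ?R \<Longrightarrow> l' y = l (vec_shift y v)" for l l' v
    proof -
      \<comment> \<open>Translates of one lift have the same orbit predicate, so \<open>SOME\<close>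
        assigns them literally the same representative.\<close>
      have "orb l' r \<longleftrightarrow> orb l r" for r
      proof
        assume "orb l r"
        then obtain z where z: "LF r" "z \<in> ?Z" "\<And>y. y \<in> topspace ?R \<Longrightarrow> l y = r (vec_shift y z)" unfolding orb_def by blast
        have "l' y = r (vec_shift y (\<lambda>i. v i + z i))" if "y \<in> topspace ?R" for y
          using eq[OF that] z(3)[OF vec_shift_in[OF that v]] by (simp add: vec_shift_add)
        then show "orb l' r" unfolding orb_def using z(1) add[OF v z(2)] by blast
      next
        assume "orb l' r"
        then obtain z where z: "LF r" "z \<in> ?Z" "\<And>y. y \<in> topspace ?R \<Longrightarrow> l' y = r (vec_shift y z)" unfolding orb_def by blast
        have "l y = r (vec_shift y (\<lambda>i. - v i + z i))" if y: "y \<in> topspace ?R" for y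
          using eq[OF vec_shift_in[OF y neg[OF v v]]] z(3)[OF vec_shift_in[OF y neg[OF v v]]]
          by (simp add: vec_shift_add vec_shift_zero)
        then show "orb l r" unfolding orb_def using z(1) add[OF neg[OF v v] z(2)] by blast
      qed
      then have "orb l' = orb l" by (simp add: fun_eq_iff)
      then have rr: "rep l' = rep l" unfolding rep_def by simp
      show ?thesis
      proof (rule key)
        show "LF (rep l)" "cc l' \<in> ?Z" "(\<lambda>i. v i + cc l i) \<in> ?Z" using rep[OF l(1)] rep[OF l(2)] add[OF v] by auto
        show "rep l (vec_shift y (cc l')) = rep l (vec_shift y (\<lambda>i. v i + cc l i))" if "y \<in> topspace ?R" for y
        proof -
          have "rep l (vec_shift y (cc l')) = l' y" using rep[OF l(2)] rr that by simp
          also have "\<dots> = l (vec_shift y v)" by (rule eq[OF that])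
          also have "\<dots> = rep l (vec_shift (vec_shift y v) (cc l))" using rep[OF l(1)] vec_shift_in[OF that v] by blast
          finally show ?thesis by (simp add: vec_shift_add)
        qed
      qed
    qed
    define P where "P i \<phi> = {w \<in> topspace (torus n). a (f w) \<in> \<phi> ` cw_open_disk i}" for i \<phi>
    have "\<exists>g. continuous_map (subtopology (torus n) (P i \<phi>)) U g \<and> (\<forall>w\<in>P i \<phi>. u (g w) = f w)" if "(i, \<phi>) \<in> C" for i \<phi>
      by (rule lift_over_cell[OF U(2) cw(1) that ab F(2) P_def]) blast
    then obtain g where g: "\<And>i \<phi>. (i, \<phi>) \<in> C \<Longrightarrow> continuous_map (subtopology (torus n) (P i \<phi>)) U (g i \<phi>)"
      "\<And>i \<phi> w. (i, \<phi>) \<in> C \<Longrightarrow> w \<in> P i \<phi> \<Longrightarrow> u (g i \<phi> w) = f w" by metis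
    \<comment> \<open>Open cells are disjoint, so the point determines the cell and the lifts over
      all \<open>i\<close>-cells combine to one function.\<close>
    define GV where "GV i w = g i (SOME \<phi>. (i, \<phi>) \<in> C \<and> w \<in> P i \<phi>) w" for i w
    have GV: "GV i w = g i \<phi> w" if "(i, \<phi>) \<in> C" "w \<in> P i \<phi>" for i \<phi> w
    proof -
      define s where "s = (SOME \<phi>. (i, \<phi>) \<in> C \<and> w \<in> P i \<phi>)"
      have s: "(i, s) \<in> C \<and> w \<in> P i s" unfolding s_def by (rule someI[of _ \<phi>]) (use that in simp)
      then have "(i, s) = (i, \<phi>)" using cw_structureD(5)[OF cw(1), of i s i \<phi> "a (f w)"] that by (simp add: P_def)
      then show ?thesis by (simp add: GV_def s_def)
    qed
    define B where "B i = {x \<in> topspace ?R. \<exists>\<phi>. (i, \<phi>) \<in> C \<and> torus_exp n x \<in> P i \<phi>}" for i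
    \<comment> \<open>The lift on all of Euclidean space that agrees at \<open>x\<close> with the
      lift over the cell. The dependence of this global lift on \<open>x\<close> is what the integer
      functions record.\<close>
    define lam where "lam i x = (SOME l. LF l \<and> l x = GV i (torus_exp n x))" for i x
    have lam: "LF (lam i x) \<and> lam i x x = GV i (torus_exp n x)" if x: "x \<in> B i" for i x
    proof -
      obtain \<phi> where \<phi>: "(i, \<phi>) \<in> C" "torus_exp n x \<in> P i \<phi>" using x by (auto simp: B_def)
      have xR: "x \<in> topspace ?R" using x by (simp add: B_def)
      have "torus_exp n x \<in> topspace (subtopology (torus n) (P i \<phi>))" using \<phi>(2) torus_exp_in by simp
      then have "GV i (torus_exp n x) \<in> topspace U"
        using continuous_map_in_topspace[OF g(1)[OF \<phi>(1)]] GV[OF \<phi>] by simp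
      moreover have "u (GV i (torus_exp n x)) = f (torus_exp n x)" using GV[OF \<phi>] g(2)[OF \<phi>] by simp
      ultimately obtain l where "continuous_map ?R U l" "\<And>y. y \<in> topspace ?R \<Longrightarrow> u (l y) = f (torus_exp n y)" "l x = GV i (torus_exp n x)"
        by (rule lift_from_Euclidean_space[OF U(2) fe xR]) (rule that)
      then have "LF l \<and> l x = GV i (torus_exp n x)" by (simp add: LF_def)
      then show ?thesis unfolding lam_def by (rule someI[of "\<lambda>l. LF l \<and> l x = GV i (torus_exp n x)"])
    qed
    \<comment> \<open>For \<open>j \<le> k\<close> these are coordinates whose invariant factors are
      multiples of \<open>d i0\<close>, so periods vanish in them modulo
      \<open>d i0\<close>.\<close>
    define \<kappa> where "\<kappa> j z = A z (i0 + j)" for j z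
    have \<kappa>_diff: "\<kappa> j (\<lambda>i. z i - w i) = \<kappa> j z - \<kappa> j w" if "z \<in> ?Z" "w \<in> ?Z" for j z w
      using lattice_aut_comb[OF A that, of "-1"] by (simp add: \<kappa>_def)
    have \<kappa>_add: "\<kappa> j (\<lambda>i. z i + w i) = \<kappa> j z + \<kappa> j w" if "z \<in> ?Z" "w \<in> ?Z" for j z w
      using lattice_aut_comb[OF A that, of 1] by (simp add: \<kappa>_def)
    have dchain: "d i0 dvd d (i0 + j)" if "i0 + j < n" for j
      using that
    proof (induction j)
      case (Suc j)
      then show ?case using chain[of "i0 + j"] dvd_trans by auto
    qed simp
    have \<kappa>_L: "int (d i0) dvd \<kappa> j z" if "j < Suc k" "z \<in> ?L" for j z
    proof -
      have "i0 + j < n" using that i0 by simp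
      then have "int (d i0) dvd int (d (i0 + j))" "int (d (i0 + j)) dvd A z (i0 + j)"
        using dchain AL[OF periods_in[OF that(2)]] that(2) by auto
      then show ?thesis unfolding \<kappa>_def by (rule dvd_trans)
    qed
    have "\<exists>b. b \<in> ?Z \<and> A b = (\<lambda>t. if t = i0 + j then 1 else 0)" if "j < Suc k" for j
    proof -
      have "(\<lambda>t. if t = i0 + j then 1 else 0) \<in> ?Z" using that i0 by (auto simp: int_lattice_def)
      then have "(\<lambda>t. if t = i0 + j then 1 else 0) \<in> A ` ?Z" using A by (simp add: lattice_aut_def bij_betw_def)
      then show ?thesis by auto
    qed
    then obtain e where e: "\<And>j. j < Suc k \<Longrightarrow> e j \<in> ?Z" "\<And>j. j < Suc k \<Longrightarrow> A (e j) = (\<lambda>t. if t = i0 + j then 1 else 0)" by metis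
    have "int (d i0) dvd 1"
    \<comment> \<open>Moving \<open>x\<close> by \<open>z\<close> replaces the lift chosen at
      \<open>x\<close> by its translate by \<open>- z\<close>, so \<open>cc\<close> drops by
      \<open>z\<close> modulo periods; hence the sign in \<open>\<phi>\<close>.\<close>
    proof (rule lattice_cover_bound[where B = B and n = n and m = "Suc k" and \<phi> = "\<lambda>i x. - \<kappa> i (cc (lam i x))" and \<kappa> = \<kappa> and b = e])
      show "B i \<subseteq> topspace ?R" for i by (auto simp: B_def)
      show "\<exists>i<Suc k. x \<in> B i" if x: "x \<in> topspace ?R" for x
      proof -
        have "a (f (torus_exp n x)) \<in> topspace K"
          by (intro continuous_map_in_topspace[OF ab(1)] continuous_map_in_topspace[OF F(2)] torus_exp_in)
        then obtain i \<phi> where c: "(i, \<phi>) \<in> C" "a (f (torus_exp n x)) \<in> \<phi> ` cw_open_disk i"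
          using cw_structureD(4)[OF cw(1)] by blast
        then have "i < Suc k" using cw(2) by auto
        moreover have "x \<in> B i" using c x torus_exp_in by (auto simp: B_def P_def)
        ultimately show ?thesis by blast
      qed
      show "e j \<in> ?Z" if "j < Suc k" for j by (rule e(1)[OF that])
      show "\<kappa> i (\<lambda>t. \<Sum>j<Suc k. w j * e j t) = w i" if "i < Suc k" for i w
      proof -
        have "\<kappa> i (\<lambda>t. \<Sum>j<Suc k. w j * e j t) = (\<Sum>j<Suc k. w j * A (e j) (i0 + i))"
          unfolding \<kappa>_def by (rule lattice_aut_sum[OF A e(1)])
        also have "\<dots> = (\<Sum>j<Suc k. if j = i then w j else 0)" by (intro sum.cong refl) (simp add: e(2))
        finally show ?thesis using that by simp
      qed
      show "vec_shift x z \<in> B i \<and> int (d i0) dvd - \<kappa> i (cc (lam i (vec_shift x z))) - - \<kappa> i (cc (lam i x)) - \<kappa> i z"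
        if i: "i < Suc k" and x: "x \<in> B i" and z: "z \<in> ?Z" for i x z
      proof
        have xR: "x \<in> topspace ?R" using x by (simp add: B_def)
        show xB: "vec_shift x z \<in> B i" using x vec_shift_in[OF xR z] by (simp add: B_def torus_exp_shift)
        have l: "LF (lam i x)" "LF (lam i (vec_shift x z))" using lam[OF x] lam[OF xB] by auto
        let ?mz = "\<lambda>i. - z i"
        have mz: "?mz \<in> ?Z" by (rule neg[OF z z])
        have "lam i (vec_shift x z) (vec_shift x z) = lam i x (vec_shift (vec_shift x z) ?mz)"
          using lam[OF x] lam[OF xB] by (simp add: torus_exp_shift vec_shift_add vec_shift_zero)
        from LF_unique[OF l(2) LF_shift[OF l(1) mz] vec_shift_in[OF xR z] this]
        have "(\<lambda>i'. cc (lam i (vec_shift x z)) i' - (- z i' + cc (lam i x) i')) \<in> ?L"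
          by (intro cc_shift[OF l mz]) auto
        from \<kappa>_L[OF i this] have "int (d i0) dvd \<kappa> i (cc (lam i (vec_shift x z))) - \<kappa> i (\<lambda>i'. - z i' + cc (lam i x) i')"
          using \<kappa>_diff[OF _ add[OF mz]] rep[OF l(1)] rep[OF l(2)] by simp
        moreover have "\<kappa> i (\<lambda>i'. - z i' + cc (lam i x) i') = \<kappa> i ?mz + \<kappa> i (cc (lam i x))"
          using \<kappa>_add[OF mz] rep[OF l(1)] by simp
        moreover have "\<kappa> i ?mz = - \<kappa> i z"
          using \<kappa>_diff[OF int_lattice_zero z, of i] \<kappa>_diff[OF int_lattice_zero int_lattice_zero, of i] by simp
        ultimately have "int (d i0) dvd - (\<kappa> i (cc (lam i (vec_shift x z))) - (- \<kappa> i z + \<kappa> i (cc (lam i x))))"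
          by (simp only: dvd_minus_iff)
        then show "int (d i0) dvd - \<kappa> i (cc (lam i (vec_shift x z))) - - \<kappa> i (cc (lam i x)) - \<kappa> i z"
          by (simp add: algebra_simps)
      qed
      show "\<exists>r>0. \<forall>y\<in>B i. (\<forall>t<n. \<bar>y t - x t\<bar> < r) \<longrightarrow> int (d i0) dvd - \<kappa> i (cc (lam i y)) - - \<kappa> i (cc (lam i x))"
        if i: "i < Suc k" and x: "x \<in> B i" for i x
      proof -
        have xR: "x \<in> topspace ?R" using x by (simp add: B_def)
        obtain \<phi> where \<phi>: "(i, \<phi>) \<in> C" "torus_exp n x \<in> P i \<phi>" using x by (auto simp: B_def)
        obtain V where V: "openin K V" "\<phi> ` cw_open_disk i \<subseteq> V"
          "\<And>\<phi>' y. (i, \<phi>') \<in> C \<Longrightarrow> y \<in> V \<Longrightarrow> y \<in> \<phi>' ` cw_open_disk i \<Longrightarrow> y \<in> \<phi> ` cw_open_disk i"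
          by (rule cw_cell_relatively_open[OF cw(1) \<phi>(1)]) (rule that)
        \<comment> \<open>On \<open>T1\<close> no other \<open>i\<close>-cell interferes, and on
          \<open>T2\<close> the lift chosen at \<open>x\<close> still agrees with the lift over the
          cell. Points of \<open>B i\<close> in both therefore yield the same lift as
          \<open>x\<close>.\<close>
        define T1 where "T1 = {y \<in> topspace ?R. a (f (torus_exp n y)) \<in> V}"
        have oT1: "openin ?R T1"
          unfolding T1_def using continuous_map_compose[OF fe ab(1)] V(1)
          by (intro openin_continuous_map_preimage) (auto simp: o_def)
        define Q where "Q = {y \<in> topspace ?R. torus_exp n y \<in> P i \<phi>}"
        have tQ: "topspace (subtopology ?R Q) = Q" by (auto simp: Q_def)
        have ce: "continuous_map (subtopology ?R Q) (subtopology (torus n) (P i \<phi>)) (torus_exp n)"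
          using tQ by (auto simp: continuous_map_in_subtopology Q_def intro: continuous_map_from_subtopology continuous_map_torus_exp)
        have "openin (subtopology ?R Q) {y \<in> topspace (subtopology ?R Q). lam i x y = g i \<phi> (torus_exp n y)}"
        proof (rule lifts_agree_openin[OF U(2)])
          show "continuous_map (subtopology ?R Q) U (lam i x)"
            using lam[OF x] by (auto simp: LF_def intro: continuous_map_from_subtopology)
          show "continuous_map (subtopology ?R Q) U (\<lambda>y. g i \<phi> (torus_exp n y))"
            using continuous_map_compose[OF ce g(1)[OF \<phi>(1)]] by (simp add: o_def)
          show "u (lam i x s) = u (g i \<phi> (torus_exp n s))" if "s \<in> topspace (subtopology ?R Q)" for s
            using that lam[OF x] g(2)[OF \<phi>(1)] tQ by (auto simp: LF_def Q_def)
        qed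
        then obtain T2 where T2: "openin ?R T2" "{y \<in> topspace (subtopology ?R Q). lam i x y = g i \<phi> (torus_exp n y)} = T2 \<inter> Q"
          unfolding openin_subtopology by blast
        have xQ: "x \<in> Q" using xR \<phi>(2) by (simp add: Q_def)
        have "lam i x x = g i \<phi> (torus_exp n x)" using lam[OF x] GV[OF \<phi>] by simp
        then have "x \<in> T2 \<inter> Q" unfolding T2(2)[symmetric] using xQ tQ by simp
        moreover have "x \<in> T1" using \<phi>(2) V(2) xR by (auto simp: T1_def P_def)
        ultimately have "x \<in> T1 \<inter> T2" by blast
        obtain r where r: "r > 0" "\<And>y. y \<in> topspace ?R \<Longrightarrow> \<forall>t<n. \<bar>y t - x t\<bar> < r \<Longrightarrow> y \<in> T1 \<inter> T2"
          by (rule openin_Euclidean_space_box[OF openin_Int[OF oT1 T2(1)] \<open>x \<in> T1 \<inter> T2\<close>]) (rule that)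
        have "int (d i0) dvd - \<kappa> i (cc (lam i y)) - - \<kappa> i (cc (lam i x))"
          if y: "y \<in> B i" "\<forall>t<n. \<bar>y t - x t\<bar> < r" for y
        proof -
          have yR: "y \<in> topspace ?R" using y(1) by (simp add: B_def)
          have yT: "y \<in> T1" "y \<in> T2" using r(2)[OF yR y(2)] by auto
          obtain \<phi>' where \<phi>': "(i, \<phi>') \<in> C" "torus_exp n y \<in> P i \<phi>'" using y(1) by (auto simp: B_def)
          have yP: "torus_exp n y \<in> P i \<phi>"
            using V(3)[OF \<phi>'(1), of "a (f (torus_exp n y))"] yT(1) \<phi>'(2) by (simp add: P_def T1_def)
          then have "y \<in> T2 \<inter> Q" using yT yR by (simp add: Q_def)
          then have "lam i x y = g i \<phi> (torus_exp n y)" unfolding T2(2)[symmetric] by simp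
          then have "lam i y y = lam i x y" using lam[OF y(1)] GV[OF \<phi>(1) yP] by simp
          have l: "LF (lam i x)" "LF (lam i y)" using lam[OF x] lam[OF y(1)] by auto
          have "(\<lambda>i'. cc (lam i y) i' - ((\<lambda>_. 0) i' + cc (lam i x) i')) \<in> ?L"
            by (rule cc_shift[OF l int_lattice_zero])
               (use LF_unique[OF l(2,1) yR \<open>lam i y y = lam i x y\<close>] in \<open>simp add: vec_shift_zero\<close>)
          then have "int (d i0) dvd \<kappa> i (\<lambda>i'. cc (lam i y) i' - cc (lam i x) i')" using \<kappa>_L[OF i] by simp
          then have "int (d i0) dvd \<kappa> i (cc (lam i y)) - \<kappa> i (cc (lam i x))"
            using \<kappa>_diff rep[OF l(1)] rep[OF l(2)] by simp
          then have "int (d i0) dvd - (\<kappa> i (cc (lam i y)) - \<kappa> i (cc (lam i x)))" by (simp only: dvd_minus_iff)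
          then show ?thesis by simp
        qed
        then show ?thesis using r(1) by blast
      qed
    qed
    then show ?thesis using i0(2) by simp
  qed
qed

section \<open>The torus as a CW-complex with a universal covering\<close>

lemma covering_map_precompose_homeomorphism:
  assumes cov: "covering_map E X p" and hom: "homeomorphic_maps E' E r j"
  shows "covering_map E' X (p \<circ> r)"
proof -
  have cr: "continuous_map E' E r" and cj: "continuous_map E E' j"
    and jr: "\<And>x. x \<in> topspace E' \<Longrightarrow> j (r x) = x" and rj: "\<And>y. y \<in> topspace E \<Longrightarrow> r (j y) = y"
    using hom by (auto simp: homeomorphic_maps_def)
  have hr: "homeomorphic_map E' E r" using hom homeomorphic_map_maps by blast
  have rim: "r ` topspace E' = topspace E" using hr homeomorphic_imp_surjective_map by blast
  show ?thesis
    unfolding covering_map_def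
  proof (intro conjI ballI)
    show "continuous_map E' X (p \<circ> r)" by (rule continuous_map_compose[OF cr covering_mapD(1)[OF cov]])
    show "(p \<circ> r) ` topspace E' = topspace X"
      unfolding image_comp[symmetric] rim by (rule covering_mapD(2)[OF cov])
    fix x assume "x \<in> topspace X"
    then obtain U \<V> where U: "openin X U" "x \<in> U" "\<Union>\<V> = {e \<in> topspace E. p e \<in> U}" "pairwise disjnt \<V>"
      and oV: "\<And>V. V \<in> \<V> \<Longrightarrow> openin E V" and hV: "\<And>V. V \<in> \<V> \<Longrightarrow> homeomorphic_map (subtopology E V) (subtopology X U) p"
      and "\<And>V. V \<in> \<V> \<Longrightarrow> inj_on p V"
      by (rule covering_evenly[OF cov]) (rule that)
    define W where "W V = {e \<in> topspace E'. r e \<in> V}" for V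
    have oW: "openin E' (W V)" if "V \<in> \<V>" for V
      unfolding W_def by (rule openin_continuous_map_preimage[OF cr oV[OF that]])
    have hW: "homeomorphic_map (subtopology E' (W V)) (subtopology X U) (p \<circ> r)" if V: "V \<in> \<V>" for V
    proof (rule homeomorphic_map_compose[OF _ hV[OF V]])
      have "V \<subseteq> topspace E" by (rule openin_subset[OF oV[OF V]])
      then have "r ` W V = V" using rim by (auto simp: W_def image_iff)
      then have "r ` (topspace E' \<inter> W V) = topspace E \<inter> V"
        using \<open>V \<subseteq> topspace E\<close> by (simp add: W_def Int_absorb1 Collect_conj_eq)
      then show "homeomorphic_map (subtopology E' (W V)) (subtopology E V) r"
        by (rule homeomorphic_map_subtopologies[OF hr])
    qed
    have un: "\<Union> (W ` \<V>) = {e \<in> topspace E'. (p \<circ> r) e \<in> U}"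
    proof (intro equalityI subsetI)
      fix e assume "e \<in> \<Union> (W ` \<V>)"
      then have "e \<in> topspace E'" "r e \<in> \<Union>\<V>" by (auto simp: W_def)
      then show "e \<in> {e \<in> topspace E'. (p \<circ> r) e \<in> U}" unfolding U(3) by simp
    next
      fix e assume "e \<in> {e \<in> topspace E'. (p \<circ> r) e \<in> U}"
      then have "e \<in> topspace E'" "r e \<in> \<Union>\<V>" unfolding U(3) using continuous_map_in_topspace[OF cr] by auto
      then show "e \<in> \<Union> (W ` \<V>)" by (auto simp: W_def)
    qed
    have "pairwise disjnt (W ` \<V>)" using U(4) by (auto simp: pairwise_def W_def disjnt_def)
    then show "\<exists>U. openin X U \<and> x \<in> U \<and> (\<exists>\<V>. \<Union> \<V> = {e \<in> topspace E'. (p \<circ> r) e \<in> U} \<and> pairwise disjnt \<V> \<and>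
        (\<forall>V\<in>\<V>. openin E' V \<and> homeomorphic_map (subtopology E' V) (subtopology X U) (p \<circ> r)))"
      using U(1,2) oW un hW by (intro exI[of _ U] exI[of _ "W ` \<V>"] conjI) auto
  qed
qed

text \<open>Loops are contracted by straight-line homotopies transported through the
  homeomorphism.\<close>

lemma simply_connected_homeomorphic_Euclidean_space:
  assumes hom: "homeomorphic_maps U (Euclidean_space n) r j"
  shows "simply_connected_space U"
  unfolding simply_connected_space_def
proof (intro conjI ballI)
  have cr: "continuous_map U (Euclidean_space n) r" and cj: "continuous_map (Euclidean_space n) U j"
    and jr: "\<And>x. x \<in> topspace U \<Longrightarrow> j (r x) = x"
    using hom by (auto simp: homeomorphic_maps_def)
  have "U homeomorphic_space Euclidean_space n" using hom by (auto simp: homeomorphic_space_def)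
  then show "path_connected_space U" using homeomorphic_path_connected_space path_connected_Euclidean_space by blast
  fix x assume x: "x \<in> topspace U"
  let ?P = "\<lambda>s. s 0 = x \<and> s 1 = x"
  have eq: "loop_class U x g = loop_class U x (\<lambda>_. x)" if g: "g \<in> loops U x" for g
  proof -
    have gp: "pathin U g" "g 0 = x" "g 1 = x" using g by (auto simp: loops_def)
    have "homotopic_with (\<lambda>s. s 0 = r x \<and> s 1 = r x) (top_of_set {0..1}) (Euclidean_space n) (\<lambda>_. r x) (r \<circ> g)"
      by (rule homotopic_paths_Euclidean_space)
         (use pathin_compose[OF gp(1) cr] gp continuous_map_in_topspace[OF cr x] in auto)
    then have "homotopic_with ?P (top_of_set {0..1}) U (j \<circ> (\<lambda>_. r x)) (j \<circ> (r \<circ> g))"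
      by (rule homotopic_with_compose_continuous_map_left) (use cj jr[OF x] in auto)
    then have h: "homotopic_with ?P (top_of_set {0..1}) U (\<lambda>_. x) g"
      by (rule homotopic_with_eq)
         (use jr[OF x] jr continuous_map_in_topspace[OF gp(1)[unfolded pathin_def]] in auto)
    show ?thesis
      unfolding loop_class_def using homotopic_with_trans[OF h] homotopic_with_trans[OF homotopic_with_symD[OF h]] by blast
  qed
  have "(\<lambda>_. x) \<in> loops U x" using x by (simp add: loops_def)
  then have "(\<lambda>_. loop_class U x (\<lambda>_. x)) ` loops U x = {loop_class U x (\<lambda>_. x)}" by (rule image_constant)
  moreover have "loop_class U x ` loops U x = (\<lambda>_. loop_class U x (\<lambda>_. x)) ` loops U x"
    by (rule image_cong[OF refl eq])
  ultimately show "carrier (fundamental_group U x) = {\<one>\<^bsub>fundamental_group U x\<^esub>}"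
    by (simp add: fundamental_group_def)
qed

lemma admits_universal_covering_torus: "admits_universal_covering (torus n)"
proof -
  let ?R = "Euclidean_space n"
  \<comment> \<open>A copy of Euclidean space inside the type that
    \<open>admits_universal_covering\<close> demands: a point becomes the singleton of a constant
    function, and \<open>r\<close> reads it back.\<close>
  define j where "j x = {\<lambda>_::real. \<lambda>i::nat. complex_of_real (x i)}" for x :: "nat \<Rightarrow> real"
  define r where "r S = (\<lambda>i. Re ((THE f. f \<in> S) 0 i))" for S :: "(real \<Rightarrow> nat \<Rightarrow> complex) set"
  have rj: "r (j x) = x" for x by (simp add: r_def j_def)
  define U where "U = pullback_topology (j ` topspace ?R) r ?R"
  have tU: "topspace U = j ` topspace ?R"
    by (auto simp: U_def topspace_pullback_topology rj)
  have "continuous_map U ?R (id \<circ> r)" unfolding U_def by (rule continuous_map_pullback) simp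
  moreover have "continuous_map ?R U j"
    unfolding U_def by (rule continuous_map_pullback') (auto simp: o_def rj continuous_map_id[unfolded id_def])
  ultimately have hom: "homeomorphic_maps U ?R r j"
    by (auto simp: homeomorphic_maps_def tU rj)
  show ?thesis
    unfolding admits_universal_covering_def
    using simply_connected_homeomorphic_Euclidean_space[OF hom]
      covering_map_precompose_homeomorphism[OF covering_map_torus_exp hom] by blast
qed

text \<open>Recursion instead of a maximum over a set gives the value \<open>0\<close> for
  \<open>d = 0\<close> and continuity by induction.\<close>

fun sup_norm :: "nat \<Rightarrow> (nat \<Rightarrow> real) \<Rightarrow> real" where
  "sup_norm 0 x = 0"
| "sup_norm (Suc d) x = max (sup_norm d x) \<bar>x d\<bar>"

definition euclid_norm :: "nat \<Rightarrow> (nat \<Rightarrow> real) \<Rightarrow> real" where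
  "euclid_norm d x = sqrt (\<Sum>i<d. (x i)\<^sup>2)"

text \<open>Multiplies a vector by the quotient of two norms, and thus carries the unit ball of \<open>M\<close> to that of
  \<open>N\<close>.\<close>

definition radial_map :: "((nat \<Rightarrow> real) \<Rightarrow> real) \<Rightarrow> ((nat \<Rightarrow> real) \<Rightarrow> real) \<Rightarrow> (nat \<Rightarrow> real) \<Rightarrow> nat \<Rightarrow> real" where
  "radial_map M N x = (\<lambda>i. x i * (M x / N x))"

text \<open>The bound on the coordinates makes \<open>N\<close> vanish only at the origin and bounds
  \<open>x i / N x\<close>, which yields continuity of \<open>radial_map\<close> at the
  origin.\<close>

definition coord_norm :: "nat \<Rightarrow> ((nat \<Rightarrow> real) \<Rightarrow> real) \<Rightarrow> bool" where
  "coord_norm d N \<longleftrightarrow> continuous_map (Euclidean_space d) euclideanreal N \<and>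
     (\<forall>x i. i < d \<longrightarrow> \<bar>x i\<bar> \<le> N x) \<and> (\<forall>x t. 0 \<le> t \<longrightarrow> N (\<lambda>i. x i * t) = N x * t) \<and> (\<forall>x. 0 \<le> N x)"

lemma sup_norm_nonneg: "0 \<le> sup_norm d x"
  by (induction d) auto

lemma sup_norm_less_iff: "0 < b \<Longrightarrow> sup_norm d x < b \<longleftrightarrow> (\<forall>i<d. \<bar>x i\<bar> < b)"
  by (induction d) (auto simp: less_Suc_eq)

lemma sup_norm_attained: "d = 0 \<or> (\<exists>i<d. sup_norm d x = \<bar>x i\<bar>)"
proof (induction d)
  case (Suc d)
  then show ?case by (cases "d = 0") (auto simp: max_def less_Suc_eq)
qed simp

lemma coord_norm_sup_norm: "coord_norm d (sup_norm d)"
  unfolding coord_norm_def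
proof (intro conjI allI impI)
  have "continuous_map (Euclidean_space n) euclideanreal (sup_norm d)" for n
  proof (induction d)
    case 0
    have "sup_norm 0 = (\<lambda>x. 0)" by auto
    then show ?case by simp
  next
    case (Suc d)
    have "sup_norm (Suc d) = (\<lambda>x. max (sup_norm d x) \<bar>x d\<bar>)" by auto
    then show ?case using Suc by (auto intro!: continuous_map_real_max continuous_map_real_abs continuous_map_Euclidean_coord)
  qed
  then show "continuous_map (Euclidean_space d) euclideanreal (sup_norm d)" .
  show "\<bar>x i\<bar> \<le> sup_norm d x" if "i < d" for x i
    using that by (induction d) (auto simp: less_Suc_eq)
  show "sup_norm d (\<lambda>i. x i * t) = sup_norm d x * t" if "0 \<le> t" for x t
    using that by (induction d) (auto simp: abs_mult max_mult_distrib_right)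
qed (rule sup_norm_nonneg)

lemma coord_norm_euclid_norm: "coord_norm d (euclid_norm d)"
  unfolding coord_norm_def euclid_norm_def
proof (intro conjI allI impI)
  show "continuous_map (Euclidean_space d) euclideanreal (\<lambda>x. sqrt (\<Sum>i<d. (x i)\<^sup>2))"
    by (intro continuous_map_sqrt continuous_map_sum continuous_map_real_pow continuous_map_Euclidean_coord) auto
  show "\<bar>x i\<bar> \<le> sqrt (\<Sum>i<d. (x i)\<^sup>2)" if "i < d" for x :: "nat \<Rightarrow> real" and i
  proof -
    have "(x i)\<^sup>2 \<le> (\<Sum>i<d. (x i)\<^sup>2)" by (rule member_le_sum) (use that in auto)
    then show ?thesis by (metis real_sqrt_abs real_sqrt_le_mono)
  qed
  show "sqrt (\<Sum>i<d. (x i * t)\<^sup>2) = sqrt (\<Sum>i<d. (x i)\<^sup>2) * t" if "0 \<le> t" for x :: "nat \<Rightarrow> real" and t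
    using that by (simp add: power_mult_distrib sum_distrib_right[symmetric] real_sqrt_mult)
qed (simp add: sum_nonneg)

lemma coord_normD:
  assumes "coord_norm d N"
  shows "continuous_map (Euclidean_space d) euclideanreal N" "i < d \<Longrightarrow> \<bar>x i\<bar> \<le> N x"
    "0 \<le> t \<Longrightarrow> N (\<lambda>i. x i * t) = N x * t" "0 \<le> N x"
  using assms by (auto simp: coord_norm_def)

lemma coord_norm_zero: "coord_norm d N \<Longrightarrow> N (\<lambda>_. 0) = 0"
  using coord_normD(3)[of d N 0 "\<lambda>_. 0"] by simp

lemma coord_norm_eq_0:
  assumes "coord_norm d N" "x \<in> topspace (Euclidean_space d)" "N x = 0"
  shows "x = (\<lambda>_. 0)"
proof
  fix i show "x i = 0"
  proof (cases "i < d")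
    case True
    then show ?thesis using coord_normD(2)[OF assms(1) True, of x] assms(3) by simp
  qed (use assms(2) in \<open>simp add: in_Euclidean_space\<close>)
qed

text \<open>By homogeneity the two scalings cancel. At the origin the quotient is
  \<open>0 / 0 = 0\<close>, and the origin is indeed fixed.\<close>

lemma radial_map_inverse:
  assumes M: "coord_norm d M" and N: "coord_norm d N" and x: "x \<in> topspace (Euclidean_space d)"
  shows "N (radial_map M N x) = M x" "radial_map N M (radial_map M N x) = x"
    "radial_map M N x \<in> topspace (Euclidean_space d)"
proof -
  have z: "M (\<lambda>_. 0) = 0" "N (\<lambda>_. 0) = 0"
    using coord_norm_zero[OF M] coord_norm_zero[OF N] by auto
  have h: "N (radial_map M N x) = N x * (M x / N x)" "M (radial_map M N x) = M x * (M x / N x)"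
    unfolding radial_map_def
    by (rule coord_normD(3)[OF N], simp add: coord_normD(4)[OF M] coord_normD(4)[OF N],
        rule coord_normD(3)[OF M], simp add: coord_normD(4)[OF M] coord_normD(4)[OF N])
  have 0: "x = (\<lambda>_. 0)" if "N x = 0 \<or> M x = 0" using coord_norm_eq_0[OF M x] coord_norm_eq_0[OF N x] that by auto
  show 1: "N (radial_map M N x) = M x" using h(1) 0 z by (cases "N x = 0") auto
  show "radial_map N M (radial_map M N x) = x"
  proof (cases "N x = 0 \<or> M x = 0")
    case True
    then show ?thesis using 0 by (auto simp: radial_map_def)
  next
    case False
    then have "radial_map N M (radial_map M N x) i = x i" for i
      unfolding radial_map_def[of N M] 1 h(2) by (simp add: radial_map_def)
    then show ?thesis by blast
  qed
  show "radial_map M N x \<in> topspace (Euclidean_space d)"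
    using x by (simp add: in_Euclidean_space radial_map_def)
qed

text \<open>Away from the origin this is a quotient of continuous functions. At the origin the bound
  by \<open>M x\<close> forces the limit \<open>0\<close>.\<close>

lemma continuous_map_radial_coord:
  assumes M: "coord_norm d M" and N: "coord_norm d N" and i: "i < d"
  shows "continuous_map (Euclidean_space d) euclideanreal (\<lambda>x. x i * (M x / N x))"
    (is "continuous_map ?R _ ?h")
proof -
  have cM: "continuous_map ?R euclideanreal M" and cN: "continuous_map ?R euclideanreal N"
    and M0: "\<And>x. 0 \<le> M x" and N0: "\<And>x. 0 \<le> N x" and Ni: "\<And>x. \<bar>x i\<bar> \<le> N x"
    using coord_normD[OF M] coord_normD[OF N] i by auto
  have bound: "\<bar>?h x\<bar> \<le> M x" for x
  proof -
    have "\<bar>?h x\<bar> = (\<bar>x i\<bar> / N x) * M x" using M0[of x] N0[of x] by (simp add: abs_mult)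
    also have "\<dots> \<le> 1 * M x"
      by (intro mult_right_mono M0) (use Ni[of x] N0[of x] in \<open>auto simp: divide_le_eq_1\<close>)
    finally show ?thesis by simp
  qed
  define D where "D = {x \<in> topspace ?R. N x \<in> - {0}}"
  have oD: "openin ?R D" unfolding D_def by (rule openin_continuous_map_preimage[OF cN]) (simp add: open_Compl)
  have cD: "continuous_map (subtopology ?R D) euclideanreal ?h"
    using cM cN by (intro continuous_map_real_mult continuous_map_real_divide continuous_map_from_subtopology continuous_map_Euclidean_coord)
      (auto simp: D_def)
  have "openin ?R {x \<in> topspace ?R. ?h x \<in> T}" if T: "open T" for T
  proof (subst openin_subopen, intro ballI)
    fix x assume x: "x \<in> {x \<in> topspace ?R. ?h x \<in> T}"
    show "\<exists>W. openin ?R W \<and> x \<in> W \<and> W \<subseteq> {x \<in> topspace ?R. ?h x \<in> T}"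
    proof (cases "N x = 0")
      case False
      have "openin (subtopology ?R D) {x \<in> topspace (subtopology ?R D). ?h x \<in> T}"
        by (rule openin_continuous_map_preimage[OF cD]) (use T in simp)
      then have "openin ?R {x \<in> topspace (subtopology ?R D). ?h x \<in> T}" using oD openin_trans_full by blast
      moreover have "x \<in> {x \<in> topspace (subtopology ?R D). ?h x \<in> T}" using x False by (simp add: D_def)
      ultimately show ?thesis by (intro exI[of _ "{x \<in> topspace (subtopology ?R D). ?h x \<in> T}"]) auto
    next
      case True
      then have x0: "x = (\<lambda>_. 0)" using coord_norm_eq_0[OF N, of x] x by simp
      have Mx: "M x = 0" unfolding x0 by (rule coord_norm_zero[OF M])
      have "0 \<in> T" using x x0 by simp
      then obtain e where e: "e > 0" "\<And>y. \<bar>y\<bar> < e \<Longrightarrow> y \<in> T"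
        using T unfolding open_dist dist_real_def by force
      have "openin ?R {y \<in> topspace ?R. M y \<in> {..<e}}" by (rule openin_continuous_map_preimage[OF cM]) simp
      moreover have "{y \<in> topspace ?R. M y \<in> {..<e}} \<subseteq> {x \<in> topspace ?R. ?h x \<in> T}"
        using e(2) le_less_trans[OF bound] by auto
      ultimately show ?thesis using x Mx e(1) by (intro exI[of _ "{y \<in> topspace ?R. M y \<in> {..<e}}"]) auto
    qed
  qed
  then show ?thesis by (simp add: continuous_map_def)
qed

lemma continuous_map_radial_map:
  assumes "coord_norm d M" "coord_norm d N"
  shows "continuous_map (Euclidean_space d) (Euclidean_space d) (radial_map M N)"
  unfolding continuous_map_Euclidean_space radial_map_def
  using continuous_map_radial_coord[OF assms] by (auto simp: in_Euclidean_space)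

text \<open>A cell of the product structure in which the circle has the single vertex
  \<open>1\<close>: the coordinates in \<open>S\<close> run through the open arc, the others rest at
  the vertex.\<close>

definition torus_cell :: "nat \<Rightarrow> nat set \<Rightarrow> (nat \<Rightarrow> complex) set" where
  "torus_cell k S = {w \<in> topspace (torus k). \<forall>i<k. w i \<noteq> 1 \<longleftrightarrow> i \<in> S}"

text \<open>The ball is carried radially onto the cube, and the cube coordinatewise to the
  circle.\<close>

lemma torus_cell_characteristic_map:
  assumes S: "S \<subseteq> {..<k}" and d: "d = card S"
  shows "\<exists>\<phi>. continuous_map (Euclidean_space d) (torus k) \<phi> \<and> \<phi> ` cw_open_disk d = torus_cell k S \<and>
     homeomorphic_map (subtopology (Euclidean_space d) (cw_open_disk d)) (subtopology (torus k) (torus_cell k S)) \<phi> \<and>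
     \<phi> ` (cw_disk d - cw_open_disk d) \<subseteq> (\<Union>S' \<in> {S'. S' \<subset> S}. torus_cell k S')"
proof -
  let ?R = "Euclidean_space d"
  have "finite S" using S finite_subset by blast
  then obtain e where e: "bij_betw e {0..<d} S" unfolding d using ex_bij_betw_nat_finite by blast
  define pos where "pos = inv_into {0..<d} e"
  have pos: "pos i < d" "e (pos i) = i" if "i \<in> S" for i
    using that e bij_betw_inv_into_right[OF e that] bij_betwE[OF bij_betw_inv_into[OF e]] by (auto simp: pos_def)
  have ej: "e j \<in> S" "pos (e j) = j" if "j < d" for j
    using that bij_betwE[OF e] bij_betw_inv_into_left[OF e, of j] by (auto simp: pos_def)
  let ?\<rho> = "radial_map (euclid_norm d) (sup_norm d)"
  let ?\<rho>' = "radial_map (sup_norm d) (euclid_norm d)"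
  note inv1 = radial_map_inverse[OF coord_norm_euclid_norm coord_norm_sup_norm]
  note inv2 = radial_map_inverse[OF coord_norm_sup_norm coord_norm_euclid_norm]
  \<comment> \<open>The sign sends both ends \<open>-1\<close> and \<open>1\<close> of the interval
    to the vertex \<open>1\<close>. The inverse is then the principal argument of
    \<open>- w\<close>, which is continuous off the vertex.\<close>
  define \<tau> where "\<tau> y = (\<lambda>i\<in>{..<k}. if i \<in> S then - cis (pi * y (pos i)) else 1)" for y
  define \<tau>' where "\<tau>' w = (\<lambda>j. if j < d then Arg (- w (e j)) / pi else 0)" for w :: "nat \<Rightarrow> complex"
  have \<tau>_in: "\<tau> y \<in> topspace (torus k)" for y by (simp add: topspace_torus \<tau>_def)
  have c\<tau>: "continuous_map ?R (torus k) \<tau>"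
    unfolding continuous_map_torus
  proof (intro conjI allI impI ballI \<tau>_in)
    fix i assume i: "i < k"
    have "continuous_map euclideanreal euclidean (\<lambda>t. - cis (pi * t))" by (simp add: continuous_intros)
    from continuous_map_compose[OF continuous_map_Euclidean_coord[of d "pos i"] this]
    show "continuous_map ?R euclidean (\<lambda>x. \<tau> x i)" using i by (simp add: \<tau>_def o_def)
  qed
  have cell_u: "norm (- w i) = 1" "- w i \<noteq> -1" if "w \<in> torus_cell k S" "i \<in> S" for w i
    using that S by (auto simp: torus_cell_def topspace_torus)
  have \<tau>'\<tau>: "\<tau>' (\<tau> y) = y" if y: "y \<in> topspace ?R" "\<forall>j<d. \<bar>y j\<bar> < 1" for y
  proof
    fix j show "\<tau>' (\<tau> y) j = y j"
    proof (cases "j < d")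
      case True
      have "e j < k" using ej(1)[OF True] S by auto
      then have "\<tau>' (\<tau> y) j = Arg (cis (2 * pi * (y j / 2))) / pi" using ej[OF True] True by (simp add: \<tau>'_def \<tau>_def)
      also have "\<dots> = y j" using y(2) True by (subst Arg_cis_2pi) auto
      finally show ?thesis .
    qed (use y in \<open>simp add: \<tau>'_def in_Euclidean_space\<close>)
  qed
  have \<tau>_cell: "\<tau> y \<in> torus_cell k S" if y: "y \<in> topspace ?R" "\<forall>j<d. \<bar>y j\<bar> < 1" for y
  proof -
    have "- cis (pi * y j) \<noteq> 1" if "j < d" for j
    proof
      assume "- cis (pi * y j) = 1"
      then have "cis (2 * pi * (y j / 2)) = -1" by (simp add: minus_equation_iff)
      moreover have "Arg (cis (2 * pi * (y j / 2))) = 2 * pi * (y j / 2)" by (rule Arg_cis_2pi) (use y(2) that in auto)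
      moreover have "Arg (-1) = pi" by (simp add: Arg_eq_pi)
      ultimately have "y j = 1" by simp
      then show False using y(2) that by auto
    qed
    then show ?thesis using \<tau>_in pos(1) by (auto simp: torus_cell_def \<tau>_def)
  qed
  have \<tau>'_cube: "\<tau>' w \<in> topspace ?R" "\<forall>j<d. \<bar>\<tau>' w j\<bar> < 1" "\<tau> (\<tau>' w) = w" if w: "w \<in> torus_cell k S" for w
  proof -
    show "\<tau>' w \<in> topspace ?R" by (simp add: \<tau>'_def in_Euclidean_space)
    show "\<forall>j<d. \<bar>\<tau>' w j\<bar> < 1"
    proof (intro allI impI)
      fix j assume j: "j < d"
      have "\<bar>Arg (- w (e j)) / (2 * pi)\<bar> < 1/2"
        by (rule Arg_circle_bound(1)[OF cell_u(1)[OF w ej(1)[OF j]] cell_u(2)[OF w ej(1)[OF j]]])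
      then show "\<bar>\<tau>' w j\<bar> < 1" using j by (simp add: \<tau>'_def abs_divide)
    qed
    show "\<tau> (\<tau>' w) = w"
    proof
      fix i
      consider "i \<in> S" | "i < k" "i \<notin> S" | "i \<ge> k" by linarith
      then show "\<tau> (\<tau>' w) i = w i"
      proof cases
        case 1
        then have "i < k" using S by auto
        have "cis (Arg (- w i)) = - w i" by (rule Arg_circle_bound(3)[OF cell_u(1)[OF w 1] cell_u(2)[OF w 1]])
        then show ?thesis using 1 \<open>i < k\<close> pos[OF 1] by (simp add: \<tau>_def \<tau>'_def)
      next
        case 2
        then show ?thesis using w by (auto simp: \<tau>_def torus_cell_def)
      next
        case 3
        then show ?thesis using w by (simp add: \<tau>_def torus_cell_def topspace_torus extensional_def)
      qed
    qed
  qed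
  have c\<tau>': "continuous_map (subtopology (torus k) (torus_cell k S)) ?R \<tau>'"
    unfolding continuous_map_Euclidean_space
  proof (intro conjI allI impI ballI)
    fix j assume j: "j < d"
    have ek: "e j < k" using ej(1)[OF j] S by auto
    have "- w (e j) \<notin> \<real>\<^sub>\<le>\<^sub>0" if "w \<in> torus_cell k S" for w
      by (rule Arg_circle_bound(2)[OF cell_u(1)[OF that ej(1)[OF j]] cell_u(2)[OF that ej(1)[OF j]]])
    then have "continuous_map (subtopology (torus k) (torus_cell k S)) (top_of_set {c. - c \<notin> \<real>\<^sub>\<le>\<^sub>0}) (\<lambda>w. w (e j))"
      using continuous_map_torus_coord[OF ek] by (auto simp: continuous_map_in_subtopology continuous_map_from_subtopology)
    moreover have "continuous_map (top_of_set {c. - c \<notin> \<real>\<^sub>\<le>\<^sub>0}) euclideanreal (\<lambda>c. Arg (- c) / pi)"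
      unfolding continuous_map_iff_continuous by (intro continuous_intros) auto
    ultimately show "continuous_map (subtopology (torus k) (torus_cell k S)) euclideanreal (\<lambda>w. \<tau>' w j)"
      using continuous_map_compose[of _ "top_of_set {c. - c \<notin> \<real>\<^sub>\<le>\<^sub>0}" "\<lambda>w. w (e j)" euclideanreal "\<lambda>c. Arg (- c) / pi"] j
      by (simp add: \<tau>'_def o_def)
  qed (simp add: \<tau>'_def)
  define \<phi> where "\<phi> = \<tau> \<circ> ?\<rho>"
  have c\<rho>: "continuous_map ?R ?R ?\<rho>" "continuous_map ?R ?R ?\<rho>'"
    by (rule continuous_map_radial_map[OF coord_norm_euclid_norm coord_norm_sup_norm],
        rule continuous_map_radial_map[OF coord_norm_sup_norm coord_norm_euclid_norm])
  have c\<phi>: "continuous_map ?R (torus k) \<phi>" unfolding \<phi>_def by (rule continuous_map_compose[OF c\<rho>(1) c\<tau>])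
  have od: "x \<in> cw_open_disk d \<longleftrightarrow> x \<in> topspace ?R \<and> euclid_norm d x < 1" for x
    by (simp add: cw_open_disk_def euclid_norm_def)
  have cube: "\<forall>j<d. \<bar>?\<rho> x j\<bar> < 1" if "x \<in> cw_open_disk d" for x
    using that inv1(1)[of x] sup_norm_less_iff[of 1 d "?\<rho> x"] by (simp add: od)
  have \<rho>'od: "?\<rho>' y \<in> cw_open_disk d" if "y \<in> topspace ?R" "\<forall>j<d. \<bar>y j\<bar> < 1" for y
    using that inv2(1,3)[of y] sup_norm_less_iff[of 1 d y] by (simp add: od)
  have \<phi>_cell: "\<phi> x \<in> torus_cell k S" if "x \<in> cw_open_disk d" for x
    using \<tau>_cell[OF inv1(3) cube[OF that]] that by (simp add: \<phi>_def od)
  define \<sigma> where "\<sigma> w = ?\<rho>' (\<tau>' w)" for w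
  have \<sigma>od: "\<sigma> w \<in> cw_open_disk d" and \<phi>\<sigma>: "\<phi> (\<sigma> w) = w" if "w \<in> torus_cell k S" for w
    using \<rho>'od[OF \<tau>'_cube(1,2)[OF that]] inv2(2)[OF \<tau>'_cube(1)[OF that]] \<tau>'_cube(3)[OF that]
    by (simp_all add: \<phi>_def \<sigma>_def)
  have \<sigma>\<phi>: "\<sigma> (\<phi> x) = x" if "x \<in> cw_open_disk d" for x
    using \<tau>'\<tau>[OF inv1(3) cube[OF that]] inv1(2)[of x] that by (simp add: \<phi>_def \<sigma>_def od)
  have im: "\<phi> ` cw_open_disk d = torus_cell k S"
    using \<phi>_cell \<sigma>od \<phi>\<sigma> by (metis image_eqI image_subsetI subsetI subset_antisym)
  have tod: "topspace (subtopology ?R (cw_open_disk d)) = cw_open_disk d" by (auto simp: cw_open_disk_def)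
  have tcell: "topspace (subtopology (torus k) (torus_cell k S)) = torus_cell k S" by (auto simp: torus_cell_def)
  have "homeomorphic_maps (subtopology ?R (cw_open_disk d)) (subtopology (torus k) (torus_cell k S)) \<phi> \<sigma>"
    unfolding homeomorphic_maps_def tod tcell
  proof (intro conjI ballI)
    show "continuous_map (subtopology ?R (cw_open_disk d)) (subtopology (torus k) (torus_cell k S)) \<phi>"
      using \<phi>_cell tod by (auto simp: continuous_map_in_subtopology continuous_map_from_subtopology[OF c\<phi>])
    have "continuous_map (subtopology (torus k) (torus_cell k S)) ?R \<sigma>"
      using continuous_map_compose[OF c\<tau>' c\<rho>(2)] by (simp add: \<sigma>_def[abs_def] o_def)
    then show "continuous_map (subtopology (torus k) (torus_cell k S)) (subtopology ?R (cw_open_disk d)) \<sigma>"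
      using \<sigma>od tcell by (auto simp: continuous_map_in_subtopology)
  qed (use \<phi>\<sigma> \<sigma>\<phi> in auto)
  then have hom: "homeomorphic_map (subtopology ?R (cw_open_disk d)) (subtopology (torus k) (torus_cell k S)) \<phi>"
    using homeomorphic_map_maps by blast
  have "\<phi> x \<in> (\<Union>S' \<in> {S'. S' \<subset> S}. torus_cell k S')" if x: "x \<in> cw_disk d - cw_open_disk d" for x
  proof -
    have xR: "x \<in> topspace ?R" and en: "euclid_norm d x = 1"
      using x by (auto simp: cw_disk_def cw_open_disk_def euclid_norm_def)
    \<comment> \<open>A boundary point of the ball reaches a face of the cube, where some coordinate
      sits at the vertex and so drops out of \<open>S\<close>.\<close>
    have sn: "sup_norm d (?\<rho> x) = 1" using inv1(1)[OF xR] en by simp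
    then have "d \<noteq> 0" by (cases d) auto
    then obtain j where j: "j < d" "\<bar>?\<rho> x j\<bar> = 1" using sup_norm_attained[of d "?\<rho> x"] sn by auto
    have "cis (pi * ?\<rho> x j) = -1" using j(2) by (cases "?\<rho> x j = 1") (auto simp: abs_if complex_eq_iff split: if_splits)
    then have "\<phi> x (e j) = 1" using ej[OF j(1)] S by (auto simp: \<phi>_def \<tau>_def)
    moreover have "\<phi> x i = 1" if "i < k" "i \<notin> S" for i using that by (simp add: \<phi>_def \<tau>_def)
    ultimately have "{i. i < k \<and> \<phi> x i \<noteq> 1} \<subset> S" using ej(1)[OF j(1)] by blast
    moreover have "\<phi> x \<in> torus_cell k {i. i < k \<and> \<phi> x i \<noteq> 1}"
      using continuous_map_in_topspace[OF c\<phi> xR] by (auto simp: torus_cell_def)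
    ultimately show ?thesis by blast
  qed
  then show ?thesis using c\<phi> im hom by blast
qed

lemma Hausdorff_space_torus: "Hausdorff_space (torus k)"
  unfolding torus_def by (simp add: Hausdorff_space_product_topology Hausdorff_space_subtopology)

theorem cw_structure_torus: "\<exists>C. cw_structure (torus k) C \<and> (\<forall>(d, \<phi>) \<in> C. d \<le> k)"
proof -
  let ?P = "\<lambda>S \<phi>. continuous_map (Euclidean_space (card S)) (torus k) \<phi> \<and> \<phi> ` cw_open_disk (card S) = torus_cell k S \<and>
     homeomorphic_map (subtopology (Euclidean_space (card S)) (cw_open_disk (card S))) (subtopology (torus k) (torus_cell k S)) \<phi> \<and>
     \<phi> ` (cw_disk (card S) - cw_open_disk (card S)) \<subseteq> (\<Union>S' \<in> {S'. S' \<subset> S}. torus_cell k S')"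
  have "\<exists>\<phi>. ?P S \<phi>" if "S \<subseteq> {..<k}" for S using torus_cell_characteristic_map[OF that refl] .
  then obtain \<Phi> where \<Phi>: "\<And>S. S \<subseteq> {..<k} \<Longrightarrow> ?P S (\<Phi> S)" by metis
  define c where "c S = (card S, \<Phi> S)" for S
  define C where "C = c ` Pow {..<k}"
  have im: "\<Phi> S ` cw_open_disk (card S) = torus_cell k S" if "S \<subseteq> {..<k}" for S using \<Phi>[OF that] by blast
  have finC: "finite C" by (simp add: C_def)
  have cover: "w \<in> torus_cell k {i. i < k \<and> w i \<noteq> 1}" if "w \<in> topspace (torus k)" for w
    using that by (auto simp: torus_cell_def)
  have disj: "S = S'" if "S \<subseteq> {..<k}" "S' \<subseteq> {..<k}" "w \<in> torus_cell k S" "w \<in> torus_cell k S'" for S S' w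
    using that by (auto simp: torus_cell_def)
  have un: "(\<Union>(d, \<phi>) \<in> C. \<phi> ` cw_open_disk d) = topspace (torus k)"
  proof -
    have "(\<Union>(d, \<phi>) \<in> C. \<phi> ` cw_open_disk d) = (\<Union>S \<in> Pow {..<k}. \<Phi> S ` cw_open_disk (card S))"
      by (simp add: C_def c_def)
    also have "\<dots> = (\<Union>S \<in> Pow {..<k}. torus_cell k S)" using im by simp
    also have "\<dots> = topspace (torus k)"
    proof (intro equalityI subsetI)
      fix w assume w: "w \<in> topspace (torus k)"
      have "{i. i < k \<and> w i \<noteq> 1} \<in> Pow {..<k}" by auto
      then show "w \<in> (\<Union>S \<in> Pow {..<k}. torus_cell k S)" using cover[OF w] by blast
    qed (auto simp: torus_cell_def)
    finally show ?thesis .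
  qed
  have "cw_structure (torus k) C"
    unfolding cw_structure_def
  proof (intro conjI)
    show "Hausdorff_space (torus k)" by (rule Hausdorff_space_torus)
    show "\<forall>(d, \<phi>) \<in> C. continuous_map (subtopology (Euclidean_space d) (cw_disk d)) (torus k) \<phi> \<and>
        homeomorphic_map (subtopology (Euclidean_space d) (cw_open_disk d)) (subtopology (torus k) (\<phi> ` cw_open_disk d)) \<phi>"
      using \<Phi> by (auto simp: C_def c_def intro: continuous_map_from_subtopology)
    show "(\<Union>(d, \<phi>) \<in> C. \<phi> ` cw_open_disk d) = topspace (torus k)" by (rule un)
    show "pairwise (\<lambda>(d, \<phi>) (d', \<phi>'). disjnt (\<phi> ` cw_open_disk d) (\<phi>' ` cw_open_disk d')) C"
    proof (rule pairwiseI)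
      fix x y assume xy: "x \<in> C" "y \<in> C" "x \<noteq> y"
      then obtain S S' where S: "S \<subseteq> {..<k}" "S' \<subseteq> {..<k}" "x = c S" "y = c S'" by (auto simp: C_def)
      then have "S \<noteq> S'" using xy(3) by auto
      then have "disjnt (torus_cell k S) (torus_cell k S')" using disj[OF S(1,2)] by (auto simp: disjnt_iff)
      then show "(\<lambda>(d, \<phi>) (d', \<phi>'). disjnt (\<phi> ` cw_open_disk d) (\<phi>' ` cw_open_disk d')) x y"
        using im S by (simp add: c_def)
    qed
    show "\<forall>(d, \<phi>) \<in> C. \<exists>D \<subseteq> C. finite D \<and> (\<forall>(d', \<phi>') \<in> D. d' < d) \<and>
        \<phi> ` (cw_disk d - cw_open_disk d) \<subseteq> (\<Union>(d', \<phi>') \<in> D. \<phi>' ` cw_open_disk d')"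
    proof (clarsimp simp: C_def c_def)
      fix S assume S: "S \<subseteq> {..<k}"
      then have fS: "finite S" using finite_subset by blast
      let ?D = "c ` {S'. S' \<subset> S}"
      have "finite {S'. S' \<subset> S}" using fS by (auto intro: finite_subset[of _ "Pow S"])
      moreover have "?D \<subseteq> (\<lambda>S. (card S, \<Phi> S)) ` Pow {..<k}" using S by (auto simp: c_def)
      moreover have "\<forall>x\<in>?D. case x of (d', \<phi>') \<Rightarrow> d' < card S" using psubset_card_mono[OF fS] by (auto simp: c_def)
      moreover have "\<Phi> S ` (cw_disk (card S) - cw_open_disk (card S)) \<subseteq> (\<Union>(d', \<phi>') \<in> ?D. \<phi>' ` cw_open_disk d')"
      proof -
        have "(\<Union>(d', \<phi>') \<in> ?D. \<phi>' ` cw_open_disk d') = (\<Union>S' \<in> {S'. S' \<subset> S}. \<Phi> S' ` cw_open_disk (card S'))"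
          by (simp add: c_def)
        also have "\<dots> = (\<Union>S' \<in> {S'. S' \<subset> S}. torus_cell k S')" using im S by (intro SUP_cong refl) auto
        finally have eq: "(\<Union>(d', \<phi>') \<in> ?D. \<phi>' ` cw_open_disk d') = (\<Union>S' \<in> {S'. S' \<subset> S}. torus_cell k S')" .
        show ?thesis unfolding eq by (rule conjunct2[OF conjunct2[OF conjunct2[OF \<Phi>[OF S]]]])
      qed
      ultimately show "\<exists>D\<subseteq>(\<lambda>S. (card S, \<Phi> S)) ` Pow {..<k}. finite D \<and> (\<forall>x\<in>D. case x of (d', \<phi>') \<Rightarrow> d' < card S) \<and>
        \<Phi> S ` (cw_disk (card S) - cw_open_disk (card S)) \<subseteq> (\<Union>(d', \<phi>') \<in> D. \<phi>' ` cw_open_disk d')"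
        by (intro exI[of _ ?D]) simp
    qed
    show "\<forall>A \<subseteq> topspace (torus k). (\<forall>(d, \<phi>) \<in> C. closedin (torus k) (A \<inter> \<phi> ` cw_disk d)) \<longrightarrow> closedin (torus k) A"
    proof (intro allI impI)
      fix A assume A: "A \<subseteq> topspace (torus k)" "\<forall>(d, \<phi>) \<in> C. closedin (torus k) (A \<inter> \<phi> ` cw_disk d)"
      \<comment> \<open>There are finitely many cells, so \<open>A\<close> is a finite union of
        closed sets.\<close>
      have "closedin (torus k) (\<Union>(d, \<phi>) \<in> C. A \<inter> \<phi> ` cw_disk d)"
        using finC A(2) by (intro closedin_Union) auto
      moreover have "(\<Union>(d, \<phi>) \<in> C. A \<inter> \<phi> ` cw_disk d) = A"
      proof (intro equalityI subsetI)
        fix w assume w: "w \<in> A"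
        then have "w \<in> (\<Union>(d, \<phi>) \<in> C. \<phi> ` cw_open_disk d)" using A(1) un by blast
        then obtain d \<phi> where "(d, \<phi>) \<in> C" "w \<in> \<phi> ` cw_open_disk d" by auto
        moreover have "cw_open_disk d \<subseteq> cw_disk d" by (auto simp: cw_disk_def cw_open_disk_def)
        ultimately have "(d, \<phi>) \<in> C" "w \<in> A \<inter> \<phi> ` cw_disk d" using w by auto
        then show "w \<in> (\<Union>(d, \<phi>) \<in> C. A \<inter> \<phi> ` cw_disk d)" by force
      qed auto
      ultimately show "closedin (torus k) A" by simp
    qed
  qed
  moreover have "\<forall>(d, \<phi>) \<in> C. d \<le> k"
    using card_mono[of "{..<k}"] by (auto simp: C_def c_def)
  ultimately show ?thesis by blast
qed

lemma space_of_dim_at_most_torus: "space_of_dim_at_most TYPE(nat \<Rightarrow> complex) k (torus k)"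
  unfolding space_of_dim_at_most_def
  using admits_universal_covering_torus cw_structure_torus[of k] homotopy_equivalent_space_refl by blast

text \<open>The first conjunct fixes the types that the torus construction produces; the type
  variables of the second express necessity for every base, complex and total space.\<close>

theorem theorem7:
  fixes n k :: nat
    and E :: "'e topology" and e0 :: 'e and x0 :: "nat \<Rightarrow> complex" and p :: "'e \<Rightarrow> (nat \<Rightarrow> complex)"
  assumes "pointed_covering E e0 (torus n) x0 p"
  shows
    "(inducible_from_dim_at_most
        TYPE(nat \<Rightarrow> complex) TYPE(nat \<Rightarrow> complex) TYPE((nat \<Rightarrow> complex) \<times> 'e) k E (torus n) p
      \<longleftrightarrow> direct_sum_of_cyclic_groups k (monodromy_group E (torus n) x0 p)) \<and>
     (inducible_from_dim_at_most TYPE('y) TYPE('c) TYPE('f) k E (torus n) p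
      \<longrightarrow> direct_sum_of_cyclic_groups k (monodromy_group E (torus n) x0 p) \<and>
          inducible_from TYPE((nat \<Rightarrow> complex) \<times> 'e) E (torus n) p (torus k))"
proof -
  let ?M = "monodromy_group E (torus n) x0 p"
  have cov: "covering_map E (torus n) p" and e0: "e0 \<in> topspace E" "p e0 = x0"
    using assms by (auto simp: pointed_covering_def)
  have x0: "x0 \<in> topspace (torus n)" using continuous_map_in_topspace[OF covering_mapD(1)[OF cov] e0(1)] e0(2) by simp
  then obtain a where a: "a \<in> topspace (Euclidean_space n)" "torus_exp n a = x0" by (rule torus_exp_surj)
  have torus: "inducible_from TYPE((nat \<Rightarrow> complex) \<times> 'e) E (torus n) p (torus k)"
    if "direct_sum_of_cyclic_groups k ?M"
  proof -
    have "\<exists>z. (\<forall>i<k. z i \<in> int_lattice n) \<and>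
      (\<forall>b\<in>int_lattice n. \<exists>w. (\<lambda>t. b t - (\<Sum>i<k. w i * z i t)) \<in> periods n E p)"
      by (rule generators_of_direct_sum[OF carrier_monodromy_group_torus[OF cov a(1)]
            mult_monodromy_group_torus[OF cov a(1)] deck_eq_iff[OF cov a(1)]]) (use that a(2) in auto)
    then obtain z where z: "\<forall>i<k. z i \<in> int_lattice n"
      "\<forall>b\<in>int_lattice n. \<exists>w. (\<lambda>t. b t - (\<Sum>i<k. w i * z i t)) \<in> periods n E p" by blast
    show ?thesis by (rule inducible_from_torus[OF cov e0(1)]) (use z in auto)
  qed
  have "inducible_from_dim_at_most TYPE(nat \<Rightarrow> complex) TYPE(nat \<Rightarrow> complex) TYPE((nat \<Rightarrow> complex) \<times> 'e) k E (torus n) p"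
    if "direct_sum_of_cyclic_groups k ?M"
    unfolding inducible_from_dim_at_most_def using space_of_dim_at_most_torus torus[OF that] by blast
  moreover have "direct_sum_of_cyclic_groups k ?M"
    if "inducible_from_dim_at_most TYPE(nat \<Rightarrow> complex) TYPE(nat \<Rightarrow> complex) TYPE((nat \<Rightarrow> complex) \<times> 'e) k E (torus n) p"
    by (rule direct_sum_of_inducible[OF cov x0 that])
  moreover have "direct_sum_of_cyclic_groups k ?M"
    if "inducible_from_dim_at_most TYPE('y) TYPE('c) TYPE('f) k E (torus n) p"
    by (rule direct_sum_of_inducible[OF cov x0 that])
  ultimately show ?thesis using torus by blast
qed

end
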